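(* Let $(b,B,m,\mu)$ be an admissible parameter set, let $(\mathcal{A},\operatorname{dom}(\mathcal{A}))$ be the generator of a strongly continuous semigroup on $H$, and let $D\in\mathcal{L}(H)$ be positive and self-adjoint. Then for every $u=(u_1,u_2)\in\mathrm{i}H\times\mathcal{H}^+$ and every $T\ge0$ there exists a unique mild solution $(\Phi(\cdot,u),(\psi_1(\cdot,u),\psi_2(\cdot,u)))$ on $[0,T]$ to the generalised Riccati equations $$\begin{aligned}\frac{\partial\Phi}{\partial t}(t,u)&=F(\psi_2(t,u)), & \Phi(0,u)&=0,\\ \psi_1(t,u)&=u_1-\mathrm{i}\mathcal{A}^*\Big(\mathrm{i}\int_0^t\psi_1(s,u)\,\mathrm{d}s\Big), & \psi_1(0,u)&=u_1,\\ \frac{\partial\psi_2}{\partial t}(t,u)&=R(\psi_1(t,u),\psi_2(t,u)), & \psi_2(0,u)&=u_2,\end{aligned}\qquad 0<t\le T,$$ where $F:\mathcal{H}^+\to\mathbb{R}$ and $R:\mathrm{i}H\times\mathcal{H}^+\to\mathcal{H}$ are $$F(u)=\langle b,u\rangle-\int_{\mathcal{H}^+\setminus\{0\}}\big(e^{-\langle\xi,u\rangle}-1+\langle\chi(\xi),u\rangle\big)m(\mathrm{d}\xi),$$ $$R(h,u)=B^*(u)-\tfrac12D^{1/2}h\otimes D^{1/2}h-\int_{\mathcal{H}^+\setminus\{0\}}\big(e^{-\langle\xi,u\rangle}-1+\langle\chi(\xi),u\rangle\big)\frac{\mu(\mathrm{d}\xi)}{\|\xi\|^2}.$$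
   Context: Notation. $H$ is a separable infinite-dimensional real Hilbert space with inner product $\langle\cdot,\cdot\rangle_H$; $\mathcal{L}(H)$ and $\mathcal{L}_2(H)$ are the bounded and the Hilbert–Schmidt operators. $\mathcal{H}=\{A\in\mathcal{L}_2(H):A=A^*\}$, $\mathcal{H}^+=\{A\in\mathcal{H}:\langle Ah,h\rangle_H\ge 0\ \forall h\in H\}$. $\langle\cdot,\cdot\rangle$, $\|\cdot\|$ denote the inner product and norm of $\mathcal{L}_2(H)$. For $a,b\in H$, $a\otimes b$ is the operator $h\mapsto\langle a,h\rangle_H b$. $\chi(\xi)=\xi1_{\{\|\xi\|\le1\}}$. $\mathrm{i}H=\{\mathrm{i}v:v\in H\}$; linear operators and $\otimes$ are extended complex-(bi)linearly, so $(\mathrm{i}a)\otimes(\mathrm{i}b)=-a\otimes b$. $\mathcal{A}^*$ is the adjoint of $\mathcal{A}$. Admissible parameter set $(b,B,m,\mu)$: (i) $b\in\mathcal{H}^+$; (ii) $m:\mathcal{B}(\mathcal{H}^+\setminus\{0\})\to[0,\infty]$ is a measure with $\int_{\mathcal{H}^+\setminus\{0\}}\|\xi\|^2\,m(\mathrm{d}\xi)<\infty$, $\int|\langle\chi(\xi),h\rangle|\,m(\mathrm{d}\xi)<\infty$ for all $h\in\mathcal{H}$, there is $I_m\in\mathcal{H}$ with $\langle I_m,h\rangle=\int\langle\chi(\xi),h\rangle\,m(\mathrm{d}\xi)$ for all $h\in\mathcal{H}$, and $\langle b,v\rangle-\int\langle\chi(\xi),v\rangle\,m(\mathrm{d}\xi)\ge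 0$ for all $v\in\mathcal{H}^+$; (iii) $\mu:\mathcal{B}(\mathcal{H}^+\setminus\{0\})\to\mathcal{H}^+$ is an $\mathcal{H}^+$-valued measure with $\int\langle\chi(\xi),u\rangle\frac{\langle\mu(\mathrm{d}\xi),x\rangle}{\|\xi\|^2}<\infty$ for all $u,x\in\mathcal{H}^+$ with $\langle u,x\rangle=0$; (iv) $B\in\mathcal{L}(\mathcal{H})$ satisfies $\langle B^*(u),x\rangle-\int\langle\chi(\xi),u\rangle\frac{\langle\mu(\mathrm{d}\xi),x\rangle}{\|\xi\|^2}\ge 0$ for all $x,u\in\mathcal{H}^+$ with $\langle u,x\rangle=0$. (All integrals are over $\mathcal{H}^+\setminus\{0\}$.) Mild solution on $[0,T]$: a triple with $\Phi(\cdot,u)\in C^1([0,T];\mathbb{R}^+)$ ($\mathbb{R}^+=[0,\infty)$), $\psi_1(\cdot,u)\in C([0,T];\mathrm{i}H)$, $\psi_2(\cdot,u)\in C^1([0,T];\mathcal{H}^+)$ satisfying the three equations with the given initial values (in particular $\mathrm{i}\int_0^t\psi_1(s,u)\,\mathrm{d}s\in\operatorname{dom}(\mathcal{A}^* )$). *)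

theory Defs
  imports "HOL-Analysis.Analysis"
begin

section \<open>Hilbert-Schmidt operators\<close>

text \<open>
  A separable real Hilbert space is a type of sort
  \<open>{real_inner, banach, second_countable_topology}\<close>: for metric spaces, separability is the
  second axiom of countability.
\<close>

definition orthonormal_basis :: "'a::real_inner set \<Rightarrow> bool" where
  "orthonormal_basis E \<longleftrightarrow>
     pairwise orthogonal E \<and> (\<forall>e\<in>E. norm e = 1) \<and> closure (span E) = UNIV"

lemma orthonormal_sum_inner:
  fixes F :: "'a::real_inner set"
  assumes "finite F" "pairwise orthogonal F" "\<forall>e\<in>F. norm e = 1" "f \<in> F"
  shows "(\<Sum>e\<in>F. c e *\<^sub>R e) \<bullet> f = c f"
proof -
  have "(\<Sum>e\<in>F. c e *\<^sub>R e) \<bullet> f = (\<Sum>e\<in>F. c e * (e \<bullet> f))"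
    by (simp add: inner_sum_left)
  also have "\<dots> = (\<Sum>e\<in>F. if e = f then c f else 0)"
    using assms by (intro sum.cong) (auto simp: pairwise_def orthogonal_def norm_eq_1)
  also have "\<dots> = c f" using assms by simp
  finally show ?thesis .
qed

lemma orthonormal_bessel:
  fixes F :: "'a::real_inner set"
  assumes "finite F" "pairwise orthogonal F" "\<forall>e\<in>F. norm e = 1"
  shows "(\<Sum>e\<in>F. (a \<bullet> e)\<^sup>2) \<le> (norm a)\<^sup>2"
proof -
  define p where "p = (\<Sum>e\<in>F. (a \<bullet> e) *\<^sub>R e)"
  have pf: "p \<bullet> f = a \<bullet> f" if "f \<in> F" for f
    unfolding p_def using orthonormal_sum_inner[OF assms that] .
  have pp: "p \<bullet> p = (\<Sum>e\<in>F. (a \<bullet> e)\<^sup>2)"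
  proof -
    have "p \<bullet> p = (\<Sum>e\<in>F. (a \<bullet> e) * (p \<bullet> e))"
      by (subst (2) p_def) (simp add: inner_sum_right)
    then show ?thesis by (simp add: pf power2_eq_square)
  qed
  have ap: "a \<bullet> p = (\<Sum>e\<in>F. (a \<bullet> e)\<^sup>2)"
    unfolding p_def by (simp add: inner_sum_right power2_eq_square)
  have "0 \<le> (a - p) \<bullet> (a - p)" by simp
  also have "\<dots> = a \<bullet> a - (\<Sum>e\<in>F. (a \<bullet> e)\<^sup>2)"
    by (simp add: inner_diff_left inner_diff_right pp ap inner_commute[of p a])
  finally show ?thesis by (simp add: power2_norm_eq_inner)
qed

fun gram_schmidt :: "(nat \<Rightarrow> 'a::real_inner) \<Rightarrow> nat \<Rightarrow> 'a set" where
  "gram_schmidt d 0 = {}"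
| "gram_schmidt d (Suc n) =
     (let r = d n - (\<Sum>e\<in>gram_schmidt d n. (d n \<bullet> e) *\<^sub>R e)
      in if r = 0 then gram_schmidt d n else insert (r /\<^sub>R norm r) (gram_schmidt d n))"

lemma gram_schmidt_orthonormal:
  "finite (gram_schmidt d n) \<and> pairwise orthogonal (gram_schmidt d n)
     \<and> (\<forall>e\<in>gram_schmidt d n. norm e = 1)"
proof (induction n)
  case 0
  then show ?case by (simp add: pairwise_def)
next
  case (Suc n)
  define r where "r = d n - (\<Sum>e\<in>gram_schmidt d n. (d n \<bullet> e) *\<^sub>R e)"
  have r: "r \<bullet> e = 0" if "e \<in> gram_schmidt d n" for e
    unfolding r_def using orthonormal_sum_inner[of "gram_schmidt d n" e "\<lambda>e. d n \<bullet> e"] Suc that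
    by (simp add: inner_diff_left)
  show ?case
  proof (cases "r = 0")
    case True
    then show ?thesis using Suc by (simp add: r_def Let_def)
  next
    case False
    then have "gram_schmidt d (Suc n) = insert (r /\<^sub>R norm r) (gram_schmidt d n)"
      by (simp add: r_def Let_def)
    then show ?thesis using Suc r False
      by (auto simp: pairwise_insert orthogonal_def inner_commute)
  qed
qed

lemma gram_schmidt_mono: "m \<le> n \<Longrightarrow> gram_schmidt d m \<subseteq> gram_schmidt d n"
  by (induction rule: dec_induct) (auto simp: Let_def)

lemma gram_schmidt_span: "d n \<in> span (gram_schmidt d (Suc n))"
proof -
  define s where "s = (\<Sum>e\<in>gram_schmidt d n. (d n \<bullet> e) *\<^sub>R e)"
  have s: "s \<in> span (gram_schmidt d (Suc n))"
    unfolding s_def using gram_schmidt_mono[of n "Suc n" d]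
    by (intro span_sum span_scale span_base) auto
  show ?thesis
  proof (cases "d n - s = 0")
    case True
    then show ?thesis using s by simp
  next
    case False
    then have "(d n - s) /\<^sub>R norm (d n - s) \<in> gram_schmidt d (Suc n)"
      by (simp add: s_def Let_def)
    then have "norm (d n - s) *\<^sub>R ((d n - s) /\<^sub>R norm (d n - s)) \<in> span (gram_schmidt d (Suc n))"
      by (intro span_scale span_base)
    then have "d n - s \<in> span (gram_schmidt d (Suc n))" using False by simp
    from span_add[OF this s] show ?thesis by simp
  qed
qed

lemma orthonormal_basis_exists:
  "\<exists>E::'a::{real_inner,second_countable_topology} set. orthonormal_basis E"
proof -
  obtain D :: "'a set" where D: "countable D" "\<And>X. open X \<Longrightarrow> X \<noteq> {} \<Longrightarrow> \<exists>d\<in>D. d \<in> X"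
    by (rule countable_dense_setE) blast
  have "D \<noteq> {}" using D(2)[of UNIV] by auto
  define d where "d = from_nat_into D"
  have ranged: "range d = D" unfolding d_def using D(1) \<open>D \<noteq> {}\<close> by (rule range_from_nat_into[rotated])
  define E where "E = (\<Union>n. gram_schmidt d n)"
  have "pairwise orthogonal E"
  proof (rule pairwiseI)
    fix x y assume "x \<in> E" "y \<in> E" "x \<noteq> y"
    then obtain m n where "x \<in> gram_schmidt d m" "y \<in> gram_schmidt d n" by (auto simp: E_def)
    then have "x \<in> gram_schmidt d (max m n)" "y \<in> gram_schmidt d (max m n)"
      using gram_schmidt_mono[of m "max m n" d] gram_schmidt_mono[of n "max m n" d] by auto
    then show "orthogonal x y"
      using gram_schmidt_orthonormal[of d "max m n"] \<open>x \<noteq> y\<close> by (meson pairwiseD)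
  qed
  moreover have "\<forall>e\<in>E. norm e = 1" using gram_schmidt_orthonormal by (auto simp: E_def)
  moreover have "closure (span E) = UNIV"
  proof -
    have "D \<subseteq> span E"
    proof
      fix x assume "x \<in> D"
      then obtain n where "x = d n" using ranged by auto
      then show "x \<in> span E"
        using gram_schmidt_span[of d n] span_mono[of "gram_schmidt d (Suc n)" E]
        unfolding E_def by blast
    qed
    moreover have "closure D = UNIV"
    proof -
      have "open (- closure D)" by (intro open_Compl closed_closure)
      then have "- closure D = {}" using D(2)[of "- closure D"] closure_subset[of D] by blast
      then show ?thesis by blast
    qed
    ultimately show ?thesis using closure_mono[of D "span E"] by auto
  qed
  ultimately show ?thesis unfolding orthonormal_basis_def by blast
qed

text \<open>
  The Hilbert-Schmidt property, inner product and norm do not depend on the orthonormal basis, so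
  one basis is fixed once and for all.
\<close>

definition onb :: "'a::{real_inner,second_countable_topology} set" where
  "onb = (SOME E. orthonormal_basis E)"

lemma orthonormal_basis_onb: "orthonormal_basis onb"
  unfolding onb_def using orthonormal_basis_exists by (rule someI_ex)

definition hilbert_schmidt ::
    "('h::{real_inner,banach,second_countable_topology} \<Rightarrow>\<^sub>L 'h) \<Rightarrow> bool" where
  "hilbert_schmidt A \<longleftrightarrow> (\<lambda>e. (norm (A e))\<^sup>2) summable_on onb"

definition hs_inner ::
    "('h::{real_inner,banach,second_countable_topology} \<Rightarrow>\<^sub>L 'h) \<Rightarrow> ('h \<Rightarrow>\<^sub>L 'h) \<Rightarrow> real" where
  "hs_inner A B = (\<Sum>\<^sub>\<infinity>e\<in>onb. A e \<bullet> B e)"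

definition selfadjoint_op :: "('h::real_inner \<Rightarrow>\<^sub>L 'h) \<Rightarrow> bool" where
  "selfadjoint_op A \<longleftrightarrow> (\<forall>x y. A x \<bullet> y = x \<bullet> A y)"

definition positive_op :: "('h::real_inner \<Rightarrow>\<^sub>L 'h) \<Rightarrow> bool" where
  "positive_op A \<longleftrightarrow> (\<forall>x. 0 \<le> A x \<bullet> x)"

lemma hilbert_schmidt_inner_summable:
  assumes "hilbert_schmidt A" "hilbert_schmidt B"
  shows "(\<lambda>e. A e \<bullet> B e) summable_on onb"
proof -
  have "(\<lambda>e. (norm (A e))\<^sup>2 + (norm (B e))\<^sup>2) summable_on onb"
    using assms unfolding hilbert_schmidt_def by (rule summable_on_add)
  then have "(\<lambda>e. norm (A e \<bullet> B e)) summable_on onb"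
  proof (rule summable_on_comparison_test)
    fix e
    have "norm (A e \<bullet> B e) \<le> norm (A e) * norm (B e)"
      using Cauchy_Schwarz_ineq2[of "A e" "B e"] by simp
    also have "\<dots> \<le> (norm (A e))\<^sup>2 + (norm (B e))\<^sup>2"
      using sum_squares_bound[of "norm (A e)" "norm (B e)"]
        mult_nonneg_nonneg[OF norm_ge_zero norm_ge_zero, of "A e" "B e"] by linarith
    finally show "norm (A e \<bullet> B e) \<le> (norm (A e))\<^sup>2 + (norm (B e))\<^sup>2" .
  qed simp
  then show ?thesis by (rule abs_summable_summable)
qed

lemma hilbert_schmidt_scaleR: "hilbert_schmidt A \<Longrightarrow> hilbert_schmidt (c *\<^sub>R A)"
  unfolding hilbert_schmidt_def
  by (simp add: blinfun.scaleR_left power_mult_distrib summable_on_cmult_right)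

lemma hilbert_schmidt_add:
  assumes "hilbert_schmidt A" "hilbert_schmidt B"
  shows "hilbert_schmidt (A + B)"
proof -
  have "(\<lambda>e. ((norm (A e))\<^sup>2 + (norm (B e))\<^sup>2) + 2 * (A e \<bullet> B e)) summable_on onb"
    using assms hilbert_schmidt_inner_summable[OF assms] unfolding hilbert_schmidt_def
    by (intro summable_on_add summable_on_cmult_right)
  moreover have "(norm ((A + B) e))\<^sup>2 = ((norm (A e))\<^sup>2 + (norm (B e))\<^sup>2) + 2 * (A e \<bullet> B e)" for e
    by (simp add: blinfun.add_left power2_norm_eq_inner inner_add_left inner_add_right
        inner_commute)
  ultimately show ?thesis unfolding hilbert_schmidt_def by simp
qed

lemma hs_inner_add_left:
  assumes "hilbert_schmidt A" "hilbert_schmidt B" "hilbert_schmidt C"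
  shows "hs_inner (A + B) C = hs_inner A C + hs_inner B C"
  unfolding hs_inner_def
  by (simp add: blinfun.add_left inner_add_left infsum_add
      hilbert_schmidt_inner_summable assms)

lemma hs_inner_scaleR_left: "hs_inner (c *\<^sub>R A) B = c * hs_inner A B"
  unfolding hs_inner_def by (simp add: blinfun.scaleR_left infsum_cmult_right')

lemma hs_inner_eq_0:
  assumes "hilbert_schmidt A" "hs_inner A A = 0"
  shows "A = 0"
proof -
  have "A e \<bullet> A e = 0" if "e \<in> onb" for e
    by (rule nonneg_infsum_le_0D[OF _ hilbert_schmidt_inner_summable[OF assms(1) assms(1)] _ that])
      (use assms(2) in \<open>simp_all add: hs_inner_def\<close>)
  then have "onb \<subseteq> {x. A x = 0}" by auto
  moreover have "subspace {x. A x = 0}"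
    by (auto simp: subspace_def blinfun.add_right blinfun.scaleR_right)
  ultimately have "span onb \<subseteq> {x. A x = 0}" by (rule span_minimal)
  moreover have "closed {x. A x = 0}"
    by (intro closed_Collect_eq continuous_intros)
  ultimately have "closure (span onb) \<subseteq> {x. A x = 0}" by (rule closure_minimal)
  then have "A x = 0" for x
    using orthonormal_basis_onb[where 'a='a] by (auto simp: orthonormal_basis_def)
  then show ?thesis by (intro blinfun_eqI) simp
qed

section \<open>The space of self-adjoint Hilbert-Schmidt operators\<close>

typedef (overloaded) 'h sahs =
  "{A :: 'h::{real_inner,banach,second_countable_topology} \<Rightarrow>\<^sub>L 'h.
      hilbert_schmidt A \<and> selfadjoint_op A}"
  morphisms op_of Abs_sahs
  by (rule exI[of _ 0]) (simp add: hilbert_schmidt_def selfadjoint_op_def)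

lemma op_of_hs [simp]: "hilbert_schmidt (op_of A)" and op_of_sa: "selfadjoint_op (op_of A)"
  using op_of[of A] by auto

instantiation sahs :: ("{real_inner,banach,second_countable_topology}") real_vector
begin

definition "0 = Abs_sahs 0"
definition "A + B = Abs_sahs (op_of A + op_of B)"
definition "- A = Abs_sahs (- op_of A)" for A :: "'a sahs"
definition "A - B = Abs_sahs (op_of A - op_of B)"
definition "c *\<^sub>R A = Abs_sahs (c *\<^sub>R op_of A)"

lemma op_of_zero: "op_of 0 = 0"
  unfolding zero_sahs_def
  by (rule Abs_sahs_inverse) (simp add: hilbert_schmidt_def selfadjoint_op_def)

lemma op_of_scaleR: "op_of (c *\<^sub>R A) = c *\<^sub>R op_of A"
  unfolding scaleR_sahs_def using op_of_sa[of A]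
  by (intro Abs_sahs_inverse)
    (simp add: hilbert_schmidt_scaleR selfadjoint_op_def blinfun.scaleR_left)

lemma op_of_add: "op_of (A + B) = op_of A + op_of B"
  unfolding plus_sahs_def using op_of_sa[of A] op_of_sa[of B]
  by (intro Abs_sahs_inverse)
    (simp add: hilbert_schmidt_add selfadjoint_op_def blinfun.add_left inner_add_left
      inner_add_right)

lemma op_of_uminus: "op_of (- A) = - op_of A"
  using op_of_scaleR[of "-1" A] op_of[of "(-1) *\<^sub>R A"]
  unfolding uminus_sahs_def by (intro Abs_sahs_inverse) simp

lemma op_of_minus: "op_of (A - B) = op_of A - op_of B"
  using op_of_add[of A "- B"] op_of_uminus[of B] op_of[of "A + - B"]
  unfolding minus_sahs_def by (intro Abs_sahs_inverse) simp

lemmas op_of_simps = op_of_zero op_of_scaleR op_of_add op_of_uminus op_of_minus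

instance
  by standard (simp_all add: op_of_inject[symmetric] op_of_simps algebra_simps)

end

instantiation sahs :: ("{real_inner,banach,second_countable_topology}") real_inner
begin

definition "A \<bullet> B = hs_inner (op_of A) (op_of B)"
definition "norm A = sqrt (hs_inner (op_of A) (op_of A))"
definition "dist A B = norm (A - B)" for A B :: "'a sahs"
definition "sgn A = A /\<^sub>R norm A" for A :: "'a sahs"
definition [code del]: "(uniformity :: ('a sahs \<times> 'a sahs) filter) =
  (INF e\<in>{0<..}. principal {(x, y). dist x y < e})"
definition [code del]: "open U \<longleftrightarrow> (\<forall>x\<in>U. \<forall>\<^sub>F (x', y) in uniformity. x' = x \<longrightarrow> y \<in> U)"
  for U :: "'a sahs set"

instance
proof
  fix A B C :: "'a sahs" and c :: real
  show "dist A B = norm (A - B)" by (rule dist_sahs_def)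
  show "sgn A = A /\<^sub>R norm A" by (rule sgn_sahs_def)
  show "(uniformity :: ('a sahs \<times> 'a sahs) filter) =
      (INF e\<in>{0<..}. principal {(x, y). dist x y < e})"
    by (rule uniformity_sahs_def)
  show "open U \<longleftrightarrow> (\<forall>x\<in>U. \<forall>\<^sub>F (x', y) in uniformity. x' = x \<longrightarrow> y \<in> U)" for U :: "'a sahs set"
    by (rule open_sahs_def)
  show "A \<bullet> B = B \<bullet> A" by (simp add: inner_sahs_def hs_inner_def inner_commute)
  show "(A + B) \<bullet> C = A \<bullet> C + B \<bullet> C"
    by (simp add: inner_sahs_def op_of_simps hs_inner_add_left)
  show "c *\<^sub>R A \<bullet> B = c * (A \<bullet> B)"
    by (simp add: inner_sahs_def op_of_simps hs_inner_scaleR_left)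
  show "0 \<le> A \<bullet> A" by (simp add: inner_sahs_def hs_inner_def infsum_nonneg)
  show "A \<bullet> A = 0 \<longleftrightarrow> A = 0"
    using hs_inner_eq_0[OF op_of_hs, of A]
    by (auto simp: inner_sahs_def op_of_inject[symmetric] op_of_simps hs_inner_def)
  show "norm A = sqrt (A \<bullet> A)" by (simp add: norm_sahs_def inner_sahs_def)
qed

end

definition pos_cone :: "'h::{real_inner,banach,second_countable_topology} sahs set" where
  "pos_cone = {A. positive_op (op_of A)}"

section \<open>Complexification and tensor products\<close>

text \<open>The pair \<open>(x, y)\<close> stands for \<open>x + i y\<close>.\<close>

type_synonym 'a complexified = "'a \<times> 'a"

definition of_re :: "'a::real_vector \<Rightarrow> 'a complexified" where
  "of_re x = (x, 0)"

definition imul :: "'a::real_vector complexified \<Rightarrow> 'a complexified" where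
  "imul z = (- snd z, fst z)"

definition imag_space :: "'a::real_vector complexified set" where
  "imag_space = range (\<lambda>v. imul (of_re v))"

definition cext :: "('a \<Rightarrow> 'b) \<Rightarrow> 'a complexified \<Rightarrow> 'b complexified" where
  "cext f z = (f (fst z), f (snd z))"

definition tensor :: "'h::real_inner \<Rightarrow> 'h \<Rightarrow> 'h \<Rightarrow>\<^sub>L 'h" where
  "tensor a b = Blinfun (\<lambda>h. (a \<bullet> h) *\<^sub>R b)"

definition ctensor ::
    "'h::real_inner complexified \<Rightarrow> 'h complexified \<Rightarrow> ('h \<Rightarrow>\<^sub>L 'h) complexified" where
  "ctensor z w =
     (tensor (fst z) (fst w) - tensor (snd z) (snd w),
      tensor (fst z) (snd w) + tensor (snd z) (fst w))"

lemma tensor_apply: "tensor a b h = (a \<bullet> h) *\<^sub>R b"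
  unfolding tensor_def
  by (subst bounded_linear_Blinfun_apply)
    (auto intro!: bounded_linear_intros bounded_linear_inner_right)

lemma tensor_hilbert_schmidt:
  "hilbert_schmidt (tensor a b :: 'h::{real_inner,banach,second_countable_topology} \<Rightarrow>\<^sub>L 'h)"
proof -
  have "(\<lambda>e. (a \<bullet> e)\<^sup>2) summable_on onb"
  proof (rule nonneg_bdd_above_summable_on)
    show "bdd_above (sum (\<lambda>e. (a \<bullet> e)\<^sup>2) ` {F. F \<subseteq> onb \<and> finite F})"
    proof (rule bdd_aboveI2)
      fix F :: "'h set" assume "F \<in> {F. F \<subseteq> onb \<and> finite F}"
      then show "(\<Sum>e\<in>F. (a \<bullet> e)\<^sup>2) \<le> (norm a)\<^sup>2"
        using orthonormal_basis_onb
        by (intro orthonormal_bessel) (auto simp: orthonormal_basis_def intro: pairwise_subset)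
    qed
  qed simp
  then show ?thesis unfolding hilbert_schmidt_def
    by (simp add: tensor_apply power_mult_distrib summable_on_cmult_left)
qed

lemma imul_imul: "imul (imul z) = - z"
  by (simp add: imul_def prod_eq_iff)

lemma ctensor_imul_imul:
  "ctensor (imul (of_re a)) (imul (of_re b)) = - of_re (tensor a b)"
proof -
  have "tensor 0 c = 0" "tensor c 0 = 0" for c :: 'a
    by (auto intro!: blinfun_eqI simp: tensor_apply)
  then show ?thesis by (simp add: ctensor_def imul_def of_re_def prod_eq_iff)
qed

definition op_sqrt :: "('h::real_inner \<Rightarrow>\<^sub>L 'h) \<Rightarrow> 'h \<Rightarrow>\<^sub>L 'h" where
  "op_sqrt D = (THE S. selfadjoint_op S \<and> positive_op S \<and> S o\<^sub>L S = D)"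

section \<open>Cone-valued measures and admissible parameters\<close>

definition cone_borel :: "'h::{real_inner,banach,second_countable_topology} sahs measure" where
  "cone_borel = restrict_space borel (pos_cone - {0})"

text \<open>The truncation function, usually written \<open>\<chi>\<close>.\<close>

definition trunc :: "'a::real_normed_vector \<Rightarrow> 'a" where
  "trunc \<xi> = (if norm \<xi> \<le> 1 then \<xi> else 0)"

definition cone_valued_measure ::
    "('h::{real_inner,banach,second_countable_topology} sahs set \<Rightarrow> 'h sahs) \<Rightarrow> bool" where
  "cone_valued_measure \<mu> \<longleftrightarrow>
     \<mu> {} = 0 \<and>
     (\<forall>X\<in>sets cone_borel. \<mu> X \<in> pos_cone) \<and>
     (\<forall>X. range X \<subseteq> sets cone_borel \<longrightarrow> disjoint_family X \<longrightarrow>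
        (\<lambda>n. \<mu> (X n)) sums \<mu> (\<Union>n. X n))"

text \<open>
  For \<open>x\<close> in the cone, the set function \<open>X \<mapsto> \<langle>\<mu>(X), x\<rangle>\<close> is nonnegative (the cone is self-dual),
  hence an ordinary finite measure.
\<close>

definition scalar_measure ::
    "('h::{real_inner,banach,second_countable_topology} sahs set \<Rightarrow> 'h sahs) \<Rightarrow>
      'h sahs \<Rightarrow> 'h sahs measure" where
  "scalar_measure \<mu> x =
     measure_of (space cone_borel) (sets cone_borel) (\<lambda>X. ennreal (\<mu> X \<bullet> x))"

text \<open>
  The integral of a scalar function against a cone-valued measure is the weak integral.  Testing
  against the elements of the cone suffices, because the cone spans the whole space.
\<close>

definition cone_integral ::
    "('h::{real_inner,banach,second_countable_topology} sahs set \<Rightarrow> 'h sahs) \<Rightarrow>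
      ('h sahs \<Rightarrow> real) \<Rightarrow> 'h sahs" where
  "cone_integral \<mu> f =
     (THE z. \<forall>x\<in>pos_cone. integrable (scalar_measure \<mu> x) f \<and>
        z \<bullet> x = (\<integral>\<xi>. f \<xi> \<partial>scalar_measure \<mu> x))"

definition admissible ::
    "'h::{real_inner,banach,second_countable_topology} sahs \<Rightarrow> ('h sahs \<Rightarrow>\<^sub>L 'h sahs) \<Rightarrow>
      'h sahs measure \<Rightarrow> ('h sahs set \<Rightarrow> 'h sahs) \<Rightarrow> bool" where
  "admissible b B m \<mu> \<longleftrightarrow>
     b \<in> pos_cone \<and>
     (sets m = sets cone_borel \<and>
      (\<integral>\<^sup>+\<xi>. ennreal ((norm \<xi>)\<^sup>2) \<partial>m) < \<infinity> \<and>
      (\<forall>h. (\<integral>\<^sup>+\<xi>. ennreal \<bar>trunc \<xi> \<bullet> h\<bar> \<partial>m) < \<infinity>) \<and>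
      (\<exists>I. \<forall>h. I \<bullet> h = (\<integral>\<xi>. trunc \<xi> \<bullet> h \<partial>m)) \<and>
      (\<forall>v\<in>pos_cone. 0 \<le> b \<bullet> v - (\<integral>\<xi>. trunc \<xi> \<bullet> v \<partial>m))) \<and>
     (cone_valued_measure \<mu> \<and>
      (\<forall>u\<in>pos_cone. \<forall>x\<in>pos_cone. u \<bullet> x = 0 \<longrightarrow>
        (\<integral>\<^sup>+\<xi>. ennreal ((trunc \<xi> \<bullet> u) / (norm \<xi>)\<^sup>2) \<partial>scalar_measure \<mu> x) < \<infinity>)) \<and>
     (\<forall>u\<in>pos_cone. \<forall>x\<in>pos_cone. u \<bullet> x = 0 \<longrightarrow>
        0 \<le> adjoint B u \<bullet> x - (\<integral>\<xi>. (trunc \<xi> \<bullet> u) / (norm \<xi>)\<^sup>2 \<partial>scalar_measure \<mu> x))"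

section \<open>Strongly continuous semigroups\<close>

definition c0_semigroup :: "(real \<Rightarrow> 'h::real_normed_vector \<Rightarrow>\<^sub>L 'h) \<Rightarrow> bool" where
  "c0_semigroup S \<longleftrightarrow>
     S 0 = id_blinfun \<and>
     (\<forall>s\<ge>0. \<forall>t\<ge>0. S (s + t) = S s o\<^sub>L S t) \<and>
     (\<forall>x. continuous_on {0..} (\<lambda>t. S t x))"

text \<open>An unbounded operator is given by a function together with its domain.\<close>

definition generates ::
    "('h::real_normed_vector \<Rightarrow> 'h) \<Rightarrow> 'h set \<Rightarrow> (real \<Rightarrow> 'h \<Rightarrow>\<^sub>L 'h) \<Rightarrow> bool" where
  "generates A domA S \<longleftrightarrow>
     domA = {x. \<exists>y. ((\<lambda>t. (S t x - x) /\<^sub>R t) \<longlongrightarrow> y) (at_right 0)} \<and>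
     (\<forall>x\<in>domA. ((\<lambda>t. (S t x - x) /\<^sub>R t) \<longlongrightarrow> A x) (at_right 0))"

definition adjoint_dom :: "('h::real_inner \<Rightarrow> 'h) \<Rightarrow> 'h set \<Rightarrow> 'h set" where
  "adjoint_dom A domA = {y. \<exists>z. \<forall>x\<in>domA. A x \<bullet> y = x \<bullet> z}"

definition adjoint_on :: "('h::real_inner \<Rightarrow> 'h) \<Rightarrow> 'h set \<Rightarrow> 'h \<Rightarrow> 'h" where
  "adjoint_on A domA y = (THE z. \<forall>x\<in>domA. A x \<bullet> y = x \<bullet> z)"

section \<open>Generalised Riccati equations\<close>

definition riccati_F ::
    "'h::{real_inner,banach,second_countable_topology} sahs \<Rightarrow> 'h sahs measure \<Rightarrow>
      'h sahs \<Rightarrow> real" where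
  "riccati_F b m u = b \<bullet> u - (\<integral>\<xi>. exp (- (\<xi> \<bullet> u)) - 1 + trunc \<xi> \<bullet> u \<partial>m)"

text \<open>
  The component \<open>fst\<close> is the real part; by \<open>ctensor_imul_imul\<close> the imaginary part of the tensor
  vanishes when \<open>h\<close> lies in \<open>imag_space\<close>.
\<close>

definition riccati_R ::
    "('h::{real_inner,banach,second_countable_topology} sahs \<Rightarrow>\<^sub>L 'h sahs) \<Rightarrow> ('h \<Rightarrow>\<^sub>L 'h) \<Rightarrow>
      ('h sahs set \<Rightarrow> 'h sahs) \<Rightarrow> 'h complexified \<Rightarrow> 'h sahs \<Rightarrow> 'h sahs" where
  "riccati_R B D \<mu> h u =
     adjoint B u
     - (1 / 2) *\<^sub>R Abs_sahs (fst (ctensor (cext (op_sqrt D) h) (cext (op_sqrt D) h)))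
     - cone_integral \<mu> (\<lambda>\<xi>. (exp (- (\<xi> \<bullet> u)) - 1 + trunc \<xi> \<bullet> u) / (norm \<xi>)\<^sup>2)"

lemma riccati_tensor_wf:
  fixes S :: "'h::{real_inner,banach,second_countable_topology} \<Rightarrow>\<^sub>L 'h"
  shows "op_of (Abs_sahs (fst (ctensor (cext S h) (cext S h)))) =
      fst (ctensor (cext S h) (cext S h))"
    and "h \<in> imag_space \<Longrightarrow> snd (ctensor (cext S h) (cext S h)) = 0"
proof -
  have "hilbert_schmidt (tensor a a - tensor b b)" for a b :: 'h
    using hilbert_schmidt_add[OF tensor_hilbert_schmidt[of a a]
        hilbert_schmidt_scaleR[OF tensor_hilbert_schmidt[of b b], of "-1"]] by simp
  then show "op_of (Abs_sahs (fst (ctensor (cext S h) (cext S h)))) =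
      fst (ctensor (cext S h) (cext S h))"
    by (intro Abs_sahs_inverse)
      (simp add: ctensor_def selfadjoint_op_def tensor_apply blinfun.diff_left
        inner_diff_left inner_diff_right inner_commute)
  assume "h \<in> imag_space"
  then obtain v where "h = imul (of_re v)" by (auto simp: imag_space_def)
  then have "cext S h = imul (of_re (S v))"
    by (simp add: cext_def imul_def of_re_def)
  then show "snd (ctensor (cext S h) (cext S h)) = 0"
    by (simp add: ctensor_imul_imul) (simp add: of_re_def)
qed

definition C1_on_interval :: "real \<Rightarrow> (real \<Rightarrow> 'a::real_normed_vector) \<Rightarrow> bool" where
  "C1_on_interval T f \<longleftrightarrow>
     (\<exists>f'. continuous_on {0..T} f' \<and>
        (\<forall>t\<in>{0..T}. (f has_vector_derivative f' t) (at t within {0..T})))"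

text \<open>
  At \<open>t = T\<close> the derivatives in the equations are one-sided.
\<close>

definition mild_solution ::
    "'h::{real_inner,banach,second_countable_topology} sahs \<Rightarrow> ('h sahs \<Rightarrow>\<^sub>L 'h sahs) \<Rightarrow>
      'h sahs measure \<Rightarrow> ('h sahs set \<Rightarrow> 'h sahs) \<Rightarrow>
      ('h \<Rightarrow> 'h) \<Rightarrow> 'h set \<Rightarrow> ('h \<Rightarrow>\<^sub>L 'h) \<Rightarrow>
      'h complexified \<Rightarrow> 'h sahs \<Rightarrow> real \<Rightarrow>
      (real \<Rightarrow> real) \<Rightarrow> (real \<Rightarrow> 'h complexified) \<Rightarrow> (real \<Rightarrow> 'h sahs) \<Rightarrow> bool" where
  "mild_solution b B m \<mu> A domA D u\<^sub>1 u\<^sub>2 T \<Phi> \<psi>\<^sub>1 \<psi>\<^sub>2 \<longleftrightarrow>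
     C1_on_interval T \<Phi> \<and> (\<forall>t\<in>{0..T}. 0 \<le> \<Phi> t) \<and>
     continuous_on {0..T} \<psi>\<^sub>1 \<and> (\<forall>t\<in>{0..T}. \<psi>\<^sub>1 t \<in> imag_space) \<and>
     C1_on_interval T \<psi>\<^sub>2 \<and> (\<forall>t\<in>{0..T}. \<psi>\<^sub>2 t \<in> pos_cone) \<and>
     \<Phi> 0 = 0 \<and> \<psi>\<^sub>1 0 = u\<^sub>1 \<and> \<psi>\<^sub>2 0 = u\<^sub>2 \<and>
     (\<forall>t\<in>{0<..T}. (\<Phi> has_vector_derivative riccati_F b m (\<psi>\<^sub>2 t)) (at t within {0..T})) \<and>
     (\<forall>t\<in>{0..T}.
        imul (integral {0..t} \<psi>\<^sub>1) \<in> of_re ` adjoint_dom A domA \<and>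
        \<psi>\<^sub>1 t = u\<^sub>1 - imul (cext (adjoint_on A domA) (imul (integral {0..t} \<psi>\<^sub>1)))) \<and>
     (\<forall>t\<in>{0<..T}.
        (\<psi>\<^sub>2 has_vector_derivative riccati_R B D \<mu> (\<psi>\<^sub>1 t) (\<psi>\<^sub>2 t)) (at t within {0..T}))"

end

theory Submission
  imports Defs
begin

text \<open>
  The three equations decouple.  The second one is solved by the adjoint semigroup
  \<open>t \<mapsto> S(t)\<^sup>*\<close> applied to the imaginary part of \<open>u\<^sub>1\<close>; it is strongly continuous because \<open>H\<close> is a
  Hilbert space, and uniqueness follows by differentiating \<open>s \<mapsto> \<langle>S(t - s) x, \<integral>\<^sub>0\<^sup>s v\<rangle>\<close>.  The third one
  becomes \<open>\<psi>' = f(\<psi>) + c(t)\<close> with \<open>c\<close> in the cone, and \<open>f\<close> locally Lipschitz and quasi-monotone on the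
  cone.  The cone has empty interior but it is self-dual, so the metric projection \<open>P\<close> gives the
  decomposition \<open>\<psi> = P\<psi> - (P\<psi> - \<psi>)\<close> into orthogonal elements of the cone, and along the flow of \<open>f \<circ> P + c\<close>
  the squared distance to the cone does not increase.  Global existence follows from an energy
  estimate, because the jump part of \<open>\<langle>\<psi>, f(\<psi>)\<rangle>\<close> is at most \<open>\<langle>\<mu>(\<H>\<^sup>+ - {0}), \<psi>\<rangle>\<close>.  The first equation
  is an integration.
\<close>

section \<open>Projections in Hilbert spaces\<close>

text \<open>Without interior points a trajectory cannot be pushed strictly inside the cone and
  examined at its first exit. The squared distance replaces that argument: it is differentiable
  although the projection is merely Lipschitz. The cut-off is radial because a nonnegative multiple
  preserves both the cone and the orthogonality on which quasi-monotonicity is tested.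

  Quasi-monotonicity comes from exp (-y) <= 1 for y >= 0: the jump integral is dominated by the
  truncated one of the admissibility condition. The forcing lies in the cone because the imaginary
  units reverse the sign of the quadratic term.

  Norm bounds for integrals against \<mu> come from the order: if |z . x| <= w . x for all x in a
  self-dual cone, then norm z <= norm w. The compensated exponential is of size O(|\<xi>|^2), so the
  quotient in R is a bounded integrand, Lipschitz in u on balls. Self-duality is the positivity of
  the trace of a product of positive operators, reduced to finite matrices.\<close>

lemma square_le_mult_imp_le:
  fixes x c :: real
  assumes "x * x \<le> c * x" "0 \<le> x" "0 \<le> c"
  shows "x \<le> c"
  using assms by (cases "x = 0") (auto simp: mult_le_cancel_right)

text \<open>A minimising sequence is Cauchy by the parallelogram law, since midpoints stay in
  \<open>C\<close>; the inequality follows by moving from the minimiser slightly towards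
  \<open>y\<close>.\<close>

lemma hilbert_projection:
  fixes C :: "'a::{real_inner,banach} set"
  assumes "closed C" "convex C" "C \<noteq> {}"
  shows "\<exists>p\<in>C. \<forall>y\<in>C. (u - p) \<bullet> (y - p) \<le> 0"
proof -
  define d where "d = (INF y\<in>C. (norm (u - y))\<^sup>2)"
  have bdd: "bdd_below ((\<lambda>y. (norm (u - y))\<^sup>2) ` C)" by (rule bdd_belowI2[of _ 0]) simp
  have d_le: "d \<le> (norm (u - y))\<^sup>2" if "y \<in> C" for y
    unfolding d_def using bdd that by (rule cINF_lower)
  have "\<exists>y\<in>C. (norm (u - y))\<^sup>2 < d + 1 / real (Suc n)" for n
    using cINF_less_iff[OF assms(3) bdd, of "d + 1 / real (Suc n)"] by (simp add: d_def)
  then obtain p where p: "\<And>n. p n \<in> C" "\<And>n. (norm (u - p n))\<^sup>2 < d + 1 / real (Suc n)" by metis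
  have pp: "(norm (p n - p k))\<^sup>2 \<le> 2 / real (Suc n) + 2 / real (Suc k)" for n k
  proof -
    have "(1/2) *\<^sub>R p n + (1/2) *\<^sub>R p k \<in> C"
      using assms(2) p(1) by (intro convexD) auto
    then have "d \<le> (norm (u - ((1/2) *\<^sub>R p n + (1/2) *\<^sub>R p k)))\<^sup>2" by (rule d_le)
    moreover have "(norm (p n - p k))\<^sup>2 = 2 * (norm (u - p n))\<^sup>2 + 2 * (norm (u - p k))\<^sup>2
        - 4 * (norm (u - ((1/2) *\<^sub>R p n + (1/2) *\<^sub>R p k)))\<^sup>2"
      by (simp add: power2_norm_eq_inner algebra_simps inner_commute)
    ultimately show ?thesis using p(2)[of n] p(2)[of k] by linarith
  qed
  have "Cauchy p"
  proof (rule CauchyI)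
    fix e :: real assume e: "0 < e"
    obtain N where N: "4 / real (Suc N) < e\<^sup>2"
      using reals_Archimedean[of "e\<^sup>2 / 4"] e by (auto simp: field_simps)
    have "norm (p n - p k) < e" if "N \<le> n" "N \<le> k" for n k
    proof -
      have "2 / real (Suc n) + 2 / real (Suc k) \<le> 2 / real (Suc N) + 2 / real (Suc N)"
        using that by (intro add_mono divide_left_mono) auto
      then have "(norm (p n - p k))\<^sup>2 < e\<^sup>2" using pp[of n k] N by simp
      then show ?thesis using e by (simp add: power2_less_imp_less)
    qed
    then show "\<exists>M. \<forall>n\<ge>M. \<forall>k\<ge>M. norm (p n - p k) < e" by blast
  qed
  then obtain q where q: "p \<longlonglongrightarrow> q" using Cauchy_convergent convergent_def by blast
  have qC: "q \<in> C" using closed_sequentially[OF assms(1) _ q] p(1) by blast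
  have "(\<lambda>n. (norm (u - p n))\<^sup>2) \<longlonglongrightarrow> (norm (u - q))\<^sup>2" by (intro tendsto_intros q)
  moreover have "(\<lambda>n. d + 1 / real (Suc n)) \<longlonglongrightarrow> d + 0"
    by (intro tendsto_add tendsto_const LIMSEQ_Suc[OF lim_1_over_n])
  ultimately have qd: "(norm (u - q))\<^sup>2 \<le> d"
    using p(2) by (intro LIMSEQ_le[where Y="\<lambda>n. d + 1 / real (Suc n)"]) (auto intro: less_imp_le)
  have "(u - q) \<bullet> (y - q) \<le> 0" if y: "y \<in> C" for y
  proof (rule ccontr)
    assume "\<not> (u - q) \<bullet> (y - q) \<le> 0"
    then have pos: "0 < (u - q) \<bullet> (y - q)" by simp
    \<comment> \<open>Small enough that the quadratic term stays below the linear gain; the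
      \<open>+ 1\<close> avoids division by zero.\<close>
    define s where "s = min 1 ((u - q) \<bullet> (y - q) / ((norm (y - q))\<^sup>2 + 1))"
    have s: "0 < s" "s \<le> 1" unfolding s_def using pos by (auto simp: add_nonneg_pos)
    have "s \<le> (u - q) \<bullet> (y - q) / ((norm (y - q))\<^sup>2 + 1)" unfolding s_def by simp
    then have s2: "s * ((norm (y - q))\<^sup>2 + 1) \<le> (u - q) \<bullet> (y - q)"
      by (subst (asm) pos_le_divide_eq) (simp_all add: add_nonneg_pos)
    have "(1 - s) *\<^sub>R q + s *\<^sub>R y \<in> C"
      using assms(2) qC y s by (intro convexD) auto
    from order_trans[OF qd d_le[OF this]]
    have "(norm (u - q))\<^sup>2 \<le> (norm (u - ((1 - s) *\<^sub>R q + s *\<^sub>R y)))\<^sup>2" .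
    also have "u - ((1 - s) *\<^sub>R q + s *\<^sub>R y) = u - q - s *\<^sub>R (y - q)"
      by (simp add: algebra_simps)
    also have "(norm \<dots>)\<^sup>2 = (norm (u - q))\<^sup>2 - s * (2 * ((u - q) \<bullet> (y - q)) - s * (norm (y - q))\<^sup>2)"
      unfolding power2_norm_eq_inner by (simp add: algebra_simps inner_commute)
    finally have "s * (2 * ((u - q) \<bullet> (y - q)) - s * (norm (y - q))\<^sup>2) \<le> 0" by simp
    then have "2 * ((u - q) \<bullet> (y - q)) \<le> s * (norm (y - q))\<^sup>2"
      using s by (simp add: mult_le_0_iff)
    then show False using s2 pos s by (simp add: algebra_simps)
  qed
  then show ?thesis using qC by blast
qed

text \<open>Test each variational inequality at the other projected point and add. The bound serves
  both the cone projection and the radial cut-off.\<close>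

lemma projection_nonexpansive:
  fixes u w :: "'a::real_inner"
  assumes "p \<in> C" "\<forall>y\<in>C. (u - p) \<bullet> (y - p) \<le> 0"
    and "q \<in> C" "\<forall>y\<in>C. (w - q) \<bullet> (y - q) \<le> 0"
  shows "norm (p - q) \<le> norm (u - w)"
proof -
  have "(u - p) \<bullet> (q - p) \<le> 0" "(w - q) \<bullet> (p - q) \<le> 0" using assms by auto
  then have "(p - q) \<bullet> (p - q) \<le> (u - w) \<bullet> (p - q)"
    by (simp add: algebra_simps inner_commute)
  also have "\<dots> \<le> norm (u - w) * norm (p - q)" by (rule norm_cauchy_schwarz)
  finally have "norm (p - q) * norm (p - q) \<le> norm (u - w) * norm (p - q)"
    by (simp add: power2_norm_eq_inner[symmetric] power2_eq_square)
  then show ?thesis by (rule square_le_mult_imp_le) simp_all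
qed

lemma orthogonal_complement_trivial_imp_dense:
  fixes V :: "'a::{real_inner,banach} set"
  assumes "subspace V" "closed V" "\<And>z. (\<And>v. v \<in> V \<Longrightarrow> v \<bullet> z = 0) \<Longrightarrow> z = 0"
  shows "V = UNIV"
proof -
  have "u \<in> V" for u
  proof -
    have "V \<noteq> {}" using subspace_0[OF assms(1)] by auto
    then obtain p where p: "p \<in> V" "\<forall>y\<in>V. (u - p) \<bullet> (y - p) \<le> 0"
      using hilbert_projection[OF assms(2) subspace_imp_convex[OF assms(1)]] by blast
    have "v \<bullet> (u - p) = 0" if v: "v \<in> V" for v
      using bspec[OF p(2), of "p + v"] bspec[OF p(2), of "p - v"] v p(1) assms(1)
      by (auto simp: subspace_add subspace_diff inner_commute)
    then show ?thesis using assms(3)[of "u - p"] p(1) by simp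
  qed
  then show ?thesis by blast
qed

text \<open>A nonzero vector orthogonal to the kernel represents \<open>f\<close> after rescaling,
  because the kernel has codimension one.\<close>

lemma riesz_representation:
  fixes f :: "'a::{real_inner,banach} \<Rightarrow> real"
  assumes "bounded_linear f"
  shows "\<exists>z. \<forall>x. f x = x \<bullet> z"
proof (cases "\<forall>x. f x = 0")
  case True
  then show ?thesis by (intro exI[of _ 0]) simp
next
  case False
  interpret f: bounded_linear f by fact
  define V where "V = {x. f x = 0}"
  have V: "subspace V" "closed V"
    unfolding V_def
    by (auto simp: subspace_def f.add f.scaleR f.zero
        intro!: closed_Collect_eq continuous_intros f.continuous_on)
  have "V \<noteq> UNIV" using False by (auto simp: V_def)
  then obtain z where z: "\<And>v. v \<in> V \<Longrightarrow> v \<bullet> z = 0" "z \<noteq> 0"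
    using orthogonal_complement_trivial_imp_dense[OF V] by blast
  have "f z \<noteq> 0" using z(1)[of z] z(2) by (auto simp: V_def)
  have "f x = x \<bullet> ((f z / (z \<bullet> z)) *\<^sub>R z)" for x
  proof -
    have "x - (f x / f z) *\<^sub>R z \<in> V" using \<open>f z \<noteq> 0\<close> by (simp add: V_def f.diff f.scaleR)
    from z(1)[OF this] show ?thesis using \<open>f z \<noteq> 0\<close> z(2) by (simp add: inner_diff_left field_simps)
  qed
  then show ?thesis by blast
qed

text \<open>\<open>adjoint\<close> is a choice of some map with this property, so existence has to
  be shown first; Riesz representation provides it pointwise.\<close>

lemma adjoint_works_hilbert:
  fixes F :: "'a::{real_inner,banach} \<Rightarrow>\<^sub>L 'b::real_inner"
  shows "F x \<bullet> y = x \<bullet> adjoint F y"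
proof -
  have "\<forall>y. \<exists>z. \<forall>x. F x \<bullet> y = x \<bullet> z"
    by (intro allI riesz_representation bounded_linear_inner_left_comp blinfun.bounded_linear_right)
  then have "\<exists>g. \<forall>x y. F x \<bullet> y = x \<bullet> g y" by metis
  then show ?thesis unfolding adjoint_def
    by (rule someI2_ex[where Q="\<lambda>g. F x \<bullet> y = x \<bullet> g y"]) blast
qed

lemma inner_left_eqI: "(\<And>x. x \<bullet> y = x \<bullet> z) \<Longrightarrow> y = (z::'a::real_inner)"
  by (metis inner_commute vector_eq_rdot)

lemma adjoint_hilbert_linear:
  fixes F :: "'a::{real_inner,banach} \<Rightarrow>\<^sub>L 'b::real_inner"
  shows "adjoint F (x + y) = adjoint F x + adjoint F y"
    and "adjoint F (c *\<^sub>R x) = c *\<^sub>R adjoint F x"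
    and "adjoint F (x - y) = adjoint F x - adjoint F y"
  by (rule inner_left_eqI, simp add: adjoint_works_hilbert[symmetric] inner_add_right
      inner_diff_right)+

lemma adjoint_hilbert_norm:
  fixes F :: "'a::{real_inner,banach} \<Rightarrow>\<^sub>L 'b::real_inner"
  shows "norm (adjoint F y) \<le> norm F * norm y"
proof -
  have "(norm (adjoint F y))\<^sup>2 = F (adjoint F y) \<bullet> y"
    by (simp add: power2_norm_eq_inner adjoint_works_hilbert)
  also have "\<dots> \<le> norm (F (adjoint F y)) * norm y" by (rule norm_cauchy_schwarz)
  also have "\<dots> \<le> norm F * norm (adjoint F y) * norm y"
    by (intro mult_right_mono norm_blinfun) simp
  finally have "norm (adjoint F y) * norm (adjoint F y) \<le> (norm F * norm y) * norm (adjoint F y)"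
    by (simp add: power2_eq_square mult_ac)
  then show ?thesis by (rule square_le_mult_imp_le) simp_all
qed

section \<open>Self-dual cones\<close>

text \<open>Self-duality as the only axiom already makes \<open>K\<close> a closed convex cone,
  being an intersection of half-spaces.\<close>

locale self_dual_cone =
  fixes K :: "'a::{real_inner,banach} set"
  assumes self_dual: "x \<in> K \<longleftrightarrow> (\<forall>y\<in>K. 0 \<le> x \<bullet> y)"
begin

lemma inner_nonneg: "x \<in> K \<Longrightarrow> y \<in> K \<Longrightarrow> 0 \<le> x \<bullet> y"
  using self_dual by blast

lemma zero_mem: "0 \<in> K" by (subst self_dual) simp

lemma add_mem: "x \<in> K \<Longrightarrow> y \<in> K \<Longrightarrow> x + y \<in> K"
  by (subst self_dual) (simp add: inner_add_left inner_nonneg)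

lemma scaleR_mem: "x \<in> K \<Longrightarrow> 0 \<le> c \<Longrightarrow> c *\<^sub>R x \<in> K"
  by (subst self_dual) (simp add: inner_nonneg)

lemma cone_convex: "convex K"
  by (rule convexI) (simp add: add_mem scaleR_mem)

lemma cone_closed: "closed K"
proof -
  have "K = (\<Inter>y\<in>K. {x. 0 \<le> x \<bullet> y})" using self_dual by blast
  moreover have "closed (\<Inter>y\<in>K. {x. 0 \<le> x \<bullet> y})"
    by (intro closed_INT ballI closed_Collect_le continuous_intros)
  ultimately show ?thesis by simp
qed

definition proj :: "'a \<Rightarrow> 'a" where
  "proj u = (SOME p. p \<in> K \<and> (\<forall>y\<in>K. (u - p) \<bullet> (y - p) \<le> 0))"

lemma proj: "proj u \<in> K" "\<forall>y\<in>K. (u - proj u) \<bullet> (y - proj u) \<le> 0"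
proof -
  have "\<exists>p. p \<in> K \<and> (\<forall>y\<in>K. (u - p) \<bullet> (y - p) \<le> 0)"
    using hilbert_projection[OF cone_closed cone_convex, of u] zero_mem by blast
  from someI_ex[OF this] show "proj u \<in> K" "\<forall>y\<in>K. (u - proj u) \<bullet> (y - proj u) \<le> 0"
    unfolding proj_def by auto
qed

lemma norm_proj_diff_le: "norm (proj u - proj w) \<le> norm (u - w)"
  by (rule projection_nonexpansive[OF proj proj])

text \<open>Testing at 0 and at twice the projection moves along the ray in both directions. With
  \<open>proj_minus_mem\<close> this is Moreau's decomposition for a self-dual cone.\<close>

lemma inner_proj: "(proj u - u) \<bullet> proj u = 0"
proof -
  have "(u - proj u) \<bullet> (0 - proj u) \<le> 0" "(u - proj u) \<bullet> (2 *\<^sub>R proj u - proj u) \<le> 0"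
    using proj(2)[of u] zero_mem scaleR_mem[OF proj(1), of 2 u] by auto
  then show ?thesis by (simp add: algebra_simps inner_commute)
qed

lemma proj_minus_mem: "proj u - u \<in> K"
proof (subst self_dual, rule ballI)
  fix y assume "y \<in> K"
  then have "(u - proj u) \<bullet> (y + proj u - proj u) \<le> 0"
    using proj(2)[of u] add_mem[OF _ proj(1)] by blast
  then show "0 \<le> (proj u - u) \<bullet> y" by (simp add: algebra_simps)
qed

text \<open>Every vector is a difference of two cone elements, so the cone separates vectors. This
  gives uniqueness of weak integrals.\<close>

lemma inner_eqI:
  assumes "\<And>x. x \<in> K \<Longrightarrow> y \<bullet> x = z \<bullet> x"
  shows "y = z"
proof (rule inner_left_eqI)
  fix x
  have "x = proj x - (proj x - x)" by simp
  moreover have "y \<bullet> (proj x - (proj x - x)) = z \<bullet> (proj x - (proj x - x))"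
    unfolding inner_diff_right[of _ "proj x" "proj x - x"]
    using assms[OF proj(1)] assms[OF proj_minus_mem] by simp
  ultimately show "x \<bullet> y = x \<bullet> z" by (simp add: inner_commute)
qed

text \<open>Both \<open>w - z\<close> and \<open>w + z\<close> lie in \<open>K\<close>, and their
  inner product is the difference of the squared norms.\<close>

lemma norm_le_of_abs_inner_le:
  assumes "\<And>x. x \<in> K \<Longrightarrow> \<bar>z \<bullet> x\<bar> \<le> w \<bullet> x"
  shows "norm z \<le> norm w"
proof -
  have "w - z \<in> K" "w + z \<in> K"
    using assms
    unfolding self_dual[of "w - z"] self_dual[of "w + z"] inner_add_left inner_diff_left
    by (auto dest!: assms)
  then have "0 \<le> (w - z) \<bullet> (w + z)" by (rule inner_nonneg)
  then have "(norm z)\<^sup>2 \<le> (norm w)\<^sup>2"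
    by (simp add: power2_norm_eq_inner algebra_simps inner_commute)
  then show ?thesis by (simp add: power2_le_iff_abs_le)
qed

text \<open>Each of \<open>proj u\<close> and \<open>proj (u + h)\<close> is a competitor in the
  other's minimisation problem, which traps the increment between two expansions with remainder
  quadratic in \<open>norm h\<close>.\<close>

lemma dist_cone_has_derivative:
  "((\<lambda>u. (norm (u - proj u))\<^sup>2) has_derivative (\<lambda>h. 2 * ((u - proj u) \<bullet> h))) (at u within S)"
proof (rule has_derivative_at_withinI, unfold has_derivative_at, intro conjI)
  show "bounded_linear (\<lambda>h. 2 * ((u - proj u) \<bullet> h))"
    by (intro bounded_linear_intros bounded_linear_inner_right)
  have close: "(norm (w - proj w))\<^sup>2 \<le> (norm (w - p))\<^sup>2" if "p \<in> K" for w p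
  proof -
    have "(w - proj w) \<bullet> (p - proj w) \<le> 0" using proj(2) that by blast
    moreover have "(norm (w - p))\<^sup>2 =
        (norm (w - proj w))\<^sup>2 - 2 * ((w - proj w) \<bullet> (p - proj w)) + (norm (p - proj w))\<^sup>2"
      by (simp add: power2_norm_eq_inner algebra_simps inner_commute)
    ultimately show ?thesis by (smt (verit) zero_le_power2)
  qed
  have bound: "\<bar>(norm (u + h - proj (u + h)))\<^sup>2 - (norm (u - proj u))\<^sup>2 - 2 * ((u - proj u) \<bullet> h)\<bar>
      \<le> 3 * (norm h)\<^sup>2" for h
  proof -
    let ?d = "proj (u + h) - proj u"
    have "(norm (u + h - proj (u + h)))\<^sup>2 \<le> (norm (u + h - proj u))\<^sup>2"
      by (rule close[OF proj(1)])
    also have "\<dots> = (norm (u - proj u))\<^sup>2 + 2 * ((u - proj u) \<bullet> h) + (norm h)\<^sup>2"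
      by (simp add: power2_norm_eq_inner algebra_simps inner_commute)
    finally have 1: "(norm (u + h - proj (u + h)))\<^sup>2 \<le> \<dots>" .
    have "(norm (u - proj u))\<^sup>2 \<le> (norm (u - proj (u + h)))\<^sup>2"
      by (rule close[OF proj(1)])
    also have "\<dots> = (norm (u + h - proj (u + h)))\<^sup>2 - 2 * ((u - proj u) \<bullet> h)
        + 2 * (?d \<bullet> h) - (norm h)\<^sup>2"
      by (simp add: power2_norm_eq_inner algebra_simps inner_commute)
    finally have 2: "(norm (u - proj u))\<^sup>2 \<le> \<dots>" .
    have "?d \<bullet> h \<le> norm ?d * norm h" by (rule norm_cauchy_schwarz)
    also have "\<dots> \<le> norm h * norm h"
      using norm_proj_diff_le[of "u + h" u] by (intro mult_right_mono) auto
    finally show ?thesis using 1 2 by (auto simp: power2_eq_square abs_le_iff)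
  qed
  show "(\<lambda>h. norm ((norm (u + h - proj (u + h)))\<^sup>2 - (norm (u - proj u))\<^sup>2 - 2 * ((u - proj u) \<bullet> h))
      / norm h) \<midarrow>0\<rightarrow> 0"
  proof (rule tendsto_sandwich)
    show "\<forall>\<^sub>F h in at 0. 0 \<le> norm ((norm (u + h - proj (u + h)))\<^sup>2 - (norm (u - proj u))\<^sup>2
        - 2 * ((u - proj u) \<bullet> h)) / norm h" by simp
    show "\<forall>\<^sub>F h in at 0. norm ((norm (u + h - proj (u + h)))\<^sup>2 - (norm (u - proj u))\<^sup>2
        - 2 * ((u - proj u) \<bullet> h)) / norm h \<le> 3 * norm h"
      using bound by (intro eventuallyI) (simp add: divide_le_eq power2_eq_square mult.assoc)
    show "(\<lambda>h::'a. 3 * norm h) \<midarrow>0\<rightarrow> 0"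
      by (rule tendsto_eq_intros | simp)+
  qed simp
qed

end

section \<open>Differential equations in Hilbert spaces\<close>

text \<open>The integrating factor \<open>exp (- a * s)\<close> turns \<open>y + q / a\<close> into
  a nonincreasing function.\<close>

lemma gronwall_differential:
  fixes y y' :: "real \<Rightarrow> real"
  assumes cont: "continuous_on {0..T} y"
    and der: "\<And>s. 0 < s \<Longrightarrow> s < T \<Longrightarrow> (y has_real_derivative y' s) (at s)"
    and le: "\<And>s. 0 < s \<Longrightarrow> s < T \<Longrightarrow> y' s \<le> a * y s + q"
    and a: "0 < a" and t: "t \<in> {0..T}"
  shows "y t \<le> (y 0 + q / a) * exp (a * t) - q / a"
proof -
  define z where "z s = (y s + q / a) * exp (- a * s)" for s
  have "z t \<le> z 0"
  proof (rule DERIV_nonpos_imp_decreasing_open[of 0 t z])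
    show "0 \<le> t" using t by simp
    fix s assume s: "0 < s" "s < t"
    then have s': "0 < s" "s < T" using t by auto
    have "(z has_real_derivative exp (- a * s) * (y' s - (a * y s + q))) (at s)"
      unfolding z_def
      by (rule derivative_eq_intros der[OF s'] refl)+ (use a in \<open>simp add: field_simps\<close>)
    moreover have "exp (- a * s) * (y' s - (a * y s + q)) \<le> 0"
      using le[OF s'] by (simp add: mult_le_0_iff)
    ultimately show "\<exists>d. (z has_real_derivative d) (at s) \<and> d \<le> 0" by blast
  next
    have "continuous_on {0..t} y" using cont t by (auto intro: continuous_on_subset)
    then show "continuous_on {0..t} z" unfolding z_def by (intro continuous_intros)
  qed
  then have le: "z t * exp (a * t) \<le> z 0 * exp (a * t)" by (intro mult_right_mono) auto
  have "z t * exp (a * t) = y t + q / a" "z 0 = y 0 + q / a"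
    by (simp_all add: z_def mult.assoc mult_exp_exp)
  with le show ?thesis by simp
qed

lemma has_real_derivative_inner_self:
  fixes x :: "real \<Rightarrow> 'a::real_inner"
  assumes "(x has_vector_derivative v) (at t)"
  shows "((\<lambda>t. x t \<bullet> x t) has_real_derivative 2 * (x t \<bullet> v)) (at t)"
  using bounded_bilinear.has_vector_derivative[OF bounded_bilinear_inner assms assms]
  by (simp add: has_real_derivative_iff_has_vector_derivative inner_commute)

text \<open>The weight \<open>exp (- (L + 1) t)\<close> makes the Picard operator a contraction on all of \<open>[0,T]\<close>.\<close>

lemma picard_lindelof_global:
  fixes g :: "'a::banach \<Rightarrow> 'a" and c :: "real \<Rightarrow> 'a"
  assumes T: "0 \<le> T" and lip: "\<And>u w. norm (g u - g w) \<le> L * norm (u - w)" and L: "0 \<le> L"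
    and c: "continuous_on {0..T} c"
  shows "\<exists>x. x 0 = x0 \<and> (\<forall>t\<in>{0..T}. (x has_vector_derivative g (x t) + c t) (at t within {0..T}))"
proof -
  define l where "l = L + 1"
  have l: "0 < l" using L by (simp add: l_def)
  have "L-lipschitz_on UNIV g" using lip L by (auto simp: lipschitz_on_def dist_norm)
  then have g_cont: "continuous_on UNIV g" by (rule lipschitz_on_continuous_on)
  \<comment> \<open>\<open>y\<close> stands for the solution damped by exp (- l s), so its plain
    supremum norm is the weighted norm of the solution; \<open>H\<close> undoes the damping before
    applying \<open>g\<close>.\<close>
  define H where "H y s = g (exp (l * s) *\<^sub>R y s) + c s" for y s
  have H_cont: "continuous_on {0..T} (H (apply_bcontfun y))" for y :: "real \<Rightarrow>\<^sub>C 'a"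
    unfolding H_def
    by (intro continuous_intros c continuous_on_compose2[OF g_cont]) auto
  define G where "G y t = exp (- l * t) *\<^sub>R (x0 + integral {0..t} (H y))" for y t
  \<comment> \<open>Clamping time to \<open>{0..T}\<close> makes the Picard image a bounded
    continuous function on the whole line, as the type of the fixed-point space demands.\<close>
  define cl where "cl t = max 0 (min T t)" for t
  have cl: "cl t \<in> {0..T}" for t using T by (auto simp: cl_def)
  have G_cont: "continuous_on {0..T} (G (apply_bcontfun y))" for y :: "real \<Rightarrow>\<^sub>C 'a"
    unfolding G_def
    by (intro continuous_intros indefinite_integral_continuous_1 integrable_continuous_real H_cont)
  have mem: "(\<lambda>t. G (apply_bcontfun y) (cl t)) \<in> bcontfun" for y :: "real \<Rightarrow>\<^sub>C 'a"
    unfolding bcontfun_def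
  proof (intro CollectI conjI)
    show "continuous_on UNIV (\<lambda>t. G y (cl t))"
      by (rule continuous_on_compose2[OF G_cont])
        (auto simp: cl_def T intro!: continuous_intros)
    have "compact (G y ` {0..T})" by (intro compact_continuous_image G_cont compact_Icc)
    then show "bounded (range (\<lambda>t. G y (cl t)))"
      by (rule bounded_subset[OF compact_imp_bounded]) (use cl in auto)
  qed
  define P where "P y = Bcontfun (\<lambda>t. G (apply_bcontfun y) (cl t))" for y :: "real \<Rightarrow>\<^sub>C 'a"
  have P_apply: "apply_bcontfun (P y) t = G (apply_bcontfun y) (cl t)" for y t
    unfolding P_def using mem by (subst Bcontfun_inverse) auto
  \<comment> \<open>Integrating exp (l r) produces a factor 1 / l and the damping cancels the
    exponential, so the contraction constant is L / (L + 1).\<close>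
  have "dist (P y) (P z) \<le> L / l * dist y z" for y z
  proof (rule dist_bound)
    fix t
    let ?s = "cl t" and ?d = "dist y z"
    have int: "H (apply_bcontfun x) integrable_on {0..?s}" for x
      using cl[of t] by (intro integrable_continuous_real continuous_on_subset[OF H_cont]) auto
    have der: "((\<lambda>r. L * ?d / l * exp (l * r)) has_vector_derivative L * ?d * exp (l * r))
        (at r within {0..?s})" for r
      unfolding has_real_derivative_iff_has_vector_derivative[symmetric]
      by (rule derivative_eq_intros refl)+ (use l in simp)
    have bi: "((\<lambda>r. L * ?d * exp (l * r)) has_integral
        L * ?d / l * exp (l * ?s) - L * ?d / l * exp (l * 0)) {0..?s}"
      using cl[of t] by (intro fundamental_theorem_of_calculus der) auto
    have "norm (integral {0..?s} (\<lambda>r. H y r - H z r)) \<le> integral {0..?s} (\<lambda>r. L * ?d * exp (l * r))"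
    proof (rule integral_norm_bound_integral)
      show "(\<lambda>r. H y r - H z r) integrable_on {0..?s}" by (intro integrable_diff int)
      show "(\<lambda>r. L * ?d * exp (l * r)) integrable_on {0..?s}" using bi by blast
      fix r
      have "norm (H y r - H z r) \<le> L * norm (exp (l * r) *\<^sub>R y r - exp (l * r) *\<^sub>R z r)"
        unfolding H_def using lip by simp
      also have "\<dots> = L * (exp (l * r) * dist (y r) (z r))"
        by (simp add: dist_norm scaleR_diff_right[symmetric])
      also have "\<dots> \<le> L * (exp (l * r) * ?d)"
        by (intro mult_left_mono dist_bounded L) auto
      finally show "norm (H y r - H z r) \<le> L * ?d * exp (l * r)" by (simp add: mult_ac)
    qed
    also have "\<dots> = L * ?d / l * exp (l * ?s) - L * ?d / l" using integral_unique[OF bi] by simp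
    also have "\<dots> \<le> L * ?d / l * exp (l * ?s)" using L l by simp
    finally have I: "norm (integral {0..?s} (\<lambda>r. H y r - H z r)) \<le> L * ?d / l * exp (l * ?s)" .
    have "dist (P y t) (P z t) = norm (exp (- l * ?s) *\<^sub>R integral {0..?s} (\<lambda>r. H y r - H z r))"
      unfolding P_apply G_def dist_norm
      by (subst integral_diff[OF int int]) (simp add: scaleR_diff_right[symmetric])
    also have "\<dots> \<le> exp (- l * ?s) * (L * ?d / l * exp (l * ?s))"
      unfolding norm_scaleR abs_exp_cancel by (intro mult_left_mono I) simp
    also have "\<dots> = L / l * ?d" by (simp add: exp_minus field_simps)
    finally show "dist (P y t) (P z t) \<le> L / l * ?d" .
  qed
  moreover have "0 \<le> L / l" "L / l < 1" using L by (auto simp: l_def)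
  ultimately obtain y where y: "P y = y" using banach_fix_type[of "L / l" P] by blast
  define x where "x t = exp (l * t) *\<^sub>R y t" for t
  have x_eq: "x t = x0 + integral {0..t} (\<lambda>s. g (x s) + c s)" if "t \<in> {0..T}" for t
  proof -
    have "y t = G (apply_bcontfun y) t" using P_apply[of y t] y that by (simp add: cl_def)
    then have "x t = (exp (l * t) * exp (- l * t)) *\<^sub>R (x0 + integral {0..t} (H (apply_bcontfun y)))"
      by (simp add: x_def G_def)
    then show ?thesis by (simp add: exp_minus H_def[abs_def] x_def)
  qed
  have "continuous_on {0..T} (\<lambda>s. g (x s) + c s)"
    using H_cont[of y] by (simp add: H_def[abs_def] x_def)
  note der = integral_has_vector_derivative[OF this]
  have "(x has_vector_derivative g (x t) + c t) (at t within {0..T})" if t: "t \<in> {0..T}" for t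
  proof (rule has_vector_derivative_transform[OF t])
    show "((\<lambda>t. x0 + integral {0..t} (\<lambda>s. g (x s) + c s)) has_vector_derivative g (x t) + c t)
        (at t within {0..T})"
      using has_vector_derivative_add[OF has_vector_derivative_const der[OF t]] by simp
  qed (rule x_eq)
  moreover have "x 0 = x0" using x_eq[of 0] T by simp
  ultimately show ?thesis by blast
qed

text \<open>The nearest point of the ball, written as a nonnegative multiple of \<open>u\<close>. At
  \<open>u = 0\<close> the quotient is 0 by convention and \<open>p\<close> is still
  \<open>u\<close>.\<close>

lemma radial_retraction:
  fixes u :: "'a::real_inner"
  assumes N: "0 < N"
  defines "p \<equiv> min 1 (N / norm u) *\<^sub>R u"
  shows "norm p \<le> N" "\<forall>y\<in>cball 0 N. (u - p) \<bullet> (y - p) \<le> 0"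
proof -
  have "norm p \<le> N \<and> (\<forall>y\<in>cball 0 N. (u - p) \<bullet> (y - p) \<le> 0)"
  proof (cases "norm u \<le> N")
    case True
    then have "p = u" using N by (cases "u = 0") (auto simp: p_def min_def)
    then show ?thesis using True by simp
  next
    case False
    then have u: "0 < norm u" using N by linarith
    have p: "p = (N / norm u) *\<^sub>R u" using False u by (simp add: p_def min_def)
    have "(u - p) \<bullet> (y - p) \<le> 0" if "norm y \<le> N" for y
    proof -
      have "u \<bullet> y \<le> norm u * norm y" by (rule norm_cauchy_schwarz)
      also have "\<dots> \<le> norm u * N" using that by (intro mult_left_mono) auto
      also have "\<dots> = u \<bullet> p" using u by (simp add: p dot_square_norm power2_eq_square)
      finally have "u \<bullet> (y - p) \<le> 0" by (simp add: inner_diff_right)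
      moreover have "u - p = (1 - N / norm u) *\<^sub>R u" by (simp add: p scaleR_diff_left)
      moreover have "0 \<le> 1 - N / norm u" using False u by simp
      ultimately show ?thesis by (simp add: mult_nonneg_nonpos)
    qed
    then show ?thesis using u N by (auto simp: p)
  qed
  then show "norm p \<le> N" "\<forall>y\<in>cball 0 N. (u - p) \<bullet> (y - p) \<le> 0" by auto
qed

context self_dual_cone
begin

text \<open>
  The vector field is extended from the cone to the whole space through the projection and cut off
  at radius \<open>N\<close>.  Quasi-monotonicity says that the squared distance to the cone cannot increase
  along the flow, so the solution stays in the cone; the energy estimate does not see the cut-off,
  so for large \<open>N\<close> the solution never reaches it.
\<close>

lemma cone_ode_exists:
  fixes f :: "'a \<Rightarrow> 'a" and c :: "real \<Rightarrow> 'a"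
  assumes T: "0 \<le> T"
    and lip: "\<And>r. \<exists>L. \<forall>u\<in>K. \<forall>w\<in>K. norm u \<le> r \<longrightarrow> norm w \<le> r \<longrightarrow>
        norm (f u - f w) \<le> L * norm (u - w)"
    and quasi: "\<And>u x. u \<in> K \<Longrightarrow> x \<in> K \<Longrightarrow> u \<bullet> x = 0 \<Longrightarrow> 0 \<le> f u \<bullet> x"
    and growth: "\<And>u s. u \<in> K \<Longrightarrow> 0 \<le> s \<Longrightarrow> s \<le> 1 \<Longrightarrow>
        u \<bullet> f (s *\<^sub>R u) \<le> a * (u \<bullet> u) + b * norm u"
    and a: "0 \<le> a" and b: "0 \<le> b"
    and c: "continuous_on {0..T} c" "\<And>t. t \<in> {0..T} \<Longrightarrow> c t \<in> K"
    and u0: "u0 \<in> K"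
  shows "\<exists>\<psi>. \<psi> 0 = u0 \<and>
    (\<forall>t\<in>{0..T}. \<psi> t \<in> K \<and> (\<psi> has_vector_derivative f (\<psi> t) + c t) (at t within {0..T}))"
proof -
  have "compact (c ` {0..T})" by (intro compact_continuous_image c compact_Icc)
  then obtain C where C: "\<And>t. t \<in> {0..T} \<Longrightarrow> norm (c t) \<le> C"
    using compact_imp_bounded bounded_iff by (metis imageI)
  have C0: "0 \<le> C" using C[of 0] T norm_ge_zero[of "c 0"] by (simp del: norm_ge_zero)
  \<comment> \<open>Constants of the energy estimate: 2 (b + C) |x| <= (b + C)^2 + |x|^2 adds 1 to
    the rate 2 a, and \<open>M\<close> is the Gronwall bound on |x|^2 up to time \<open>T\<close>.
    They do not involve the cut-off radius, which can therefore be chosen afterwards.\<close>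
  define \<alpha> where "\<alpha> = 2 * a + 1"
  define Q where "Q = (b + C)\<^sup>2"
  define M where "M = (u0 \<bullet> u0 + Q / \<alpha>) * exp (\<alpha> * T)"
  have \<alpha>: "0 < \<alpha>" using a by (simp add: \<alpha>_def)
  have M: "0 \<le> M" using \<alpha> by (simp add: M_def Q_def)
  define N where "N = sqrt M + 1"
  have N: "0 < N" using M by (simp add: N_def add_nonneg_pos)
  define ret where "ret u = min 1 (N / norm u) *\<^sub>R u" for u :: 'a
  have ret_le: "norm (ret u) \<le> N" and
    ret_var: "\<forall>y\<in>cball 0 N. (u - ret u) \<bullet> (y - ret u) \<le> 0" for u
    unfolding ret_def by (rule radial_retraction[OF N])+
  have ret_mem: "ret u \<in> K" if "u \<in> K" for u
    unfolding ret_def using that N by (intro scaleR_mem) auto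
  obtain L where L: "\<And>u w. u \<in> K \<Longrightarrow> w \<in> K \<Longrightarrow> norm u \<le> N \<Longrightarrow> norm w \<le> N \<Longrightarrow>
      norm (f u - f w) \<le> L * norm (u - w)"
    using lip[of N] by blast
  define g where "g u = f (ret (proj u))" for u
  have glip: "norm (g u - g w) \<le> max L 0 * norm (u - w)" for u w
  proof -
    have "norm (g u - g w) \<le> L * norm (ret (proj u) - ret (proj w))"
      unfolding g_def by (intro L ret_mem proj ret_le)
    also have "\<dots> \<le> max L 0 * norm (ret (proj u) - ret (proj w))"
      by (intro mult_right_mono) auto
    also have "\<dots> \<le> max L 0 * norm (proj u - proj w)"
      using ret_le by (intro mult_left_mono projection_nonexpansive[OF _ ret_var _ ret_var]) auto
    also have "\<dots> \<le> max L 0 * norm (u - w)"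
      by (intro mult_left_mono norm_proj_diff_le) auto
    finally show ?thesis .
  qed
  obtain x where x0: "x 0 = u0"
    and x: "\<And>t. t \<in> {0..T} \<Longrightarrow> (x has_vector_derivative g (x t) + c t) (at t within {0..T})"
    using picard_lindelof_global[OF T glip _ c(1), of u0] by auto
  have x_cont: "continuous_on {0..T} x"
    unfolding continuous_on_eq_continuous_within
    using has_vector_derivative_continuous[OF x] by blast
  have x_int: "(x has_vector_derivative g (x t) + c t) (at t)" if "0 < t" "t < T" for t
    using x[of t] that at_within_Icc_at[of 0 t T] by simp
  have proj_id: "proj u = u" if "u \<in> K" for u
    using proj(2)[of u] that order_antisym[OF _ inner_ge_zero[of "u - proj u"]] by auto
  have in_cone: "x t \<in> K" if t: "t \<in> {0..T}" for t
  proof -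
    let ?d = "\<lambda>t. (norm (x t - proj (x t)))\<^sup>2"
    have proj_cont: "continuous_on UNIV proj"
      by (rule lipschitz_on_continuous_on[of 1])
        (auto simp: lipschitz_on_def dist_norm norm_proj_diff_le)
    \<comment> \<open>The derivative of the squared distance is nonpositive; the rate 1 only meets
      the positivity that Gronwall's lemma asks for.\<close>
    have "?d t \<le> (?d 0 + 0 / 1) * exp (1 * t) - 0 / 1"
    proof (rule gronwall_differential[OF _ _ _ _ t])
      show "continuous_on {0..T} ?d"
        by (intro continuous_intros x_cont continuous_on_compose2[OF proj_cont x_cont]) auto
      fix s assume s: "0 < s" "s < T"
      have "(x has_derivative (\<lambda>h. h *\<^sub>R (g (x s) + c s))) (at s)"
        using x_int[OF s] by (simp add: has_vector_derivative_def)
      from has_derivative_compose[OF this dist_cone_has_derivative]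
      have "(?d has_derivative (\<lambda>h. 2 * ((x s - proj (x s)) \<bullet> (h *\<^sub>R (g (x s) + c s))))) (at s)" .
      then show "(?d has_real_derivative 2 * ((x s - proj (x s)) \<bullet> (g (x s) + c s))) (at s)"
        unfolding has_field_derivative_def
        by (rule has_derivative_eq_rhs) (simp add: mult_ac fun_eq_iff)
      \<comment> \<open>The vector from \<open>x s\<close> to its projection lies in the cone and is
        orthogonal to \<open>proj (x s)\<close>, hence to its rescaling by \<open>ret\<close>: the
        configuration for \<open>quasi\<close>.\<close>
      let ?w = "proj (x s) - x s"
      have "proj (x s) \<bullet> ?w = 0" using inner_proj[of "x s"] by (simp add: inner_commute)
      then have "ret (proj (x s)) \<bullet> ?w = 0" by (simp add: ret_def)
      then have "0 \<le> g (x s) \<bullet> ?w"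
        unfolding g_def by (intro quasi ret_mem proj proj_minus_mem)
      moreover have "0 \<le> c s \<bullet> ?w" using s by (intro inner_nonneg c proj_minus_mem) auto
      ultimately have "(x s - proj (x s)) \<bullet> (g (x s) + c s) \<le> 0"
        by (simp add: algebra_simps inner_commute)
      moreover have "0 \<le> ?d s" by simp
      ultimately show "2 * ((x s - proj (x s)) \<bullet> (g (x s) + c s)) \<le> 1 * ?d s + 0" by linarith
    qed simp
    moreover have "?d 0 = 0" by (simp add: proj_id x0 u0)
    ultimately have "x t = proj (x t)" by simp
    then show ?thesis using proj(1)[of "x t"] by simp
  qed
  have small: "norm (x t) \<le> N" if t: "t \<in> {0..T}" for t
  proof -
    have "x t \<bullet> x t \<le> (x 0 \<bullet> x 0 + Q / \<alpha>) * exp (\<alpha> * t) - Q / \<alpha>"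
    proof (rule gronwall_differential[OF _ _ _ \<alpha> t])
      show "continuous_on {0..T} (\<lambda>t. x t \<bullet> x t)" by (intro continuous_intros x_cont)
      fix s assume s: "0 < s" "s < T"
      then have sT: "s \<in> {0..T}" by simp
      show "((\<lambda>t. x t \<bullet> x t) has_real_derivative 2 * (x s \<bullet> (g (x s) + c s))) (at s)"
        by (rule has_real_derivative_inner_self[OF x_int[OF s]])
      \<comment> \<open>The cut-off replaces \<open>x s\<close> by a multiple with factor in [0, 1],
        which is why the growth bound is assumed for all such multiples.\<close>
      have "x s \<bullet> g (x s) \<le> a * (x s \<bullet> x s) + b * norm (x s)"
        unfolding g_def proj_id[OF in_cone[OF sT]] ret_def using N
        by (intro growth in_cone sT) auto
      moreover have "x s \<bullet> c s \<le> norm (x s) * norm (c s)" by (rule norm_cauchy_schwarz)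
      moreover have "norm (x s) * norm (c s) \<le> norm (x s) * C"
        by (intro mult_left_mono C sT) auto
      moreover have "2 * ((b + C) * norm (x s)) \<le> Q + x s \<bullet> x s"
        using sum_squares_bound[of "b + C" "norm (x s)"]
        by (simp only: Q_def power2_norm_eq_inner mult.assoc)
      ultimately show "2 * (x s \<bullet> (g (x s) + c s)) \<le> \<alpha> * (x s \<bullet> x s) + Q"
        by (simp add: \<alpha>_def algebra_simps)
    qed
    also have "\<dots> \<le> M"
    proof -
      have "(u0 \<bullet> u0 + Q / \<alpha>) * exp (\<alpha> * t) \<le> M"
        unfolding M_def using t \<alpha> by (intro mult_left_mono) (auto simp: Q_def)
      moreover have "0 \<le> Q / \<alpha>" using \<alpha> by (simp add: Q_def)
      ultimately show ?thesis using x0 by simp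
    qed
    finally have "norm (x t) \<le> sqrt M" by (simp add: norm_eq_sqrt_inner)
    then show ?thesis by (simp add: N_def)
  qed
  have "g (x t) = f (x t)" if t: "t \<in> {0..T}" for t
  proof -
    have "ret (x t) = x t"
      using small[OF t] N by (cases "x t = 0") (auto simp: ret_def min_def)
    then show ?thesis by (simp add: g_def proj_id[OF in_cone[OF t]])
  qed
  then show ?thesis using x0 x in_cone by (intro exI[of _ x]) auto
qed

text \<open>Both trajectories stay in one ball over a compact interval, so one local Lipschitz
  constant serves Gronwall's lemma for their squared distance.\<close>

lemma cone_ode_unique:
  fixes f :: "'a \<Rightarrow> 'a" and c x y :: "real \<Rightarrow> 'a"
  assumes lip: "\<And>r. \<exists>L. \<forall>u\<in>K. \<forall>w\<in>K. norm u \<le> r \<longrightarrow> norm w \<le> r \<longrightarrow>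
        norm (f u - f w) \<le> L * norm (u - w)"
    and x: "continuous_on {0..T} x" "\<And>t. t \<in> {0..T} \<Longrightarrow> x t \<in> K"
      "\<And>t. 0 < t \<Longrightarrow> t < T \<Longrightarrow> (x has_vector_derivative f (x t) + c t) (at t)"
    and y: "continuous_on {0..T} y" "\<And>t. t \<in> {0..T} \<Longrightarrow> y t \<in> K"
      "\<And>t. 0 < t \<Longrightarrow> t < T \<Longrightarrow> (y has_vector_derivative f (y t) + c t) (at t)"
    and "x 0 = y 0" and t: "t \<in> {0..T}"
  shows "x t = y t"
proof -
  have "bounded (x ` {0..T} \<union> y ` {0..T})"
    by (intro compact_imp_bounded compact_Un compact_continuous_image x y compact_Icc)
  then obtain r where r: "\<And>t. t \<in> {0..T} \<Longrightarrow> norm (x t) \<le> r \<and> norm (y t) \<le> r"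
    unfolding bounded_iff by blast
  obtain L where L: "\<And>u w. u \<in> K \<Longrightarrow> w \<in> K \<Longrightarrow> norm u \<le> r \<Longrightarrow> norm w \<le> r \<Longrightarrow>
      norm (f u - f w) \<le> L * norm (u - w)"
    using lip[of r] by blast
  define l where "l = 2 * \<bar>L\<bar> + 1"
  let ?d = "\<lambda>t. (x t - y t) \<bullet> (x t - y t)"
  have "?d t \<le> (?d 0 + 0 / l) * exp (l * t) - 0 / l"
  proof (rule gronwall_differential[OF _ _ _ _ t])
    show "continuous_on {0..T} ?d" by (intro continuous_intros x y)
    show "0 < l" by (simp add: l_def)
    fix s assume s: "0 < s" "s < T"
    have "((\<lambda>t. x t - y t) has_vector_derivative (f (x s) + c s) - (f (y s) + c s)) (at s)"
      by (intro derivative_intros x y s)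
    then have "((\<lambda>t. x t - y t) has_vector_derivative f (x s) - f (y s)) (at s)" by simp
    from has_real_derivative_inner_self[OF this]
    show "(?d has_real_derivative 2 * ((x s - y s) \<bullet> (f (x s) - f (y s)))) (at s)" .
    have "(x s - y s) \<bullet> (f (x s) - f (y s)) \<le> norm (x s - y s) * norm (f (x s) - f (y s))"
      by (rule norm_cauchy_schwarz)
    also have "\<dots> \<le> norm (x s - y s) * (L * norm (x s - y s))"
      using s r[of s] by (intro mult_left_mono L x y) auto
    also have "\<dots> = L * ?d s"
      by (simp add: power2_norm_eq_inner[symmetric] power2_eq_square)
    also have "\<dots> \<le> \<bar>L\<bar> * ?d s" by (intro mult_right_mono) auto
    finally have "2 * ((x s - y s) \<bullet> (f (x s) - f (y s))) \<le> 2 * (\<bar>L\<bar> * ?d s) + ?d s"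
      using inner_ge_zero[of "x s - y s"] by linarith
    then show "2 * ((x s - y s) \<bullet> (f (x s) - f (y s))) \<le> l * ?d s + 0"
      by (simp add: l_def distrib_right)
  qed
  then have "?d t \<le> 0" using \<open>x 0 = y 0\<close> by simp
  then show ?thesis using inner_ge_zero[of "x t - y t"] by (simp add: order_antisym)
qed

end

section \<open>Strongly continuous semigroups and their adjoints\<close>

text \<open>By Baire's theorem some \<open>V n\<close> contains a ball; differences of points of
  that ball carry the bound to the origin.\<close>

lemma banach_steinhaus:
  fixes F :: "'i \<Rightarrow> 'a::banach \<Rightarrow>\<^sub>L 'b::real_normed_vector"
  assumes "\<And>x. \<exists>M. \<forall>i\<in>I. norm (F i x) \<le> M"
  shows "\<exists>M. \<forall>i\<in>I. norm (F i) \<le> M"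
proof -
  define V where "V n = {x. \<forall>i\<in>I. norm (F i x) \<le> real n}" for n
  have V_closed: "closed (V n)" for n
  proof -
    have "V n = (\<Inter>i\<in>I. {x. norm (F i x) \<le> real n})" by (auto simp: V_def)
    then show ?thesis by (auto intro!: closed_INT closed_Collect_le continuous_intros)
  qed
  have "\<exists>n. x \<in> V n" for x
  proof -
    obtain M where "\<forall>i\<in>I. norm (F i x) \<le> M" using assms by blast
    moreover obtain n where "M \<le> real n" using real_arch_simple by blast
    ultimately have "x \<in> V n" by (auto simp: V_def intro: order_trans)
    then show ?thesis ..
  qed
  then have "\<Union>(range V) = UNIV" by blast
  then have "interior (\<Union>(range V)) \<noteq> {}" by simp
  then have "\<exists>n. interior (V n) \<noteq> {}"
    using Met_TC.metric_Baire_category_alt[of "range V"] V_closed complete_UNIV by auto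
  then obtain n x r where r: "0 < r" "ball x r \<subseteq> V n" by (metis all_not_in_conv mem_interior)
  \<comment> \<open>\<open>y\<close> is rescaled to length r / 2, where a difference of two values
    is at most 2 n; scaling back gives 4 n / r.\<close>
  have "norm (F i) \<le> 4 * real n / r" if i: "i \<in> I" for i
  proof (rule norm_blinfun_bound)
    show "0 \<le> 4 * real n / r" using r by simp
    fix y
    show "norm (F i y) \<le> 4 * real n / r * norm y"
    proof (cases "y = 0")
      case False
      define k where "k = r / 2 / norm y"
      have k: "0 < k" using False r by (simp add: k_def)
      have "x + k *\<^sub>R y \<in> ball x r" "x \<in> ball x r"
        using False r by (auto simp: dist_norm k_def)
      then have *: "norm (F i (x + k *\<^sub>R y)) \<le> n" "norm (F i x) \<le> n"
        using subsetD[OF r(2)] i unfolding V_def by blast+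
      have "k * norm (F i y) = norm (F i (x + k *\<^sub>R y) - F i x)"
        using k by (simp add: blinfun.add_right blinfun.scaleR_right)
      also have "\<dots> \<le> real n + real n" by (intro norm_triangle_le_diff add_mono *)
      finally have "norm (F i y) \<le> 2 * real n / k" using k by (simp add: pos_le_divide_eq mult.commute)
      also have "\<dots> = 4 * real n / r * norm y" using False r by (simp add: k_def field_simps)
      finally show ?thesis .
    qed simp
  qed
  then show ?thesis by blast
qed

lemma has_vector_derivative_right_quotient:
  fixes f :: "real \<Rightarrow> 'a::real_normed_vector"
  assumes "(f has_vector_derivative v) (at t within {t..t + d})" "0 < d"
  shows "((\<lambda>h. (f (t + h) - f t) /\<^sub>R h) \<longlongrightarrow> v) (at_right 0)"
proof (rule tendstoI)
  fix e :: real assume e: "0 < e"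
  obtain d' where d': "0 < d'" "\<And>s. s \<in> {t..t + d} \<Longrightarrow> norm (s - t) < d' \<Longrightarrow>
      norm (f s - f t - (s - t) *\<^sub>R v) \<le> e / 2 * norm (s - t)"
    using assms(1) e unfolding has_vector_derivative_def has_derivative_within_alt
    by (meson half_gt_zero)
  have "dist ((f (t + h) - f t) /\<^sub>R h) v < e" if h: "0 < h" "h < min d d'" for h
  proof -
    have "(f (t + h) - f t) /\<^sub>R h - v = (f (t + h) - f t - h *\<^sub>R v) /\<^sub>R h"
      using h by (simp add: scaleR_diff_right)
    then have "dist ((f (t + h) - f t) /\<^sub>R h) v = norm (f (t + h) - f t - h *\<^sub>R v) / h"
      using h by (simp add: dist_norm divide_inverse_commute)
    also have "\<dots> \<le> e / 2 * h / h" using d'(2)[of "t + h"] h by (intro divide_right_mono) auto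
    finally show ?thesis using h e by simp
  qed
  then show "\<forall>\<^sub>F h in at_right 0. dist ((f (t + h) - f t) /\<^sub>R h) v < e"
    using d'(1) assms(2) unfolding eventually_at_right_field by (intro exI[of _ "min d d'"]) auto
qed

locale semigroup_generator =
  fixes S :: "real \<Rightarrow> 'h::{real_inner,banach} \<Rightarrow>\<^sub>L 'h" and A :: "'h \<Rightarrow> 'h" and domA :: "'h set"
  assumes c0: "c0_semigroup S" and gen: "generates A domA S"
begin

section \<open>Orbits of the semigroup and their derivatives\<close>

lemma S_0: "S 0 x = x"
  using c0 by (simp add: c0_semigroup_def)

lemma S_add: "0 \<le> s \<Longrightarrow> 0 \<le> t \<Longrightarrow> S (s + t) x = S s (S t x)"
  using c0 by (simp add: c0_semigroup_def)

lemma S_continuous: "continuous_on {0..} (\<lambda>t. S t x)"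
  using c0 by (simp add: c0_semigroup_def)

lemma S_continuous_Icc: "0 \<le> a \<Longrightarrow> continuous_on {a..b} (\<lambda>t. S t x)"
  by (rule continuous_on_subset[OF S_continuous]) auto

lemma S_integrable: "0 \<le> a \<Longrightarrow> (\<lambda>t. S t x) integrable_on {a..b}"
  by (intro integrable_continuous_real S_continuous_Icc)

lemma S_bound: "\<exists>M>0. \<forall>t\<in>{0..T}. norm (S t) \<le> M"
proof -
  have "\<exists>M. \<forall>t\<in>{0..T}. norm (S t x) \<le> M" for x
  proof -
    have "bounded ((\<lambda>t. S t x) ` {0..T})"
      by (intro compact_imp_bounded compact_continuous_image S_continuous_Icc) auto
    then show ?thesis by (auto simp: bounded_iff)
  qed
  then obtain M where M: "\<forall>t\<in>{0..T}. norm (S t) \<le> M" using banach_steinhaus[of "{0..T}" S] by blast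
  then show ?thesis by (intro exI[of _ "max M 1"]) force
qed

lemma domA_iff: "x \<in> domA \<longleftrightarrow> (\<exists>y. ((\<lambda>t. (S t x - x) /\<^sub>R t) \<longlongrightarrow> y) (at_right 0))"
  using gen by (simp add: generates_def)

lemma A_tendsto: "x \<in> domA \<Longrightarrow> ((\<lambda>t. (S t x - x) /\<^sub>R t) \<longlongrightarrow> A x) (at_right 0)"
  using gen by (simp add: generates_def)

lemma A_eqI: "((\<lambda>t. (S t x - x) /\<^sub>R t) \<longlongrightarrow> y) (at_right 0) \<Longrightarrow> x \<in> domA \<and> A x = y"
  using A_tendsto domA_iff tendsto_unique[OF trivial_limit_at_right_real] by blast

lemma A_orbit:
  assumes "x \<in> domA" "0 \<le> t"
  shows "S t x \<in> domA" "A (S t x) = S t (A x)"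
proof -
  have "((\<lambda>h. S t ((S h x - x) /\<^sub>R h)) \<longlongrightarrow> S t (A x)) (at_right 0)"
    by (intro tendsto_intros A_tendsto assms)
  moreover have "\<forall>\<^sub>F h in at_right 0. S t ((S h x - x) /\<^sub>R h) = (S h (S t x) - S t x) /\<^sub>R h"
    using eventually_at_right_less
  proof eventually_elim
    case (elim h)
    then have "S h (S t x) = S t (S h x)" using S_add[of h t x] S_add[of t h x] assms by (simp add: add.commute)
    then show ?case by (simp add: blinfun.scaleR_right blinfun.diff_right)
  qed
  ultimately have "((\<lambda>h. (S h (S t x) - S t x) /\<^sub>R h) \<longlongrightarrow> S t (A x)) (at_right 0)"
    by (rule Lim_transform_eventually)
  from A_eqI[OF this] show "S t x \<in> domA" "A (S t x) = S t (A x)" by auto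
qed

text \<open>The generator supplies only the right derivative at 0. To the right of \<open>t\<close>
  it is transported by \<open>S t\<close>; to the left \<open>S s\<close> is factored out at the
  earlier time, leaving \<open>h *\<^sub>R (S s (A x) - S t (A x))\<close>, small by continuity of
  the orbit of \<open>A x\<close>.\<close>

lemma orbit_has_vector_derivative:
  assumes x: "x \<in> domA" and t: "t \<in> {0..T}"
  shows "((\<lambda>t. S t x) has_vector_derivative S t (A x)) (at t within {0..T})"
  unfolding has_vector_derivative_def has_derivative_within_alt
proof (intro conjI allI impI)
  show "bounded_linear (\<lambda>h. h *\<^sub>R S t (A x))" by (rule bounded_linear_scaleR_left)
  fix e :: real assume e: "0 < e"
  obtain M where M: "0 < M" "\<And>s. s \<in> {0..T} \<Longrightarrow> norm (S s) \<le> M" using S_bound by blast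
  have "0 < e / (2 * M)" using e M by simp
  from tendstoD[OF A_tendsto[OF x] this] obtain d1 where d1: "0 < d1"
    "\<And>h. 0 < h \<Longrightarrow> h < d1 \<Longrightarrow> dist ((S h x - x) /\<^sub>R h) (A x) < e / (2 * M)"
    unfolding eventually_at_right_field by auto
  \<comment> \<open>Uniform in the transporting time \<open>r\<close>, since the left-hand case uses
    it with the varying \<open>r = s\<close>.\<close>
  have quot: "norm (S r (S h x - x - h *\<^sub>R A x)) \<le> e / 2 * h" if "0 \<le> h" "h < d1" "r \<in> {0..T}" for h r
  proof (cases "h = 0")
    case False
    then have h: "0 < h" using that by simp
    have "S h x - x - h *\<^sub>R A x = h *\<^sub>R ((S h x - x) /\<^sub>R h - A x)"
      using h by (simp add: scaleR_diff_right)
    then have "norm (S h x - x - h *\<^sub>R A x) = h * dist ((S h x - x) /\<^sub>R h) (A x)"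
      using h by (simp add: dist_norm)
    also have "\<dots> \<le> h * (e / (2 * M))" using d1(2)[OF h] that h by (intro mult_left_mono) auto
    finally have 1: "norm (S h x - x - h *\<^sub>R A x) \<le> h * (e / (2 * M))" .
    have "norm (S r (S h x - x - h *\<^sub>R A x)) \<le> norm (S r) * norm (S h x - x - h *\<^sub>R A x)"
      by (rule norm_blinfun)
    also have "\<dots> \<le> M * (h * (e / (2 * M)))" using M that 1 by (intro mult_mono) auto
    finally show ?thesis using M by (simp add: mult_ac)
  qed (simp add: S_0)
  obtain d2 where d2: "0 < d2"
    "\<And>s. s \<in> {0..T} \<Longrightarrow> dist s t < d2 \<Longrightarrow> dist (S s (A x)) (S t (A x)) < e / 2"
    using S_continuous_Icc[of 0 T "A x"] t e unfolding continuous_on_iff by (metis half_gt_zero order_refl)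
  have "norm (S s x - S t x - (s - t) *\<^sub>R S t (A x)) \<le> e * norm (s - t)"
    if s: "s \<in> {0..T}" "norm (s - t) < min d1 d2" for s
  proof (cases "t \<le> s")
    case True
    define h where "h = s - t"
    have "S s x = S t (S h x)" using S_add[of t h x] t True by (simp add: h_def)
    then have "S s x - S t x - (s - t) *\<^sub>R S t (A x) = S t (S h x - x - h *\<^sub>R A x)"
      by (simp add: h_def blinfun.diff_right blinfun.scaleR_right)
    moreover have "e / 2 * h \<le> e * h" using e True by (simp add: h_def)
    ultimately show ?thesis using quot[of h t] s t True by (simp add: h_def)
  next
    case False
    define h where "h = t - s"
    have "S t x = S s (S h x)" using S_add[of s h x] s False by (simp add: h_def)
    then have "S s x - S t x - (s - t) *\<^sub>R S t (A x)
        = - S s (S h x - x - h *\<^sub>R A x) - h *\<^sub>R (S s (A x) - S t (A x))"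
      by (simp add: h_def blinfun.diff_right blinfun.scaleR_right scaleR_diff_left scaleR_diff_right)
    then have "norm (S s x - S t x - (s - t) *\<^sub>R S t (A x))
        \<le> norm (S s (S h x - x - h *\<^sub>R A x)) + norm (h *\<^sub>R (S s (A x) - S t (A x)))"
      using norm_triangle_ineq4[of "- S s (S h x - x - h *\<^sub>R A x)" "h *\<^sub>R (S s (A x) - S t (A x))"]
      by simp
    also have "\<dots> \<le> e / 2 * h + h * (e / 2)"
    proof (intro add_mono)
      show "norm (S s (S h x - x - h *\<^sub>R A x)) \<le> e / 2 * h" using quot[of h s] s False by (simp add: h_def)
      have "norm (S s (A x) - S t (A x)) \<le> e / 2" using d2(2)[of s] s by (simp add: dist_norm)
      then show "norm (h *\<^sub>R (S s (A x) - S t (A x))) \<le> h * (e / 2)"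
        using False by (simp add: h_def mult_left_mono)
    qed
    also have "\<dots> = e * norm (s - t)" using False by (simp add: h_def)
    finally show ?thesis .
  qed
  then show "\<exists>d>0. \<forall>s\<in>{0..T}. norm (s - t) < d \<longrightarrow>
      norm (S s x - S t x - (s - t) *\<^sub>R S t (A x)) \<le> e * norm (s - t)"
    using d1 d2 by (intro exI[of _ "min d1 d2"]) auto
qed

text \<open>Integrated orbits lie in the domain for every \<open>x\<close>, and divided by
  \<open>t\<close> they recover \<open>x\<close> as \<open>t\<close> tends to 0; density of the
  domain goes through them.\<close>

definition orbit_int :: "real \<Rightarrow> 'h \<Rightarrow> 'h" where
  "orbit_int t x = integral {0..t} (\<lambda>s. S s x)"

lemma orbit_int_right_quotient:
  assumes "0 \<le> t"
  shows "((\<lambda>h. (orbit_int (t + h) x - orbit_int t x) /\<^sub>R h) \<longlongrightarrow> S t x) (at_right 0)"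
proof (rule has_vector_derivative_right_quotient[where d=1])
  have "((\<lambda>t. orbit_int t x) has_vector_derivative S t x) (at t within {0..t + 1})"
    unfolding orbit_int_def using assms by (intro integral_has_vector_derivative S_continuous_Icc) auto
  then show "((\<lambda>t. orbit_int t x) has_vector_derivative S t x) (at t within {t..t + 1})"
    by (rule has_vector_derivative_within_subset) (use assms in auto)
qed simp

lemma orbit_int_0: "orbit_int 0 x = 0"
  by (simp add: orbit_int_def)

lemma S_orbit_int:
  assumes "0 \<le> h" "0 \<le> t"
  shows "S h (orbit_int t x) = orbit_int (t + h) x - orbit_int h x"
proof -
  have "S h (orbit_int t x) = integral {0..t} (\<lambda>s. S h (S s x))"
    unfolding orbit_int_def
    using integral_linear[OF S_integrable[of 0 x t] blinfun.bounded_linear_right[of "S h"]]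
    by (simp add: o_def)
  also have "\<dots> = integral {0..t} ((\<lambda>s. S s x) \<circ> (+) h)"
    using assms by (intro integral_cong) (simp add: S_add)
  also have "\<dots> = integral {h..t + h} (\<lambda>s. S s x)"
    by (simp add: integral_shift_Icc_real)
  also have "\<dots> = orbit_int (t + h) x - orbit_int h x"
    using Henstock_Kurzweil_Integration.integral_combine[where a=0 and c=h and b="t + h" and f="\<lambda>s. S s x"] assms S_integrable
    by (simp add: orbit_int_def algebra_simps)
  finally show ?thesis .
qed

lemma orbit_int_commute:
  assumes "0 \<le> h" "0 \<le> t"
  shows "orbit_int t (S h x) = S h (orbit_int t x)"
proof -
  have "S h (orbit_int t x) = integral {0..t} (\<lambda>s. S h (S s x))"
    unfolding orbit_int_def
    using integral_linear[OF S_integrable[of 0 x t] blinfun.bounded_linear_right[of "S h"]]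
    by (simp add: o_def)
  also have "\<dots> = integral {0..t} (\<lambda>s. S s (S h x))"
    using assms by (intro integral_cong) (simp add: S_add[symmetric] add.commute)
  finally show ?thesis by (simp add: orbit_int_def)
qed

text \<open>By the shift formula the semigroup quotient at \<open>orbit_int t x\<close> is a
  difference of two right difference quotients of \<open>orbit_int\<close>, at \<open>t\<close> and
  at 0.\<close>

lemma orbit_int_mem_domA:
  assumes "0 \<le> t"
  shows "orbit_int t x \<in> domA"
proof -
  have "((\<lambda>h. (orbit_int (t + h) x - orbit_int t x) /\<^sub>R h - (orbit_int (0 + h) x - orbit_int 0 x) /\<^sub>R h) \<longlongrightarrow> S t x - S 0 x) (at_right 0)"
    by (intro tendsto_diff orbit_int_right_quotient assms) simp
  then have "((\<lambda>h. (S h (orbit_int t x) - orbit_int t x) /\<^sub>R h) \<longlongrightarrow> S t x - S 0 x) (at_right 0)"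
  proof (rule Lim_transform_eventually)
    show "\<forall>\<^sub>F h in at_right 0. (orbit_int (t + h) x - orbit_int t x) /\<^sub>R h - (orbit_int (0 + h) x - orbit_int 0 x) /\<^sub>R h
        = (S h (orbit_int t x) - orbit_int t x) /\<^sub>R h"
      using eventually_at_right_less
      by eventually_elim (simp add: S_orbit_int assms orbit_int_0 scaleR_diff_right scaleR_add_right)
  qed
  then show ?thesis using A_eqI by blast
qed

text \<open>Density of the domain in weak form. It makes the description in
  \<open>adjoint_on\<close> unique.\<close>

lemma orthogonal_domA_eq_0:
  assumes "\<And>x. x \<in> domA \<Longrightarrow> x \<bullet> z = 0"
  shows "z = 0"
proof -
  have "y \<bullet> z = 0" for y
  proof -
    have lim: "((\<lambda>h. ((orbit_int (0 + h) y - orbit_int 0 y) /\<^sub>R h) \<bullet> z) \<longlongrightarrow> S 0 y \<bullet> z) (at_right 0)"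
      by (intro tendsto_inner orbit_int_right_quotient tendsto_const) simp
    have "((\<lambda>h. ((orbit_int (0 + h) y - orbit_int 0 y) /\<^sub>R h) \<bullet> z) \<longlongrightarrow> 0) (at_right 0)"
    proof (rule Lim_transform_eventually[OF tendsto_const])
      show "\<forall>\<^sub>F h in at_right 0. 0 = ((orbit_int (0 + h) y - orbit_int 0 y) /\<^sub>R h) \<bullet> z"
        using eventually_at_right_less
        by eventually_elim (simp add: orbit_int_0 assms orbit_int_mem_domA)
    qed
    from tendsto_unique[OF trivial_limit_at_right_real this lim] show ?thesis by (simp add: S_0)
  qed
  from this[of z] show ?thesis by simp
qed

lemma adjoint_domI:
  assumes "\<And>x. x \<in> domA \<Longrightarrow> A x \<bullet> y = x \<bullet> z"
  shows "y \<in> adjoint_dom A domA" "adjoint_on A domA y = z"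
proof -
  show "y \<in> adjoint_dom A domA" using assms by (auto simp: adjoint_dom_def)
  show "adjoint_on A domA y = z" unfolding adjoint_on_def
  proof (rule the_equality)
    fix w assume "\<forall>x\<in>domA. A x \<bullet> y = x \<bullet> w"
    then have "w - z = 0"
      using assms by (intro orthogonal_domA_eq_0) (simp add: inner_diff_right)
    then show "w = z" by simp
  qed (use assms in auto)
qed

lemma adjoint_domD:
  assumes "y \<in> adjoint_dom A domA" "x \<in> domA"
  shows "A x \<bullet> y = x \<bullet> adjoint_on A domA y"
proof -
  obtain z where z: "\<And>x. x \<in> domA \<Longrightarrow> A x \<bullet> y = x \<bullet> z" using assms(1) by (auto simp: adjoint_dom_def)
  show ?thesis using z assms(2) adjoint_domI(2)[OF z] by simp
qed

text \<open>
  Strong continuity of the adjoint semigroup at \<open>0\<close> holds on a closed subspace, which contains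
  the weak integrals of its orbits.  Their orthogonal complement is trivial.
\<close>

lemma adjoint_tendsto:
  "((\<lambda>t. adjoint (S t) y) \<longlongrightarrow> y) (at_right 0)"
proof -
  \<comment> \<open>The horizon 2 accommodates \<open>\<tau> + h\<close> with both at most
    1.\<close>
  obtain M where M: "0 < M" "\<And>s. s \<in> {0..2} \<Longrightarrow> norm (S s) \<le> M" using S_bound by blast
  have adj_le: "norm (adjoint (S t) y) \<le> M * norm y" if "t \<in> {0..2}" for t y
    using adjoint_hilbert_norm[of "S t" y] mult_right_mono[OF M(2)[OF that], of "norm y"] by simp
  define V where "V = {y. ((\<lambda>t. adjoint (S t) y) \<longlongrightarrow> y) (at_right 0)}"
  have sub: "subspace V"
  proof -
    have "adjoint (S t) 0 = 0" for t using adjoint_hilbert_linear(2)[of "S t" 0 0] by simp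
    then show ?thesis
      by (auto simp: subspace_def V_def adjoint_hilbert_linear intro!: tendsto_intros)
  qed
  have "closure V \<subseteq> V"
  proof
    fix y assume y: "y \<in> closure V"
    have "((\<lambda>t. adjoint (S t) y) \<longlongrightarrow> y) (at_right 0)"
    proof (rule tendstoI)
      fix e :: real assume e: "0 < e"
      define d where "d = e / (2 * (M + 1))"
      have d: "0 < d" using e M by (simp add: d_def)
      obtain v where v: "v \<in> V" "norm (y - v) < d"
        using y d unfolding closure_approachable by (metis dist_commute dist_norm)
      have ev: "\<forall>\<^sub>F t in at_right 0. dist (adjoint (S t) v) v < e / 2"
        using v(1) e unfolding V_def by (intro tendstoD[of _ v]) auto
      have "\<forall>\<^sub>F t in at_right 0. t \<in> {0<..<2::real}" by (rule eventually_at_right_real) simp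
      with ev show "\<forall>\<^sub>F t in at_right 0. dist (adjoint (S t) y) y < e"
      proof eventually_elim
        case (elim t)
        have "adjoint (S t) y - y = adjoint (S t) (y - v) + (adjoint (S t) v - v) + (v - y)"
          by (simp add: adjoint_hilbert_linear)
        then have "dist (adjoint (S t) y) y
            = norm (adjoint (S t) (y - v) + (adjoint (S t) v - v) + (v - y))"
          by (simp only: dist_norm)
        also have "\<dots>
            \<le> norm (adjoint (S t) (y - v)) + norm (adjoint (S t) v - v) + norm (v - y)"
          using norm_triangle_ineq[of "adjoint (S t) (y - v) + (adjoint (S t) v - v)" "v - y"]
            norm_triangle_ineq[of "adjoint (S t) (y - v)" "adjoint (S t) v - v"]
          by linarith
        also have "\<dots> \<le> M * norm (y - v) + dist (adjoint (S t) v) v + norm (y - v)"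
          using adj_le[of t "y - v"] elim by (simp add: dist_norm norm_minus_commute)
        also have "\<dots> < (M + 1) * d + e / 2"
        proof -
          have "(M + 1) * norm (y - v) < (M + 1) * d" using v(2) M by (intro mult_strict_left_mono) auto
          then show ?thesis using elim by (simp add: algebra_simps)
        qed
        also have "\<dots> = e" using M by (simp add: d_def field_simps)
        finally show ?case .
      qed
    qed
    then show "y \<in> V" by (simp add: V_def)
  qed
  then have cl: "closed V" using closure_subset_eq by blast
  have orbit_int_bound: "norm (integral {a..b} (\<lambda>s. S s x)) \<le> (b - a) * (M * norm x)"
    if "0 \<le> a" "a \<le> b" "b \<le> 2" for a b x
  proof -
    have "norm (S s x) \<le> M * norm x" if "s \<in> {a..b}" for s
      using norm_blinfun[of "S s" x] mult_right_mono[OF M(2)[of s], of "norm x"] that \<open>0 \<le> a\<close> \<open>b \<le> 2\<close> by simp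
    then have "norm (integral {a..b} (\<lambda>s. S s x)) \<le> M * norm x * (b - a)"
      using that by (intro integral_bound S_continuous_Icc) auto
    then show ?thesis by (simp add: mult_ac)
  qed
  \<comment> \<open>\<open>w\<close> plays the role of the integral of the adjoint orbit of
    \<open>y\<close> over [0, \<tau>]. It comes from Riesz representation because adjoint orbits are
    not yet known to be integrable.\<close>
  have weak: "\<exists>w\<in>V. \<forall>x. orbit_int \<tau> x \<bullet> y = x \<bullet> w" if \<tau>: "0 < \<tau>" "\<tau> \<le> 1" for \<tau> y
  proof -
    have "bounded_linear (\<lambda>x. orbit_int \<tau> x)"
    proof (rule bounded_linear_intro)
      show "orbit_int \<tau> (x + x') = orbit_int \<tau> x + orbit_int \<tau> x'" for x x'
        unfolding orbit_int_def by (simp add: blinfun.add_right integral_add S_integrable)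
      show "orbit_int \<tau> (r *\<^sub>R x) = r *\<^sub>R orbit_int \<tau> x" for r x
        unfolding orbit_int_def by (simp add: blinfun.scaleR_right)
      show "norm (orbit_int \<tau> x) \<le> norm x * (\<tau> * M)" for x
        using orbit_int_bound[of 0 \<tau> x] \<tau> by (simp add: orbit_int_def mult_ac)
    qed
    then obtain w where w: "\<And>x. orbit_int \<tau> x \<bullet> y = x \<bullet> w"
      using riesz_representation[OF bounded_linear_inner_left_comp] by metis
    \<comment> \<open>Shifting by \<open>h\<close> changes the integral only on two intervals of
      length \<open>h\<close>, at the ends of the time range.\<close>
    have "norm (adjoint (S h) w - w) \<le> 2 * h * M * norm y" if h: "0 < h" "h \<le> 1" for h
    proof -
      define z where "z = adjoint (S h) w - w"
      have "z \<bullet> z = S h z \<bullet> w - z \<bullet> w"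
        by (subst (2) z_def) (simp add: inner_diff_right adjoint_works_hilbert)
      also have "\<dots> = (orbit_int (\<tau> + h) z - orbit_int h z - orbit_int \<tau> z) \<bullet> y"
        using h \<tau> by (simp add: w[symmetric] orbit_int_commute S_orbit_int inner_diff_left)
      also have "orbit_int (\<tau> + h) z - orbit_int h z - orbit_int \<tau> z = integral {\<tau>..\<tau> + h} (\<lambda>s. S s z) - integral {0..h} (\<lambda>s. S s z)"
        using Henstock_Kurzweil_Integration.integral_combine[where a=0 and c=\<tau> and b="\<tau> + h" and f="\<lambda>s. S s z"] h \<tau> S_integrable
        by (simp add: orbit_int_def algebra_simps)
      also have "(\<dots>) \<bullet> y \<le> norm (\<dots>) * norm y" by (rule norm_cauchy_schwarz)
      also have "\<dots> \<le> (h * (M * norm z) + h * (M * norm z)) * norm y"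
        using orbit_int_bound[of \<tau> "\<tau> + h" z] orbit_int_bound[of 0 h z] h \<tau>
        by (intro mult_right_mono norm_triangle_le_diff add_mono) auto
      finally have "norm z * norm z \<le> (2 * h * M * norm y) * norm z"
        by (simp add: power2_norm_eq_inner[symmetric] power2_eq_square mult_ac)
      then show ?thesis unfolding z_def[symmetric]
        by (rule square_le_mult_imp_le) (use h M in simp_all)
    qed
    then have ev: "\<forall>\<^sub>F h in at_right 0. norm (adjoint (S h) w - w) \<le> 2 * h * M * norm y"
      unfolding eventually_at_right_field by (intro exI[of _ 1]) auto
    have "((\<lambda>h. 2 * h * M * norm y) \<longlongrightarrow> 2 * 0 * M * norm y) (at_right 0)"
      by (intro tendsto_intros)
    then have "((\<lambda>h. adjoint (S h) w - w) \<longlongrightarrow> 0) (at_right 0)"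
      using Lim_null_comparison[OF ev] by simp
    then have "w \<in> V" unfolding V_def by (simp add: LIM_zero_iff)
    then show ?thesis using w by blast
  qed
  have "V = UNIV"
  proof (rule orthogonal_complement_trivial_imp_dense[OF sub cl])
    fix z assume z: "\<And>v. v \<in> V \<Longrightarrow> v \<bullet> z = 0"
    \<comment> \<open>With \<open>y = orbit_int \<tau> z\<close> and \<open>x = z\<close> the
      left-hand side of \<open>weak\<close> is a squared norm, and the right-hand side vanishes
      because \<open>w\<close> is in \<open>V\<close>.\<close>
    have "orbit_int \<tau> z = 0" if "0 < \<tau>" "\<tau> \<le> 1" for \<tau>
      using weak[OF that, of "orbit_int \<tau> z"] z by (metis inner_commute inner_eq_zero_iff)
    then have "((\<lambda>h. (orbit_int (0 + h) z - orbit_int 0 z) /\<^sub>R h) \<longlongrightarrow> 0) (at_right 0)"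
      by (intro Lim_transform_eventually[OF tendsto_const])
        (auto simp: orbit_int_0 eventually_at_right_field intro!: exI[of _ 1])
    from tendsto_unique[OF trivial_limit_at_right_real this orbit_int_right_quotient] show "z = 0"
      by (simp add: S_0)
  qed
  then show ?thesis unfolding V_def by blast
qed

text \<open>For r < s, factoring out \<open>adjoint (S r)\<close> leaves an increment at 0 over the
  time s - r; using the earlier time covers both sides of \<open>t\<close>.\<close>

lemma adjoint_continuous:
  "continuous_on {0..T} (\<lambda>t. adjoint (S t) y)"
  unfolding continuous_on_iff
proof (intro ballI allI impI)
  fix t e :: real assume t: "t \<in> {0..T}" and e: "0 < e"
  obtain M where M: "0 < M" "\<And>s. s \<in> {0..T} \<Longrightarrow> norm (S s) \<le> M" using S_bound by blast
  have "0 < e / M" using e M by simp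
  from tendstoD[OF adjoint_tendsto this] obtain d where d: "0 < d"
    "\<And>h. 0 < h \<Longrightarrow> h < d \<Longrightarrow> dist (adjoint (S h) y) y < e / M"
    unfolding eventually_at_right_field by blast
  have step: "dist (adjoint (S r) y) (adjoint (S s) y) < e"
    if "r \<in> {0..T}" "s \<in> {0..T}" "r < s" "s - r < d" for r s
  proof -
    have "x \<bullet> adjoint (S s) y = x \<bullet> adjoint (S r) (adjoint (S (s - r)) y)" for x
      using S_add[of "s - r" r x] that by (simp add: adjoint_works_hilbert[symmetric])
    then have "adjoint (S s) y = adjoint (S r) (adjoint (S (s - r)) y)" by (rule inner_left_eqI)
    then have "dist (adjoint (S r) y) (adjoint (S s) y) = norm (adjoint (S r) (y - adjoint (S (s - r)) y))"
      by (simp add: dist_norm adjoint_hilbert_linear)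
    also have "\<dots> \<le> norm (S r) * norm (y - adjoint (S (s - r)) y)" by (rule adjoint_hilbert_norm)
    also have "\<dots> \<le> M * norm (y - adjoint (S (s - r)) y)" using M that by (intro mult_right_mono) auto
    also have "\<dots> < M * (e / M)"
      using d(2)[of "s - r"] that M by (intro mult_strict_left_mono) (auto simp: dist_norm norm_minus_commute)
    finally show ?thesis using M by simp
  qed
  have "dist (adjoint (S s) y) (adjoint (S t) y) < e" if "s \<in> {0..T}" "dist s t < d" for s
  proof (cases s t rule: linorder_cases)
    case less
    then show ?thesis using step[of s t] that t by (auto simp: dist_real_def)
  next
    case greater
    then show ?thesis using step[of t s] that t by (auto simp: dist_real_def dist_commute)
  qed (use e in auto)
  then show "\<exists>d>0. \<forall>s\<in>{0..T}. dist s t < d \<longrightarrow> dist (adjoint (S s) y) (adjoint (S t) y) < e"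
    using d by blast
qed

text \<open>Moving \<open>S s\<close> across the inner product makes the integrand the derivative of
  \<open>S s x \<bullet> y\<close>. By \<open>adjoint_domI\<close> this weak identity also puts the
  integral into the adjoint domain.\<close>

lemma adjoint_orbit_integral_equation:
  assumes x: "x \<in> domA" and t: "0 \<le> t"
  shows "A x \<bullet> integral {0..t} (\<lambda>s. adjoint (S s) y) = x \<bullet> (adjoint (S t) y - y)"
proof -
  have int: "(\<lambda>s. adjoint (S s) y) integrable_on {0..t}"
    by (intro integrable_continuous_real adjoint_continuous)
  have "A x \<bullet> integral {0..t} (\<lambda>s. adjoint (S s) y) = integral {0..t} (\<lambda>s. A x \<bullet> adjoint (S s) y)"
    using integral_linear[OF int bounded_linear_inner_right[of "A x"]] by (simp add: o_def)
  also have "\<dots> = integral {0..t} (\<lambda>s. S s (A x) \<bullet> y)" by (simp add: adjoint_works_hilbert)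
  also have "\<dots> = S t x \<bullet> y - S 0 x \<bullet> y"
  proof (rule integral_unique, rule fundamental_theorem_of_calculus[OF t])
    fix s assume "s \<in> {0..t}"
    from orbit_has_vector_derivative[OF x this]
    show "((\<lambda>s. S s x \<bullet> y) has_vector_derivative S s (A x) \<bullet> y) (at s within {0..t})"
      by (rule bounded_linear.has_vector_derivative[OF bounded_linear_inner_left])
  qed
  also have "\<dots> = x \<bullet> (adjoint (S t) y - y)" by (simp add: S_0 inner_diff_right adjoint_works_hilbert)
  finally show ?thesis .
qed

text \<open>
  With \<open>w t\<close> the integral of \<open>v\<close> over \<open>[0,t]\<close>, the function \<open>s \<mapsto> S (t - s) x \<bullet> w s\<close> has
  derivative \<open>0\<close>.
\<close>

lemma adjoint_integral_equation_unique:
  fixes v :: "real \<Rightarrow> 'h"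
  assumes v: "continuous_on {0..T} v"
    and eq: "\<And>t x. t \<in> {0..T} \<Longrightarrow> x \<in> domA \<Longrightarrow> A x \<bullet> integral {0..t} v = x \<bullet> v t"
    and t: "t \<in> {0..T}"
  shows "v t = 0"
proof -
  define w where "w t = integral {0..t} v" for t
  have w: "(w has_vector_derivative v s) (at s within {0..T})" if "s \<in> {0..T}" for s
    unfolding w_def using integral_has_vector_derivative[OF v that] .
  have "x \<bullet> w t = 0" if x: "x \<in> domA" for x
  proof -
    have der: "((\<lambda>s. S (t - s) x \<bullet> w s) has_vector_derivative 0) (at s within {0..t})"
      if s: "s \<in> {0..t}" for s
    proof -
      have "((\<lambda>r. t - r) has_vector_derivative - 1) (at s within {0..t})"
        using has_vector_derivative_diff[OF has_vector_derivative_const has_vector_derivative_id] by simp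
      moreover have "((\<lambda>r. S r x) has_vector_derivative S (t - s) (A x)) (at (t - s) within (\<lambda>r. t - r) ` {0..t})"
        using orbit_has_vector_derivative[OF x, of "t - s" t] s by simp
      ultimately have d: "((\<lambda>s. S (t - s) x) has_vector_derivative - S (t - s) (A x)) (at s within {0..t})"
        using vector_diff_chain_within[of "\<lambda>r. t - r" "-1" s "{0..t}" "\<lambda>r. S r x"] by (simp add: o_def)
      have "(w has_vector_derivative v s) (at s within {0..T})" using w s t by simp
      then have "(w has_vector_derivative v s) (at s within {0..t})"
        by (rule has_vector_derivative_within_subset) (use t in auto)
      from bounded_bilinear.has_vector_derivative[OF bounded_bilinear_inner d this]
      have "((\<lambda>s. S (t - s) x \<bullet> w s) has_vector_derivative
          (S (t - s) x \<bullet> v s + - S (t - s) (A x) \<bullet> w s)) (at s within {0..t})" .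
      \<comment> \<open>The equation at time \<open>s\<close>, tested at \<open>S (t - s) x\<close>,
        which stays in the domain: the two terms of the product rule cancel.\<close>
      moreover have "S (t - s) (A x) \<bullet> w s = S (t - s) x \<bullet> v s"
        using eq[of s "S (t - s) x"] A_orbit[OF x, of "t - s"] s t by (simp add: w_def)
      ultimately show ?thesis by simp
    qed
    have "((\<lambda>s. 0::real) has_integral S (t - t) x \<bullet> w t - S (t - 0) x \<bullet> w 0) {0..t}"
      using t by (intro fundamental_theorem_of_calculus der) auto
    from has_integral_unique[OF this has_integral_0] show ?thesis by (simp add: S_0 w_def)
  qed
  note w0 = this
  have "x \<bullet> v t = 0" if "x \<in> domA" for x
  proof -
    have "w t = 0" using w0 by (rule orthogonal_domA_eq_0)
    then show ?thesis using eq[OF t that] by (simp add: w_def)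
  qed
  then show ?thesis by (rule orthogonal_domA_eq_0)
qed

end

section \<open>The Hilbert space of self-adjoint Hilbert-Schmidt operators\<close>

text \<open>Bessel bounds partial sums from above. From below, \<open>a\<close> is approximated by a
  finite combination \<open>a'\<close> over \<open>F\<close>, and on every finite \<open>Y\<close>
  containing \<open>F\<close> the Fourier coefficients of \<open>a\<close> do at least as
  well.\<close>

lemma parseval_norm:
  assumes "orthonormal_basis E"
  shows "((\<lambda>e. (a \<bullet> e)\<^sup>2) has_sum (norm a)\<^sup>2) E"
  unfolding has_sum_def
proof (rule tendstoI)
  fix \<epsilon> :: real assume \<epsilon>: "0 < \<epsilon>"
  have E: "pairwise orthogonal E" "\<forall>e\<in>E. norm e = 1" "closure (span E) = UNIV"
    using assms by (auto simp: orthonormal_basis_def)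
  have "0 < sqrt \<epsilon>" using \<epsilon> by simp
  then obtain a' where a': "a' \<in> span E" "norm (a - a') < sqrt \<epsilon>"
    using E(3) closure_approachable[of a "span E"] by (metis UNIV_I dist_commute dist_norm)
  obtain F r where F: "finite F" "F \<subseteq> E" "a' = (\<Sum>e\<in>F. r e *\<^sub>R e)"
    using a'(1) unfolding span_explicit by auto
  have "dist (\<Sum>e\<in>Y. (a \<bullet> e)\<^sup>2) ((norm a)\<^sup>2) < \<epsilon>" if Y: "finite Y" "F \<subseteq> Y" "Y \<subseteq> E" for Y
  proof -
    define c where "c e = (if e \<in> F then r e else 0)" for e
    have a'_eq: "a' = (\<Sum>e\<in>Y. c e *\<^sub>R e)"
      unfolding F(3) using Y F(1) by (intro sum.mono_neutral_cong_left) (auto simp: c_def)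
    have Yo: "pairwise orthogonal Y" "\<forall>e\<in>Y. norm e = 1"
      using E Y by (auto intro: pairwise_subset)
    have "a' \<bullet> a' = (\<Sum>e\<in>Y. c e * (a' \<bullet> e))" by (subst (2) a'_eq) (simp add: inner_sum_right)
    also have "\<dots> = (\<Sum>e\<in>Y. (c e)\<^sup>2)"
      using orthonormal_sum_inner[OF Y(1) Yo] by (simp add: a'_eq power2_eq_square)
    finally have 1: "a' \<bullet> a' = (\<Sum>e\<in>Y. (c e)\<^sup>2)" .
    have 2: "a \<bullet> a' = (\<Sum>e\<in>Y. c e * (a \<bullet> e))" unfolding a'_eq by (simp add: inner_sum_right)
    have "0 \<le> (\<Sum>e\<in>Y. (c e - a \<bullet> e)\<^sup>2)" by (intro sum_nonneg) simp
    also have "\<dots> = (\<Sum>e\<in>Y. (c e)\<^sup>2) - 2 * (\<Sum>e\<in>Y. c e * (a \<bullet> e)) + (\<Sum>e\<in>Y. (a \<bullet> e)\<^sup>2)"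
      by (simp add: power2_diff sum.distrib sum_subtractf sum_distrib_left mult.assoc)
    also have "\<dots> = (norm (a - a'))\<^sup>2 - ((norm a)\<^sup>2 - (\<Sum>e\<in>Y. (a \<bullet> e)\<^sup>2))"
      unfolding 1[symmetric] 2[symmetric]
      by (simp add: power2_norm_eq_inner inner_diff_left inner_diff_right inner_commute)
    also have "(norm (a - a'))\<^sup>2 < (sqrt \<epsilon>)\<^sup>2" using a'(2) by (intro power_strict_mono) auto
    finally have "(norm a)\<^sup>2 - (\<Sum>e\<in>Y. (a \<bullet> e)\<^sup>2) < \<epsilon>" using \<epsilon> by simp
    moreover have "(\<Sum>e\<in>Y. (a \<bullet> e)\<^sup>2) \<le> (norm a)\<^sup>2" using orthonormal_bessel[OF Y(1) Yo] .
    ultimately show ?thesis by (simp add: dist_real_def)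
  qed
  then show "\<forall>\<^sub>F Y in finite_subsets_at_top E. dist (\<Sum>e\<in>Y. (a \<bullet> e)\<^sup>2) ((norm a)\<^sup>2) < \<epsilon>"
    unfolding eventually_finite_subsets_at_top using F(1,2) by blast
qed

lemma parseval:
  assumes "orthonormal_basis E"
  shows "((\<lambda>e. (a \<bullet> e) * (b \<bullet> e)) has_sum (a \<bullet> b)) E"
proof -
  have "((\<lambda>e. (1/4) * (((a + b) \<bullet> e)\<^sup>2 + - ((a - b) \<bullet> e)\<^sup>2))
      has_sum (1/4) * ((norm (a + b))\<^sup>2 + - (norm (a - b))\<^sup>2)) E"
    by (intro has_sum_cmult_right has_sum_add has_sum_uminusI parseval_norm assms)
  moreover have "(1/4) * ((norm (a + b))\<^sup>2 + - (norm (a - b))\<^sup>2) = a \<bullet> b"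
    by (simp add: power2_norm_eq_inner algebra_simps inner_commute)
  moreover have "(1/4) * (((a + b) \<bullet> e)\<^sup>2 + - ((a - b) \<bullet> e)\<^sup>2) = (a \<bullet> e) * (b \<bullet> e)" for e
    by (simp add: inner_add_left inner_diff_left power2_eq_square algebra_simps)
  ultimately show ?thesis by simp
qed

section \<open>Completeness of the Hilbert-Schmidt norm\<close>

lemma op_of_symmetric: "op_of A x \<bullet> y = x \<bullet> op_of A y"
  using op_of_sa[of A] by (simp add: selfadjoint_op_def)

lemma sahs_norm_has_sum: "((\<lambda>e. (norm (op_of A e))\<^sup>2) has_sum (norm A)\<^sup>2) onb"
proof -
  have "(norm A)\<^sup>2 = (\<Sum>\<^sub>\<infinity>e\<in>onb. (norm (op_of A e))\<^sup>2)"
    by (simp add: power2_norm_eq_inner inner_sahs_def hs_inner_def)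
  moreover have "(\<lambda>e. (norm (op_of A e))\<^sup>2) summable_on onb"
    using op_of_hs[of A] by (simp add: hilbert_schmidt_def)
  ultimately show ?thesis by simp
qed

text \<open>Parseval in the range, and symmetry, which turns the coefficients of
  \<open>op_of A x\<close> into \<open>x \<bullet> op_of A e\<close>. Hence Cauchy sequences are
  also Cauchy in operator norm.\<close>

lemma norm_op_of_le: "norm (op_of A x) \<le> norm A * norm x"
proof -
  have "(norm (op_of A x))\<^sup>2 \<le> (norm A)\<^sup>2 * (norm x)\<^sup>2"
  proof (rule has_sum_mono)
    show "((\<lambda>e. (op_of A x \<bullet> e)\<^sup>2) has_sum (norm (op_of A x))\<^sup>2) onb"
      by (rule parseval_norm[OF orthonormal_basis_onb])
    show "((\<lambda>e. (norm (op_of A e))\<^sup>2 * (norm x)\<^sup>2) has_sum (norm A)\<^sup>2 * (norm x)\<^sup>2) onb"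
      by (intro has_sum_cmult_left sahs_norm_has_sum)
    fix e :: 'a
    have "\<bar>op_of A x \<bullet> e\<bar> \<le> norm (op_of A e) * norm x"
      using Cauchy_Schwarz_ineq2[of x "op_of A e"] by (simp only: op_of_symmetric mult.commute)
    then show "(op_of A x \<bullet> e)\<^sup>2 \<le> (norm (op_of A e))\<^sup>2 * (norm x)\<^sup>2"
      by (metis abs_ge_zero power2_abs power_mono power_mult_distrib)
  qed
  then show ?thesis by (simp add: power_mult_distrib[symmetric] power2_le_iff_abs_le)
qed

text \<open>The operator-norm limit is the candidate. Finite partial sums pass to the limit, and
  their bound, uniform in the finite set, gives both the Hilbert-Schmidt property and the
  convergence.\<close>

instance sahs :: ("{real_inner,banach,second_countable_topology}") banach
proof
  fix X :: "nat \<Rightarrow> 'a sahs"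
  assume X: "Cauchy X"
  have "Cauchy (\<lambda>n. op_of (X n))"
  proof (rule CauchyI)
    fix e :: real assume e: "0 < e"
    then obtain N where N: "\<And>m n. N \<le> m \<Longrightarrow> N \<le> n \<Longrightarrow> norm (X m - X n) < e"
      using CauchyD[OF X] by blast
    have "norm (op_of (X m) - op_of (X n)) < e" if "N \<le> m" "N \<le> n" for m n
    proof -
      have "norm (op_of (X m - X n)) \<le> norm (X m - X n)"
        by (intro norm_blinfun_bound norm_op_of_le) simp
      then show ?thesis using N[OF that] by (simp add: op_of_minus)
    qed
    then show "\<exists>N. \<forall>m\<ge>N. \<forall>n\<ge>N. norm (op_of (X m) - op_of (X n)) < e" by blast
  qed
  then obtain A where A: "(\<lambda>n. op_of (X n)) \<longlonglongrightarrow> A"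
    using Cauchy_convergent convergent_def by blast
  have Ax: "(\<lambda>n. op_of (X n) x) \<longlonglongrightarrow> A x" for x by (intro tendsto_intros A)
  have A_sa: "selfadjoint_op A"
    unfolding selfadjoint_op_def
  proof (intro allI)
    fix x y
    have "(\<lambda>n. op_of (X n) x \<bullet> y) \<longlonglongrightarrow> A x \<bullet> y" by (intro tendsto_intros Ax)
    moreover have "(\<lambda>n. op_of (X n) x \<bullet> y) \<longlonglongrightarrow> x \<bullet> A y"
      unfolding op_of_symmetric by (intro tendsto_intros Ax)
    ultimately show "A x \<bullet> y = x \<bullet> A y" by (rule LIMSEQ_unique)
  qed
  have sums: "(\<Sum>e\<in>F. (norm ((op_of (X n) - A) e))\<^sup>2) \<le> d\<^sup>2"
    if d: "\<And>m. n \<le> m \<Longrightarrow> norm (X n - X m) \<le> d" and F: "finite F" "F \<subseteq> onb" for n d F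
  proof (rule LIMSEQ_le_const2)
    show "(\<lambda>m. \<Sum>e\<in>F. (norm ((op_of (X n) - op_of (X m)) e))\<^sup>2)
        \<longlonglongrightarrow> (\<Sum>e\<in>F. (norm ((op_of (X n) - A) e))\<^sup>2)"
      by (intro tendsto_intros A)
    have "(\<Sum>e\<in>F. (norm ((op_of (X n) - op_of (X m)) e))\<^sup>2) \<le> d\<^sup>2" if "n \<le> m" for m
    proof -
      have "(\<Sum>e\<in>F. (norm (op_of (X n - X m) e))\<^sup>2) \<le> (norm (X n - X m))\<^sup>2"
        by (rule has_sum_mono2[OF has_sum_finite[OF F(1)] sahs_norm_has_sum F(2)]) simp
      also have "\<dots> \<le> d\<^sup>2" using d[OF that] by (intro power_mono) auto
      finally show ?thesis by (simp add: op_of_minus)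
    qed
    then show "\<exists>N. \<forall>m\<ge>N. (\<Sum>e\<in>F. (norm ((op_of (X n) - op_of (X m)) e))\<^sup>2) \<le> d\<^sup>2" by blast
  qed
  have diff_hs: "hilbert_schmidt (op_of (X n) - A)"
    if d: "\<And>m. n \<le> m \<Longrightarrow> norm (X n - X m) \<le> d" for n d
    unfolding hilbert_schmidt_def
    by (rule nonneg_bdd_above_summable_on)
      (use sums[OF d] in \<open>auto intro!: bdd_aboveI2[where M="d\<^sup>2"]\<close>)
  obtain N where "\<And>m n. N \<le> m \<Longrightarrow> N \<le> n \<Longrightarrow> norm (X m - X n) < 1"
    using CauchyD[OF X, of 1] by auto
  then have "hilbert_schmidt (op_of (X N) - A)" by (intro diff_hs[where d=1] less_imp_le) auto
  then have "hilbert_schmidt (op_of (X N) + (-1) *\<^sub>R (op_of (X N) - A))"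
    by (intro hilbert_schmidt_add hilbert_schmidt_scaleR op_of_hs)
  then have "hilbert_schmidt A" by simp
  then obtain L where L: "op_of L = A" using A_sa by (metis Abs_sahs_inverse mem_Collect_eq)
  have "X \<longlonglongrightarrow> L"
  proof (rule LIMSEQ_I)
    fix e :: real assume e: "0 < e"
    obtain N where N: "\<And>m n. N \<le> m \<Longrightarrow> N \<le> n \<Longrightarrow> norm (X m - X n) < e / 2"
      using CauchyD[OF X, of "e / 2"] e by auto
    have "norm (X n - L) < e" if n: "N \<le> n" for n
    proof -
      have d: "\<And>m. n \<le> m \<Longrightarrow> norm (X n - X m) \<le> e / 2" using N n by (meson less_imp_le order_trans)
      have "(norm (X n - L))\<^sup>2 = (\<Sum>\<^sub>\<infinity>f\<in>onb. (norm ((op_of (X n) - A) f))\<^sup>2)"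
        using infsumI[OF sahs_norm_has_sum[of "X n - L"]] by (simp add: op_of_minus L)
      also have "\<dots> \<le> (e / 2)\<^sup>2"
        using diff_hs[OF d] sums[OF d]
        by (intro infsum_le_finite_sums) (auto simp: hilbert_schmidt_def)
      finally have "norm (X n - L) \<le> e / 2" using e by (simp add: power2_le_iff_abs_le)
      then show ?thesis using e by simp
    qed
    then show "\<exists>N. \<forall>n\<ge>N. norm (X n - L) < e" by blast
  qed
  then show "convergent X" by (auto simp: convergent_def)
qed

section \<open>Rank-one operators and self-duality of the cone\<close>

definition sq :: "'h::{real_inner,banach,second_countable_topology} \<Rightarrow> 'h sahs" where
  "sq x = Abs_sahs (tensor x x)"

lemma op_of_sq: "op_of (sq x) = tensor x x"
  unfolding sq_def
  by (rule Abs_sahs_inverse)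
    (simp add: tensor_hilbert_schmidt selfadjoint_op_def tensor_apply inner_commute)

lemma inner_sq: "A \<bullet> sq x = op_of A x \<bullet> x"
proof -
  have "((\<lambda>e. (op_of A x \<bullet> e) * (x \<bullet> e)) has_sum op_of A x \<bullet> x) onb"
    by (rule parseval[OF orthonormal_basis_onb])
  moreover have "op_of A e \<bullet> op_of (sq x) e = (op_of A x \<bullet> e) * (x \<bullet> e)" for e
    using op_of_symmetric[of A e x] by (simp add: op_of_sq tensor_apply inner_commute)
  ultimately show ?thesis by (simp add: inner_sahs_def hs_inner_def infsumI)
qed

lemma pos_cone_iff: "A \<in> pos_cone \<longleftrightarrow> (\<forall>x. 0 \<le> A \<bullet> sq x)"
  by (simp add: pos_cone_def positive_op_def inner_sq)

lemma sq_mem_pos_cone: "sq x \<in> pos_cone"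
  by (simp add: pos_cone_def positive_op_def op_of_sq tensor_apply)

lemma sq_continuous: "continuous_on UNIV sq"
proof (rule continuous_at_imp_continuous_on, rule ballI)
  fix a :: 'a
  have "(norm (sq x - sq a))\<^sup>2 = (x \<bullet> x)\<^sup>2 - 2 * (x \<bullet> a)\<^sup>2 + (a \<bullet> a)\<^sup>2" for x
    unfolding power2_norm_eq_inner
    by (simp add: inner_diff_left inner_diff_right inner_sq op_of_sq
        tensor_apply power2_eq_square inner_commute)
  moreover have "((\<lambda>x. (x \<bullet> x)\<^sup>2 - 2 * (x \<bullet> a)\<^sup>2 + (a \<bullet> a)\<^sup>2)
      \<longlongrightarrow> (a \<bullet> a)\<^sup>2 - 2 * (a \<bullet> a)\<^sup>2 + (a \<bullet> a)\<^sup>2) (at a)"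
    by (intro tendsto_intros)
  ultimately have "((\<lambda>x. sqrt ((norm (sq x - sq a))\<^sup>2)) \<longlongrightarrow> sqrt 0) (at a)"
    by (intro tendsto_real_sqrt) simp
  then have "((\<lambda>x. norm (sq x - sq a)) \<longlongrightarrow> 0) (at a)" by simp
  then show "isCont sq a"
    unfolding isCont_def by (simp add: tendsto_norm_zero_iff LIM_zero_iff)
qed

text \<open>
  Eliminating one vector \<open>k\<close> of \<open>F\<close> at a time, as in a Cholesky factorisation, splits \<open>B\<close> into
  positive multiples of \<open>B k \<otimes> B k\<close>.
\<close>

lemma positive_op_finite_sum_nonneg:
  fixes A B :: "'h::real_inner \<Rightarrow>\<^sub>L 'h"
  assumes A: "positive_op A"
    and "finite F" "positive_op B" "selfadjoint_op B"
  shows "0 \<le> (\<Sum>e\<in>F. \<Sum>f\<in>F. (A e \<bullet> f) * (B e \<bullet> f))"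
  using assms(2-)
proof (induction F arbitrary: B rule: finite_induct)
  case (insert k F)
  have sym: "B x \<bullet> y = B y \<bullet> x" for x y
    using insert.prems(2) by (simp add: selfadjoint_op_def inner_commute)
  have pos: "0 \<le> B x \<bullet> x" for x using insert.prems(1) by (simp add: positive_op_def)
  \<comment> \<open>A symmetric operator that kills \<open>k\<close> has zero row and column at
    \<open>k\<close>, so the sum drops to \<open>F\<close> and the induction hypothesis
    applies.\<close>
  have reduce: "(\<Sum>e\<in>insert k F. \<Sum>f\<in>insert k F. (A e \<bullet> f) * (C e \<bullet> f))
      = (\<Sum>e\<in>F. \<Sum>f\<in>F. (A e \<bullet> f) * (C e \<bullet> f))"
    if "C k = 0" "selfadjoint_op C" for C :: "'h \<Rightarrow>\<^sub>L 'h"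
  proof -
    have "C e \<bullet> k = 0" for e using that by (simp add: selfadjoint_op_def)
    then show ?thesis using insert.hyps that(1) by simp
  qed
  show ?case
  proof (cases "B k \<bullet> k = 0")
    case True
    have "B k \<bullet> x = 0" for x
    proof (rule ccontr)
      assume nz: "B k \<bullet> x \<noteq> 0"
      \<comment> \<open>This makes the quadratic form at \<open>x + s *\<^sub>R k\<close> equal to
        -1, against positivity.\<close>
      define s where "s = - (B x \<bullet> x + 1) / (2 * (B k \<bullet> x))"
      have "0 \<le> B (x + s *\<^sub>R k) \<bullet> (x + s *\<^sub>R k)" by (rule pos)
      also have "\<dots> = B x \<bullet> x + 2 * s * (B k \<bullet> x)"
        using True sym[of x k]
        by (simp add: blinfun.add_right blinfun.scaleR_right inner_add_left inner_add_right)
      also have "\<dots> = - 1" using nz by (simp add: s_def field_simps)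
      finally show False by simp
    qed
    then have "B k = 0" by (metis inner_eq_zero_iff)
    then show ?thesis using reduce[of B] insert.IH[of B] insert.prems by simp
  next
    case False
    then have k: "0 < B k \<bullet> k" using pos[of k] by simp
    define C where "C = B - (1 / (B k \<bullet> k)) *\<^sub>R tensor (B k) (B k)"
    have C: "C x = B x - ((B k \<bullet> x) / (B k \<bullet> k)) *\<^sub>R B k" for x
      by (simp add: C_def blinfun.diff_left blinfun.scaleR_left tensor_apply)
    have "positive_op C"
      unfolding positive_op_def
    proof
      fix x
      \<comment> \<open>The minimiser along \<open>k\<close>: the form of \<open>C\<close> at
        \<open>x\<close> is the form of \<open>B\<close> at
        \<open>x - s *\<^sub>R k\<close>.\<close>
      define s where "s = (B k \<bullet> x) / (B k \<bullet> k)"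
      have "0 \<le> B (x - s *\<^sub>R k) \<bullet> (x - s *\<^sub>R k)" by (rule pos)
      also have "\<dots> = B x \<bullet> x - s * (B k \<bullet> x) - s * ((B k \<bullet> x) - s * (B k \<bullet> k))"
        using sym[of x k]
        by (simp add: blinfun.diff_right blinfun.scaleR_right inner_diff_left inner_diff_right algebra_simps)
      also have "\<dots> = C x \<bullet> x" using k by (simp add: C s_def inner_diff_left)
      finally show "0 \<le> C x \<bullet> x" .
    qed
    moreover have C_sa: "selfadjoint_op C"
      using sym by (simp add: selfadjoint_op_def C inner_diff_left inner_diff_right inner_commute)
    moreover have "C k = 0" using k by (simp add: C)
    ultimately have 1: "0 \<le> (\<Sum>e\<in>insert k F. \<Sum>f\<in>insert k F. (A e \<bullet> f) * (C e \<bullet> f))"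
      using reduce insert.IH by simp
    define g where "g = (\<Sum>e\<in>insert k F. (B k \<bullet> e) *\<^sub>R e)"
    have "A g \<bullet> g = (\<Sum>e\<in>insert k F. \<Sum>f\<in>insert k F. (A e \<bullet> f) * ((B k \<bullet> e) * (B k \<bullet> f)))"
      unfolding g_def
      by (simp only: blinfun.sum_right blinfun.scaleR_right inner_sum_left inner_sum_right
          inner_scaleR_left inner_scaleR_right sum_distrib_left mult_ac)
        (subst sum.swap, simp only: mult_ac)
    then have 2: "0 \<le> (\<Sum>e\<in>insert k F. \<Sum>f\<in>insert k F. (A e \<bullet> f) * ((B k \<bullet> e) * (B k \<bullet> f)))"
      using A unfolding positive_op_def by metis
    have "(A e \<bullet> f) * (B e \<bullet> f) = (A e \<bullet> f) * (C e \<bullet> f)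
        + 1 / (B k \<bullet> k) * ((A e \<bullet> f) * ((B k \<bullet> e) * (B k \<bullet> f)))" for e f
      by (simp add: C inner_diff_left algebra_simps)
    then have "(\<Sum>e\<in>insert k F. \<Sum>f\<in>insert k F. (A e \<bullet> f) * (B e \<bullet> f))
        = (\<Sum>e\<in>insert k F. \<Sum>f\<in>insert k F. (A e \<bullet> f) * (C e \<bullet> f))
          + 1 / (B k \<bullet> k) * (\<Sum>e\<in>insert k F. \<Sum>f\<in>insert k F. (A e \<bullet> f) * ((B k \<bullet> e) * (B k \<bullet> f)))"
      by (simp only: sum.distrib sum_distrib_left)
    then show ?thesis using 1 2 k by (simp only:) (intro add_nonneg_nonneg mult_nonneg_nonneg; simp)
  qed
qed simp

text \<open>Square summability of the matrix entries makes the double sum absolutely convergent, so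
  it may be summed iteratively or exhausted by arbitrary finite index sets.\<close>

lemma sahs_inner_has_sum:
  "((\<lambda>(e, f). (op_of A e \<bullet> f) * (op_of B e \<bullet> f)) has_sum A \<bullet> B) (onb \<times> onb)"
proof -
  have sq_summable: "(\<lambda>(e, f). (op_of C e \<bullet> f)\<^sup>2) summable_on (onb \<times> onb)" for C :: "'a sahs"
  proof (rule summable_on_SigmaI)
    show "((\<lambda>f. (case (e, f) of (e, f) \<Rightarrow> (op_of C e \<bullet> f)\<^sup>2)) has_sum (norm (op_of C e))\<^sup>2) onb" for e
      using parseval_norm[OF orthonormal_basis_onb] by simp
    show "(\<lambda>e. (norm (op_of C e))\<^sup>2) summable_on onb"
      using op_of_hs[of C] by (simp add: hilbert_schmidt_def)
  qed auto
  have "(\<lambda>p. (case p of (e, f) \<Rightarrow> (op_of A e \<bullet> f)\<^sup>2) + (case p of (e, f) \<Rightarrow> (op_of B e \<bullet> f)\<^sup>2))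
      summable_on (onb \<times> onb)"
    by (intro summable_on_add sq_summable)
  then have "(\<lambda>p. norm (case p of (e, f) \<Rightarrow> (op_of A e \<bullet> f) * (op_of B e \<bullet> f))) summable_on (onb \<times> onb)"
  proof (rule summable_on_comparison_test)
    fix p :: "'a \<times> 'a"
    obtain e f where p: "p = (e, f)" by (cases p)
    have "\<bar>x * y\<bar> \<le> x\<^sup>2 + y\<^sup>2" for x y :: real
      using sum_squares_bound[of "\<bar>x\<bar>" "\<bar>y\<bar>"] abs_ge_zero[of "x * y"]
      unfolding power2_abs mult.assoc abs_mult[symmetric] by linarith
    then show "norm (case p of (e, f) \<Rightarrow> (op_of A e \<bullet> f) * (op_of B e \<bullet> f))
      \<le> (case p of (e, f) \<Rightarrow> (op_of A e \<bullet> f)\<^sup>2) + (case p of (e, f) \<Rightarrow> (op_of B e \<bullet> f)\<^sup>2)"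
      by (simp add: p)
  qed simp
  then have sm: "(\<lambda>(e, f). (op_of A e \<bullet> f) * (op_of B e \<bullet> f)) summable_on (onb \<times> onb)"
    by (rule abs_summable_summable)
  have "(\<Sum>\<^sub>\<infinity>(e, f)\<in>onb \<times> onb. (op_of A e \<bullet> f) * (op_of B e \<bullet> f))
      = (\<Sum>\<^sub>\<infinity>e\<in>onb. \<Sum>\<^sub>\<infinity>f\<in>onb. (op_of A e \<bullet> f) * (op_of B e \<bullet> f))"
    using infsum_Sigma'_banach[of "\<lambda>e f. (op_of A e \<bullet> f) * (op_of B e \<bullet> f)" onb "\<lambda>_. onb"] sm by simp
  also have "\<dots> = A \<bullet> B"
    by (simp add: infsumI[OF parseval[OF orthonormal_basis_onb]] inner_sahs_def hs_inner_def)
  finally show ?thesis using has_sum_infsum[OF sm] by simp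
qed

text \<open>A negative value would make all large finite partial sums negative, among them one over
  a square \<open>F \<times> F\<close>, against the finite-matrix case.\<close>

lemma pos_cone_inner_nonneg:
  assumes "A \<in> pos_cone" "B \<in> pos_cone"
  shows "0 \<le> A \<bullet> B"
proof (rule ccontr)
  assume "\<not> 0 \<le> A \<bullet> B"
  let ?g = "\<lambda>(e, f). (op_of A e \<bullet> f) * (op_of B e \<bullet> f)"
  have "\<forall>\<^sub>F X in finite_subsets_at_top (onb \<times> onb). sum ?g X < 0"
    using sahs_inner_has_sum[of A B] \<open>\<not> 0 \<le> A \<bullet> B\<close>
    unfolding has_sum_def by (intro order_tendstoD) auto
  then obtain X where "finite X \<and> X \<subseteq> onb \<times> onb \<and>
      (\<forall>Y. finite Y \<and> X \<subseteq> Y \<and> Y \<subseteq> onb \<times> onb \<longrightarrow> sum ?g Y < 0)"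
    unfolding eventually_finite_subsets_at_top by (rule exE)
  then have X: "finite X" "X \<subseteq> onb \<times> onb"
    "\<And>Y. finite Y \<Longrightarrow> X \<subseteq> Y \<Longrightarrow> Y \<subseteq> onb \<times> onb \<Longrightarrow> sum ?g Y < 0"
    by simp_all
  define F where "F = fst ` X \<union> snd ` X"
  have "sum ?g (F \<times> F) < 0"
  proof (rule X(3))
    show "finite (F \<times> F)" using X(1) by (simp add: F_def)
    show "X \<subseteq> F \<times> F" unfolding F_def by (force simp: image_iff)
    show "F \<times> F \<subseteq> onb \<times> onb" using X(2) by (auto simp: F_def)
  qed
  moreover have "sum ?g (F \<times> F) = (\<Sum>e\<in>F. \<Sum>f\<in>F. (op_of A e \<bullet> f) * (op_of B e \<bullet> f))"
    by (simp add: sum.cartesian_product)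
  moreover have "0 \<le> (\<Sum>e\<in>F. \<Sum>f\<in>F. (op_of A e \<bullet> f) * (op_of B e \<bullet> f))"
    using assms X(1) op_of_sa[of B]
    by (intro positive_op_finite_sum_nonneg) (auto simp: pos_cone_def F_def)
  ultimately show False by simp
qed

interpretation pos_cone: self_dual_cone "pos_cone :: 'h::{real_inner,banach,second_countable_topology} sahs set"
proof
  fix A :: "'h sahs"
  show "A \<in> pos_cone \<longleftrightarrow> (\<forall>B\<in>pos_cone. 0 \<le> A \<bullet> B)"
    using pos_cone_inner_nonneg pos_cone_iff sq_mem_pos_cone by blast
qed

section \<open>Cone-valued measures\<close>

lemma space_cone_borel: "space cone_borel = pos_cone - {0}"
  by (simp add: cone_borel_def space_restrict_space)

lemma punctured_cone_measurable: "pos_cone - {0} \<in> sets cone_borel"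
  using sets.top[of cone_borel] by (simp add: space_cone_borel)

lemma inner_const_borel_measurable [measurable]:
  fixes u :: "'a::real_inner"
  shows "(\<lambda>\<xi>. \<xi> \<bullet> u) \<in> borel_measurable borel"
  by (intro borel_measurable_continuous_onI continuous_intros)

context
  fixes \<mu> :: "'h::{real_inner,banach,second_countable_topology} sahs set \<Rightarrow> 'h sahs"
  assumes \<mu>: "cone_valued_measure \<mu>"
begin

lemma sets_scalar_measure: "sets (scalar_measure \<mu> x) = sets cone_borel"
  by (simp add: scalar_measure_def)

lemma space_scalar_measure: "space (scalar_measure \<mu> x) = pos_cone - {0}"
  unfolding scalar_measure_def space_cone_borel[symmetric] by (rule space_measure_of[OF sets.space_closed])

text \<open>\<open>measure_of\<close> returns the intended values only for an actual measure.
  Nonnegativity comes from self-duality, additivity from norm convergence of the vector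
  series.\<close>

lemma emeasure_scalar_measure:
  assumes x: "x \<in> pos_cone" and X: "X \<in> sets cone_borel"
  shows "emeasure (scalar_measure \<mu> x) X = ennreal (\<mu> X \<bullet> x)"
  unfolding scalar_measure_def
proof (rule emeasure_measure_of_sigma[OF _ _ _ X])
  show "sigma_algebra (space cone_borel) (sets cone_borel)" by (rule sets.sigma_algebra_axioms)
  show "positive (sets cone_borel) (\<lambda>X. ennreal (\<mu> X \<bullet> x))"
    using \<mu> by (simp add: positive_def cone_valued_measure_def)
  show "countably_additive (sets cone_borel) (\<lambda>X. ennreal (\<mu> X \<bullet> x))"
    unfolding countably_additive_def
  proof (intro allI impI)
    fix Y :: "nat \<Rightarrow> 'h sahs set"
    assume Y: "range Y \<subseteq> sets cone_borel" "disjoint_family Y"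
    have "(\<lambda>n. \<mu> (Y n)) sums \<mu> (\<Union>n. Y n)" using \<mu> Y by (simp add: cone_valued_measure_def)
    then have "(\<lambda>n. \<mu> (Y n) \<bullet> x) sums (\<mu> (\<Union>n. Y n) \<bullet> x)"
      by (rule bounded_linear.sums[OF bounded_linear_inner_left])
    moreover have "0 \<le> \<mu> (Y n) \<bullet> x" for n
      using \<mu> Y(1) x by (intro pos_cone_inner_nonneg) (auto simp: cone_valued_measure_def)
    ultimately show "(\<Sum>n. ennreal (\<mu> (Y n) \<bullet> x)) = ennreal (\<mu> (\<Union>n. Y n) \<bullet> x)"
      by (intro suminf_ennreal_eq)
  qed
qed

lemma measure_scalar_measure:
  assumes "x \<in> pos_cone" "X \<in> sets cone_borel"
  shows "measure (scalar_measure \<mu> x) X = \<mu> X \<bullet> x"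
proof -
  have "0 \<le> \<mu> X \<bullet> x"
    using \<mu> assms by (intro pos_cone_inner_nonneg) (auto simp: cone_valued_measure_def)
  then show ?thesis by (simp add: measure_def emeasure_scalar_measure[OF assms])
qed

lemma finite_scalar_measure: "x \<in> pos_cone \<Longrightarrow> finite_measure (scalar_measure \<mu> x)"
  by (intro finite_measureI)
    (simp add: space_scalar_measure emeasure_scalar_measure punctured_cone_measurable)

lemma measure_space_scalar_measure:
  "x \<in> pos_cone \<Longrightarrow> measure (scalar_measure \<mu> x) (space (scalar_measure \<mu> x)) = \<mu> (pos_cone - {0}) \<bullet> x"
  by (simp add: space_scalar_measure measure_scalar_measure punctured_cone_measurable)

lemma integrable_scalar_measure:
  fixes f :: "'h sahs \<Rightarrow> real"
  assumes x: "x \<in> pos_cone" and f: "f \<in> borel_measurable cone_borel"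
    and C: "\<And>\<xi>. \<xi> \<in> pos_cone - {0} \<Longrightarrow> \<bar>f \<xi>\<bar> \<le> C"
  shows "integrable (scalar_measure \<mu> x) f"
proof (rule finite_measure.integrable_const_bound[OF finite_scalar_measure[OF x]])
  show "AE \<xi> in scalar_measure \<mu> x. norm (f \<xi>) \<le> C"
    using C by (intro AE_I2) (simp add: space_scalar_measure)
  show "f \<in> borel_measurable (scalar_measure \<mu> x)"
    using f by (simp add: measurable_cong_sets[OF sets_scalar_measure refl])
qed

lemma abs_integral_scalar_measure_le:
  fixes f :: "'h sahs \<Rightarrow> real"
  assumes x: "x \<in> pos_cone" and f: "integrable (scalar_measure \<mu> x) f"
    and C: "\<And>\<xi>. \<xi> \<in> pos_cone - {0} \<Longrightarrow> \<bar>f \<xi>\<bar> \<le> C"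
  shows "\<bar>\<integral>\<xi>. f \<xi> \<partial>scalar_measure \<mu> x\<bar> \<le> C * (\<mu> (pos_cone - {0}) \<bullet> x)"
proof -
  interpret finite_measure "scalar_measure \<mu> x" by (rule finite_scalar_measure[OF x])
  have "\<bar>\<integral>\<xi>. f \<xi> \<partial>scalar_measure \<mu> x\<bar> \<le> (\<integral>\<xi>. \<bar>f \<xi>\<bar> \<partial>scalar_measure \<mu> x)"
    using integral_norm_bound[of "scalar_measure \<mu> x" f] by simp
  also have "\<dots> \<le> (\<integral>\<xi>. C \<partial>scalar_measure \<mu> x)"
    using f C by (intro integral_mono) (auto simp: space_scalar_measure)
  also have "\<dots> = C * (\<mu> (pos_cone - {0}) \<bullet> x)"
    using measure_space_scalar_measure[OF x] by simp
  finally show ?thesis .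
qed

text \<open>The integral is the limit of the integrals of the step functions \<open>\<lfloor>n f\<rfloor> / n\<close>.\<close>

lemma cone_integral_exists:
  fixes f :: "'h sahs \<Rightarrow> real"
  assumes f: "f \<in> borel_measurable cone_borel"
    and C: "\<And>\<xi>. \<xi> \<in> pos_cone - {0} \<Longrightarrow> \<bar>f \<xi>\<bar> \<le> C"
  shows "\<exists>z. \<forall>x\<in>pos_cone. z \<bullet> x = (\<integral>\<xi>. f \<xi> \<partial>scalar_measure \<mu> x)"
proof -
  let ?M = "\<mu> (pos_cone - {0})"
  define L where "L n k = {\<xi> \<in> space cone_borel. \<lfloor>real (Suc n) * f \<xi>\<rfloor> = k}" for n and k :: int
  \<comment> \<open>Boundedness of \<open>f\<close> by \<open>C\<close> leaves finitely many levels;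
    the margin of 1 absorbs the rounding.\<close>
  define I where "I n = {- \<lceil>real (Suc n) * C\<rceil> - 1..\<lceil>real (Suc n) * C\<rceil> + 1}" for n
  define z where "z n = (\<Sum>k\<in>I n. (real_of_int k / real (Suc n)) *\<^sub>R \<mu> (L n k))" for n
  have L_sets: "L n k \<in> sets cone_borel" for n k
    unfolding L_def using f by measurable
  have step: "\<bar>z n \<bullet> x - (\<integral>\<xi>. f \<xi> \<partial>scalar_measure \<mu> x)\<bar> \<le> 1 / real (Suc n) * (?M \<bullet> x)"
    if x: "x \<in> pos_cone" for n x
  proof -
    define g where "g \<xi> = (\<Sum>k\<in>I n. (real_of_int k / real (Suc n)) * indicator (L n k) \<xi>)" for \<xi>
    have g_eq: "g \<xi> = \<lfloor>real (Suc n) * f \<xi>\<rfloor> / real (Suc n)" if \<xi>: "\<xi> \<in> pos_cone - {0}" for \<xi>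
    proof -
      have "\<bar>real (Suc n) * f \<xi>\<bar> \<le> real (Suc n) * C"
        unfolding abs_mult using C[OF \<xi>] by (intro mult_mono) auto
      then have "\<lfloor>real (Suc n) * f \<xi>\<rfloor> \<in> I n" unfolding I_def by (simp; linarith)
      moreover have "g \<xi> = (\<Sum>k\<in>I n. if k = \<lfloor>real (Suc n) * f \<xi>\<rfloor> then real_of_int k / real (Suc n) else 0)"
        unfolding g_def using \<xi> by (intro sum.cong) (auto simp: L_def space_cone_borel)
      ultimately show ?thesis by (simp add: I_def)
    qed
    have close: "\<bar>g \<xi> - f \<xi>\<bar> \<le> 1 / real (Suc n)" if "\<xi> \<in> pos_cone - {0}" for \<xi>
    proof -
      have "g \<xi> - f \<xi> = (\<lfloor>real (Suc n) * f \<xi>\<rfloor> - real (Suc n) * f \<xi>) / real (Suc n)"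
        by (simp add: g_eq[OF that] diff_divide_distrib del: of_nat_Suc)
      also have "\<bar>\<dots>\<bar> = \<bar>\<lfloor>real (Suc n) * f \<xi>\<rfloor> - real (Suc n) * f \<xi>\<bar> / real (Suc n)"
        by simp
      also have "\<dots> \<le> 1 / real (Suc n)"
        by (intro divide_right_mono) (linarith, simp)
      finally show ?thesis .
    qed
    have ind: "integrable (scalar_measure \<mu> x) (indicator (L n k) :: 'h sahs \<Rightarrow> real)" for k
      using finite_measure.emeasure_finite[OF finite_scalar_measure[OF x], of "L n k"] L_sets
      by (intro integrable_real_indicator) (auto simp: sets_scalar_measure top.not_eq_extremum)
    have g_int: "integrable (scalar_measure \<mu> x) g"
      unfolding g_def by (intro Bochner_Integration.integrable_sum integrable_mult_right ind)
    have f_int: "integrable (scalar_measure \<mu> x) f" by (rule integrable_scalar_measure[OF x f C])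
    have "L n k \<inter> space (scalar_measure \<mu> x) = L n k" for k
      by (auto simp: L_def space_scalar_measure space_cone_borel)
    then have "(\<integral>\<xi>. g \<xi> \<partial>scalar_measure \<mu> x) = z n \<bullet> x"
      unfolding g_def z_def
      by (subst Bochner_Integration.integral_sum)
        (simp_all add: ind inner_sum_left measure_scalar_measure[OF x L_sets] del: of_nat_Suc)
    then have "z n \<bullet> x - (\<integral>\<xi>. f \<xi> \<partial>scalar_measure \<mu> x) = (\<integral>\<xi>. g \<xi> - f \<xi> \<partial>scalar_measure \<mu> x)"
      using g_int f_int by simp
    then show ?thesis
      using abs_integral_scalar_measure_le[OF x Bochner_Integration.integrable_diff[OF g_int f_int] close] by simp
  qed
  have zz: "norm (z n - z k) \<le> (1 / real (Suc n) + 1 / real (Suc k)) * norm ?M" for n k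
  proof -
    \<comment> \<open>Scalar errors against all cone elements become one norm bound through
      self-duality.\<close>
    have "norm (z n - z k) \<le> norm ((1 / real (Suc n) + 1 / real (Suc k)) *\<^sub>R ?M)"
    proof (rule pos_cone.norm_le_of_abs_inner_le)
      fix x :: "'h sahs" assume x: "x \<in> pos_cone"
      show "\<bar>(z n - z k) \<bullet> x\<bar> \<le> ((1 / real (Suc n) + 1 / real (Suc k)) *\<^sub>R ?M) \<bullet> x"
        using step[OF x, of n] step[OF x, of k]
        by (simp add: inner_diff_left distrib_right del: of_nat_Suc)
    qed
    also have "\<dots> = (1 / real (Suc n) + 1 / real (Suc k)) * norm ?M"
      by (simp del: of_nat_Suc)
    finally show ?thesis .
  qed
  have "Cauchy z"
  proof (rule CauchyI)
    fix e :: real assume e: "0 < e"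
    have "0 < e / (2 * (norm ?M + 1))" using e by (simp add: add_nonneg_pos)
    from reals_Archimedean[OF this] obtain N where N: "1 / real (Suc N) < e / (2 * (norm ?M + 1))"
      by (auto simp: inverse_eq_divide)
    have "norm (z n - z k) < e" if "N \<le> n" "N \<le> k" for n k
    proof -
      have "(1 / real (Suc n) + 1 / real (Suc k)) * norm ?M
          \<le> (1 / real (Suc N) + 1 / real (Suc N)) * norm ?M"
        using that by (intro mult_right_mono add_mono divide_left_mono) auto
      also have "\<dots> \<le> (2 * (1 / real (Suc N))) * (norm ?M + 1)" by (intro mult_mono) auto
      also have "\<dots> < (2 * (e / (2 * (norm ?M + 1)))) * (norm ?M + 1)"
        using N by (intro mult_strict_right_mono mult_strict_left_mono) (auto simp: add_nonneg_pos)
      also have "\<dots> = e" using norm_ge_zero[of ?M] by (simp add: field_simps del: norm_ge_zero)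
      finally show ?thesis using zz[of n k] by simp
    qed
    then show "\<exists>N. \<forall>n\<ge>N. \<forall>k\<ge>N. norm (z n - z k) < e" by blast
  qed
  then obtain w where w: "z \<longlonglongrightarrow> w" using Cauchy_convergent convergent_def by blast
  have "w \<bullet> x = (\<integral>\<xi>. f \<xi> \<partial>scalar_measure \<mu> x)" if x: "x \<in> pos_cone" for x
  proof (rule LIMSEQ_unique)
    show "(\<lambda>n. z n \<bullet> x) \<longlonglongrightarrow> w \<bullet> x" by (intro tendsto_intros w)
    have "(\<lambda>n. 1 / real (Suc n) * (?M \<bullet> x)) \<longlonglongrightarrow> 0 * (?M \<bullet> x)"
      by (intro tendsto_mult tendsto_const LIMSEQ_Suc[OF lim_1_over_n])
    then have lim: "(\<lambda>n. 1 / real (Suc n) * (?M \<bullet> x)) \<longlonglongrightarrow> 0" unfolding mult_zero_left .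
    have "(\<lambda>n. z n \<bullet> x - (\<integral>\<xi>. f \<xi> \<partial>scalar_measure \<mu> x)) \<longlonglongrightarrow> 0"
      by (rule Lim_null_comparison[OF _ lim])
        (use step[OF x] in \<open>simp only: real_norm_def eventually_True\<close>)
    then show "(\<lambda>n. z n \<bullet> x) \<longlonglongrightarrow> (\<integral>\<xi>. f \<xi> \<partial>scalar_measure \<mu> x)" by (simp add: LIM_zero_iff)
  qed
  then show ?thesis by blast
qed

lemma cone_integral_inner:
  fixes f :: "'h sahs \<Rightarrow> real"
  assumes f: "f \<in> borel_measurable cone_borel"
    and C: "\<And>\<xi>. \<xi> \<in> pos_cone - {0} \<Longrightarrow> \<bar>f \<xi>\<bar> \<le> C"
    and x: "x \<in> pos_cone"
  shows "cone_integral \<mu> f \<bullet> x = (\<integral>\<xi>. f \<xi> \<partial>scalar_measure \<mu> x)"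
proof -
  obtain z where z: "\<forall>x\<in>pos_cone. z \<bullet> x = (\<integral>\<xi>. f \<xi> \<partial>scalar_measure \<mu> x)"
    using cone_integral_exists[OF f C] by blast
  have "cone_integral \<mu> f = z"
    unfolding cone_integral_def
  proof (rule the_equality)
    show "\<forall>x\<in>pos_cone. integrable (scalar_measure \<mu> x) f \<and> z \<bullet> x = (\<integral>\<xi>. f \<xi> \<partial>scalar_measure \<mu> x)"
      using z integrable_scalar_measure[OF _ f C] by blast
    fix w assume "\<forall>x\<in>pos_cone. integrable (scalar_measure \<mu> x) f \<and> w \<bullet> x = (\<integral>\<xi>. f \<xi> \<partial>scalar_measure \<mu> x)"
    then show "w = z" using z by (intro pos_cone.inner_eqI) auto
  qed
  then show ?thesis using z x by blast
qed

text \<open>A pointwise bound \<open>c\<close> bounds the difference by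
  \<open>c *\<^sub>R \<mu> (pos_cone - {0})\<close> in the order of the cone, hence in norm.\<close>

lemma norm_cone_integral_diff_le:
  fixes f g :: "'h sahs \<Rightarrow> real"
  assumes f: "f \<in> borel_measurable cone_borel" "\<And>\<xi>. \<xi> \<in> pos_cone - {0} \<Longrightarrow> \<bar>f \<xi>\<bar> \<le> C"
    and g: "g \<in> borel_measurable cone_borel" "\<And>\<xi>. \<xi> \<in> pos_cone - {0} \<Longrightarrow> \<bar>g \<xi>\<bar> \<le> C'"
    and c: "\<And>\<xi>. \<xi> \<in> pos_cone - {0} \<Longrightarrow> \<bar>f \<xi> - g \<xi>\<bar> \<le> c" "0 \<le> c"
  shows "norm (cone_integral \<mu> f - cone_integral \<mu> g) \<le> c * norm (\<mu> (pos_cone - {0}))"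
proof -
  have "norm (cone_integral \<mu> f - cone_integral \<mu> g) \<le> norm (c *\<^sub>R \<mu> (pos_cone - {0}))"
  proof (rule pos_cone.norm_le_of_abs_inner_le)
    fix x :: "'h sahs" assume x: "x \<in> pos_cone"
    have "cone_integral \<mu> f \<bullet> x = (\<integral>\<xi>. f \<xi> \<partial>scalar_measure \<mu> x)"
      "cone_integral \<mu> g \<bullet> x = (\<integral>\<xi>. g \<xi> \<partial>scalar_measure \<mu> x)"
      using cone_integral_inner[OF f x] cone_integral_inner[OF g x] by blast+
    then have "(cone_integral \<mu> f - cone_integral \<mu> g) \<bullet> x = (\<integral>\<xi>. f \<xi> - g \<xi> \<partial>scalar_measure \<mu> x)"
      using integrable_scalar_measure[OF x f] integrable_scalar_measure[OF x g]
      by (simp add: inner_diff_left)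
    then show "\<bar>(cone_integral \<mu> f - cone_integral \<mu> g) \<bullet> x\<bar> \<le> (c *\<^sub>R \<mu> (pos_cone - {0})) \<bullet> x"
      using abs_integral_scalar_measure_le[OF x Bochner_Integration.integrable_diff[OF
            integrable_scalar_measure[OF x f] integrable_scalar_measure[OF x g]] c(1)]
      by simp
  qed
  then show ?thesis using c(2) by simp
qed

end

section \<open>The jump kernel\<close>

text \<open>All three follow from exp z >= 1 + z. The third makes the defect of the linear
  approximation second order, at most y (y - x).\<close>

lemma exp_minus_diff_bounds:
  fixes x y :: real
  assumes "0 \<le> x" "x \<le> y"
  shows "0 \<le> exp (- x) - exp (- y)" "exp (- x) - exp (- y) \<le> y - x"
    "(1 - y) * (y - x) \<le> exp (- x) - exp (- y)"
proof -
  show "0 \<le> exp (- x) - exp (- y)" using assms by simp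
  have "exp (- x) - exp (- y) = exp (- x) * (1 - exp (- (y - x)))"
    by (simp add: right_diff_distrib mult_exp_exp)
  also have "\<dots> \<le> 1 * (y - x)"
  proof (rule mult_mono)
    show "1 - exp (- (y - x)) \<le> y - x" using exp_ge_add_one_self[of "- (y - x)"] by linarith
  qed (use assms in auto)
  finally show "exp (- x) - exp (- y) \<le> y - x" by simp
  have "(1 - y) * (y - x) \<le> exp (- y) * (y - x)"
  proof (rule mult_right_mono)
    show "1 - y \<le> exp (- y)" using exp_ge_add_one_self[of "- y"] by linarith
  qed (use assms in simp)
  also have "\<dots> \<le> exp (- y) * (exp (y - x) - 1)"
  proof (rule mult_left_mono)
    show "y - x \<le> exp (y - x) - 1" using exp_ge_add_one_self[of "y - x"] by linarith
  qed simp
  also have "\<dots> = exp (- x) - exp (- y)" by (simp add: right_diff_distrib mult_exp_exp)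
  finally show "(1 - y) * (y - x) \<le> exp (- x) - exp (- y)" .
qed

text \<open>The compensated exponential shared by \<open>riccati_F\<close> and, after division by
  \<open>(norm \<xi>)\<^sup>2\<close>, by \<open>riccati_R\<close>.\<close>

definition jump_kernel :: "'a::real_inner \<Rightarrow> 'a \<Rightarrow> real" where
  "jump_kernel u \<xi> = exp (- (\<xi> \<bullet> u)) - 1 + trunc \<xi> \<bullet> u"

lemma jump_kernel_zero: "jump_kernel 0 \<xi> = 0"
  by (simp add: jump_kernel_def)

text \<open>Small jumps give a nonnegative value, large ones at least -1. The bound is independent
  of \<open>u\<close>, which keeps the jump part of the energy estimate linear in
  \<open>norm u\<close>.\<close>

lemma jump_kernel_lower:
  assumes "0 \<le> \<xi> \<bullet> u"
  shows "- (norm \<xi>)\<^sup>2 \<le> jump_kernel u \<xi>"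
proof (cases "norm \<xi> \<le> 1")
  case True
  then have "0 \<le> jump_kernel u \<xi>"
    using exp_ge_add_one_self[of "- (\<xi> \<bullet> u)"] by (simp add: jump_kernel_def trunc_def)
  then show ?thesis by (smt (verit) zero_le_power2)
next
  case False
  then have "1 \<le> (norm \<xi>)\<^sup>2" by (simp add: one_le_power)
  moreover have "- 1 \<le> jump_kernel u \<xi>" using False by (simp add: jump_kernel_def trunc_def)
  ultimately show ?thesis by simp
qed

text \<open>For small jumps the compensation gains a second factor \<open>norm \<xi>\<close>; for
  large ones a single factor is already below the square. The constant \<open>1 + r\<close> covers
  both regimes.\<close>

lemma jump_kernel_diff_le:
  assumes "0 \<le> \<xi> \<bullet> u" "0 \<le> \<xi> \<bullet> w" "norm u \<le> r" "norm w \<le> r"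
  shows "\<bar>jump_kernel u \<xi> - jump_kernel w \<xi>\<bar> \<le> (1 + r) * norm (u - w) * (norm \<xi>)\<^sup>2"
proof -
  have *: "\<bar>jump_kernel u \<xi> - jump_kernel w \<xi>\<bar> \<le> (1 + r) * norm (u - w) * (norm \<xi>)\<^sup>2"
    if "0 \<le> \<xi> \<bullet> u" "\<xi> \<bullet> u \<le> \<xi> \<bullet> w" "norm w \<le> r" for u w
  proof -
    let ?x = "\<xi> \<bullet> u" and ?y = "\<xi> \<bullet> w"
    note b = exp_minus_diff_bounds[OF that(1,2)]
    have r: "0 \<le> r" using that(3) norm_ge_zero order_trans by blast
    have diff: "?y - ?x \<le> norm \<xi> * norm (u - w)"
      using norm_cauchy_schwarz[of \<xi> "w - u"] by (simp add: inner_diff_right norm_minus_commute)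
    show ?thesis
    proof (cases "norm \<xi> \<le> 1")
      case True
      have "?y \<le> norm \<xi> * r"
        using norm_cauchy_schwarz[of \<xi> w] mult_left_mono[OF that(3), of "norm \<xi>"] by simp
      then have "?y * (?y - ?x) \<le> (norm \<xi> * r) * (norm \<xi> * norm (u - w))"
        using diff that r by (intro mult_mono) auto
      moreover have "jump_kernel u \<xi> - jump_kernel w \<xi> = exp (- ?x) - exp (- ?y) - (?y - ?x)"
        using True by (simp add: jump_kernel_def trunc_def)
      ultimately have "\<bar>jump_kernel u \<xi> - jump_kernel w \<xi>\<bar> \<le> (norm \<xi> * r) * (norm \<xi> * norm (u - w))"
        using b by (simp add: left_diff_distrib)
      also have "\<dots> = r * norm (u - w) * (norm \<xi>)\<^sup>2" by (simp add: power2_eq_square)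
      also have "\<dots> \<le> (1 + r) * norm (u - w) * (norm \<xi>)\<^sup>2" by (intro mult_right_mono) auto
      finally show ?thesis .
    next
      case False
      have "\<bar>jump_kernel u \<xi> - jump_kernel w \<xi>\<bar> \<le> norm \<xi> * norm (u - w)"
        using b diff False by (simp add: jump_kernel_def trunc_def)
      also have "\<dots> \<le> (norm \<xi>)\<^sup>2 * ((1 + r) * norm (u - w))"
        using False r mult_right_mono[of 1 "1 + r" "norm (u - w)"] self_le_power[of "norm \<xi>" 2]
        by (intro mult_mono) auto
      finally show ?thesis by (simp add: mult_ac)
    qed
  qed
  show ?thesis
  proof (cases "\<xi> \<bullet> u \<le> \<xi> \<bullet> w")
    case True
    then show ?thesis using * assms by blast
  next
    case False
    then show ?thesis using *[of w u] assms by (simp add: abs_minus_commute norm_minus_commute)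
  qed
qed

lemma jump_kernel_abs_le:
  assumes "0 \<le> \<xi> \<bullet> u"
  shows "\<bar>jump_kernel u \<xi>\<bar> \<le> (1 + norm u) * norm u * (norm \<xi>)\<^sup>2"
  using jump_kernel_diff_le[OF assms, of 0 "norm u"] by (simp add: jump_kernel_zero)

text \<open>Through this sign the admissibility conditions yield both the nonnegativity of
  \<open>riccati_F\<close> and quasi-monotonicity.\<close>

lemma jump_kernel_le_trunc: "0 \<le> \<xi> \<bullet> u \<Longrightarrow> jump_kernel u \<xi> \<le> trunc \<xi> \<bullet> u"
  by (simp add: jump_kernel_def)

lemma trunc_inner_measurable [measurable]:
  "(\<lambda>\<xi>. trunc \<xi> \<bullet> u) \<in> borel_measurable (borel :: 'a::real_inner measure)"
proof -
  have "(\<lambda>\<xi>. if norm \<xi> \<le> 1 then \<xi> \<bullet> u else 0) \<in> borel_measurable (borel :: 'a measure)"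
    by measurable
  also have "(\<lambda>\<xi>. if norm \<xi> \<le> 1 then \<xi> \<bullet> u else 0) = (\<lambda>\<xi>. trunc \<xi> \<bullet> u)"
    by (auto simp: trunc_def)
  finally show ?thesis .
qed

lemma jump_kernel_measurable [measurable]:
  "jump_kernel u \<in> borel_measurable (borel :: 'a::real_inner measure)"
  unfolding jump_kernel_def[abs_def] by measurable

lemma borel_imp_cone_borel_measurable:
  "f \<in> borel_measurable borel \<Longrightarrow> f \<in> borel_measurable cone_borel"
  unfolding cone_borel_def by (rule measurable_restrict_space1)

lemma jump_kernel_quotient_abs_le:
  assumes u: "u \<in> pos_cone" and \<xi>: "\<xi> \<in> pos_cone - {0}"
  shows "\<bar>jump_kernel u \<xi> / (norm \<xi>)\<^sup>2\<bar> \<le> (1 + norm u) * norm u"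
proof -
  have "\<bar>jump_kernel u \<xi>\<bar> \<le> (1 + norm u) * norm u * (norm \<xi>)\<^sup>2"
    using assms by (intro jump_kernel_abs_le pos_cone_inner_nonneg) auto
  then show ?thesis using \<xi> by (simp add: abs_divide divide_le_eq)
qed

lemma jump_kernel_quotient_measurable:
  "(\<lambda>\<xi>. jump_kernel u \<xi> / (norm \<xi>)\<^sup>2) \<in> borel_measurable cone_borel"
  by (rule borel_imp_cone_borel_measurable) measurable

section \<open>The Riccati vector fields\<close>

locale admissible_parameters =
  fixes b :: "'h::{real_inner,banach,second_countable_topology} sahs"
    and B :: "'h sahs \<Rightarrow>\<^sub>L 'h sahs"
    and m :: "'h sahs measure"
    and \<mu> :: "'h sahs set \<Rightarrow> 'h sahs"
  assumes admissible: "admissible b B m \<mu>"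
begin

lemma sets_m: "sets m = sets cone_borel"
  and m_second_moment: "(\<integral>\<^sup>+\<xi>. ennreal ((norm \<xi>)\<^sup>2) \<partial>m) < \<infinity>"
  and m_trunc: "(\<integral>\<^sup>+\<xi>. ennreal \<bar>trunc \<xi> \<bullet> h\<bar> \<partial>m) < \<infinity>"
  and m_drift: "v \<in> pos_cone \<Longrightarrow> 0 \<le> b \<bullet> v - (\<integral>\<xi>. trunc \<xi> \<bullet> v \<partial>m)"
  and cone_valued: "cone_valued_measure \<mu>"
  and \<mu>_trunc: "u \<in> pos_cone \<Longrightarrow> x \<in> pos_cone \<Longrightarrow> u \<bullet> x = 0 \<Longrightarrow>
    (\<integral>\<^sup>+\<xi>. ennreal ((trunc \<xi> \<bullet> u) / (norm \<xi>)\<^sup>2) \<partial>scalar_measure \<mu> x) < \<infinity>"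
  and \<mu>_drift: "u \<in> pos_cone \<Longrightarrow> x \<in> pos_cone \<Longrightarrow> u \<bullet> x = 0 \<Longrightarrow>
    0 \<le> adjoint B u \<bullet> x - (\<integral>\<xi>. (trunc \<xi> \<bullet> u) / (norm \<xi>)\<^sup>2 \<partial>scalar_measure \<mu> x)"
  using admissible unfolding admissible_def by blast+

lemma space_m: "space m = pos_cone - {0}"
  using sets_eq_imp_space_eq[OF sets_m] by (simp add: space_cone_borel)

lemma measurable_m: "f \<in> borel_measurable borel \<Longrightarrow> f \<in> borel_measurable m"
  using borel_imp_cone_borel_measurable by (simp add: measurable_cong_sets[OF sets_m refl])

lemma integrable_m_norm: "integrable m (\<lambda>\<xi>. (norm \<xi>)\<^sup>2)"
proof (rule integrableI_bounded)
  show "(\<lambda>\<xi>. (norm \<xi>)\<^sup>2) \<in> borel_measurable m" by (rule measurable_m) measurable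
  show "(\<integral>\<^sup>+\<xi>. ennreal (norm ((norm \<xi>)\<^sup>2)) \<partial>m) < \<infinity>" using m_second_moment by simp
qed

lemma integrable_m_trunc: "integrable m (\<lambda>\<xi>. trunc \<xi> \<bullet> h)"
proof (rule integrableI_bounded)
  show "(\<lambda>\<xi>. trunc \<xi> \<bullet> h) \<in> borel_measurable m" by (rule measurable_m) measurable
  show "(\<integral>\<^sup>+\<xi>. ennreal (norm (trunc \<xi> \<bullet> h)) \<partial>m) < \<infinity>" using m_trunc by simp
qed

lemma integrable_m_jump_kernel:
  assumes u: "u \<in> pos_cone"
  shows "integrable m (jump_kernel u)"
proof (rule Bochner_Integration.integrable_bound)
  show "integrable m (\<lambda>\<xi>. (1 + norm u) * norm u * (norm \<xi>)\<^sup>2)"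
    by (intro integrable_mult_right integrable_m_norm)
  show "jump_kernel u \<in> borel_measurable m" by (rule measurable_m) measurable
  show "AE \<xi> in m. norm (jump_kernel u \<xi>) \<le> norm ((1 + norm u) * norm u * (norm \<xi>)\<^sup>2)"
  proof (rule AE_I2)
    fix \<xi> assume "\<xi> \<in> space m"
    then have "\<bar>jump_kernel u \<xi>\<bar> \<le> (1 + norm u) * norm u * (norm \<xi>)\<^sup>2"
      using u by (intro jump_kernel_abs_le pos_cone_inner_nonneg) (auto simp: space_m)
    then show "norm (jump_kernel u \<xi>) \<le> norm ((1 + norm u) * norm u * (norm \<xi>)\<^sup>2)"
      by (simp add: abs_mult)
  qed
qed

section \<open>The scalar field F: sign and continuity\<close>

lemma riccati_F_eq: "riccati_F b m u = b \<bullet> u - (\<integral>\<xi>. jump_kernel u \<xi> \<partial>m)"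
  by (simp add: riccati_F_def jump_kernel_def)

lemma riccati_F_nonneg:
  assumes u: "u \<in> pos_cone"
  shows "0 \<le> riccati_F b m u"
proof -
  have "(\<integral>\<xi>. jump_kernel u \<xi> \<partial>m) \<le> (\<integral>\<xi>. trunc \<xi> \<bullet> u \<partial>m)"
    using u by (intro integral_mono integrable_m_jump_kernel integrable_m_trunc
        jump_kernel_le_trunc pos_cone_inner_nonneg) (auto simp: space_m)
  then show ?thesis using m_drift[OF u] by (simp add: riccati_F_eq)
qed

lemma riccati_F_continuous: "continuous_on pos_cone (riccati_F b m)"
proof -
  have "continuous_on pos_cone (\<lambda>u. \<integral>\<xi>. jump_kernel u \<xi> \<partial>m)"
    unfolding continuous_on_def
  proof
    fix u :: "'h sahs" assume u: "u \<in> pos_cone"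
    let ?F = "at u within pos_cone" and ?M = "\<integral>\<xi>. (norm \<xi>)\<^sup>2 \<partial>m"
    let ?I = "\<lambda>u. \<integral>\<xi>. jump_kernel u \<xi> \<partial>m"
    have le: "norm (?I w - ?I u) \<le> (1 + (norm w + norm u)) * norm (w - u) * ?M"
      if w: "w \<in> pos_cone" for w
    proof -
      have ptw: "\<bar>jump_kernel w \<xi> - jump_kernel u \<xi>\<bar>
          \<le> (1 + (norm w + norm u)) * norm (w - u) * (norm \<xi>)\<^sup>2" if "\<xi> \<in> space m" for \<xi>
        using that u w by (intro jump_kernel_diff_le pos_cone_inner_nonneg) (auto simp: space_m)
      have int: "integrable m (\<lambda>\<xi>. jump_kernel w \<xi> - jump_kernel u \<xi>)"
        by (intro Bochner_Integration.integrable_diff integrable_m_jump_kernel u w)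
      have "norm (?I w - ?I u) = \<bar>\<integral>\<xi>. jump_kernel w \<xi> - jump_kernel u \<xi> \<partial>m\<bar>"
        using integrable_m_jump_kernel u w by simp
      also have "\<dots> \<le> (\<integral>\<xi>. \<bar>jump_kernel w \<xi> - jump_kernel u \<xi>\<bar> \<partial>m)"
        using integral_norm_bound[of m "\<lambda>\<xi>. jump_kernel w \<xi> - jump_kernel u \<xi>"] by simp
      also have "\<dots> \<le> (\<integral>\<xi>. (1 + (norm w + norm u)) * norm (w - u) * (norm \<xi>)\<^sup>2 \<partial>m)"
        using int ptw by (intro integral_mono integrable_mult_right integrable_m_norm) auto
      finally show ?thesis by simp
    qed
    have "((\<lambda>w. (1 + (norm w + norm u)) * norm (w - u) * ?M)
        \<longlongrightarrow> (1 + (norm u + norm u)) * norm (u - u) * ?M) ?F"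
      by (intro tendsto_intros)
    then have lim: "((\<lambda>w. (1 + (norm w + norm u)) * norm (w - u) * ?M) \<longlongrightarrow> 0) ?F" by simp
    have "((\<lambda>w. ?I w - ?I u) \<longlongrightarrow> 0) ?F"
    proof (rule Lim_null_comparison[OF _ lim])
      show "\<forall>\<^sub>F w in ?F. norm (?I w - ?I u) \<le> (1 + (norm w + norm u)) * norm (w - u) * ?M"
        unfolding eventually_at_topological using le by blast
    qed
    then show "(?I \<longlongrightarrow> ?I u) ?F" by (simp add: LIM_zero_iff)
  qed
  then have "continuous_on pos_cone (\<lambda>u. b \<bullet> u - (\<integral>\<xi>. jump_kernel u \<xi> \<partial>m))"
    by (intro continuous_intros)
  then show ?thesis by (simp add: riccati_F_eq[abs_def])
qed

section \<open>The operator-valued field R\<close>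

definition jumps :: "'h sahs \<Rightarrow> 'h sahs" where
  "jumps u = cone_integral \<mu> (\<lambda>\<xi>. jump_kernel u \<xi> / (norm \<xi>)\<^sup>2)"

lemma jumps_inner:
  assumes "u \<in> pos_cone" "x \<in> pos_cone"
  shows "jumps u \<bullet> x = (\<integral>\<xi>. jump_kernel u \<xi> / (norm \<xi>)\<^sup>2 \<partial>scalar_measure \<mu> x)"
    and "integrable (scalar_measure \<mu> x) (\<lambda>\<xi>. jump_kernel u \<xi> / (norm \<xi>)\<^sup>2)"
  unfolding jumps_def
  using cone_integral_inner[OF cone_valued jump_kernel_quotient_measurable
      jump_kernel_quotient_abs_le[OF assms(1)] assms(2)]
    integrable_scalar_measure[OF cone_valued assms(2) jump_kernel_quotient_measurable
      jump_kernel_quotient_abs_le[OF assms(1)]]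
  by blast+

lemma norm_jumps_diff_le:
  assumes "u \<in> pos_cone" "w \<in> pos_cone" "norm u \<le> r" "norm w \<le> r"
  shows "norm (jumps u - jumps w) \<le> (1 + r) * norm (\<mu> (pos_cone - {0})) * norm (u - w)"
proof -
  have r: "0 \<le> r" using assms(3) norm_ge_zero order_trans by blast
  have ptw: "\<bar>jump_kernel u \<xi> / (norm \<xi>)\<^sup>2 - jump_kernel w \<xi> / (norm \<xi>)\<^sup>2\<bar> \<le> (1 + r) * norm (u - w)"
    if \<xi>: "\<xi> \<in> pos_cone - {0}" for \<xi>
  proof -
    have "\<bar>jump_kernel u \<xi> - jump_kernel w \<xi>\<bar> \<le> (1 + r) * norm (u - w) * (norm \<xi>)\<^sup>2"
      using \<xi> assms by (intro jump_kernel_diff_le pos_cone_inner_nonneg) auto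
    then show ?thesis
      using \<xi> by (simp add: diff_divide_distrib[symmetric] abs_divide divide_le_eq)
  qed
  have "norm (jumps u - jumps w) \<le> (1 + r) * norm (u - w) * norm (\<mu> (pos_cone - {0}))"
    unfolding jumps_def
    using norm_cone_integral_diff_le[OF cone_valued jump_kernel_quotient_measurable
        jump_kernel_quotient_abs_le[OF assms(1)] jump_kernel_quotient_measurable
        jump_kernel_quotient_abs_le[OF assms(2)] ptw] r
    by simp
  then show ?thesis by (simp add: mult_ac)
qed

text \<open>The part of \<open>riccati_R\<close> depending on the second argument alone; the first
  one enters as a known forcing term once \<open>\<psi>\<^sub>1\<close> is solved.\<close>

definition drift :: "'h sahs \<Rightarrow> 'h sahs" where
  "drift u = adjoint B u - jumps u"

lemma drift_lipschitz:
  "\<exists>L. \<forall>u\<in>pos_cone. \<forall>w\<in>pos_cone. norm u \<le> r \<longrightarrow> norm w \<le> r \<longrightarrow>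
      norm (drift u - drift w) \<le> L * norm (u - w)"
proof (intro exI ballI impI)
  fix u w :: "'h sahs" assume uw: "u \<in> pos_cone" "w \<in> pos_cone" "norm u \<le> r" "norm w \<le> r"
  have "drift u - drift w = adjoint B (u - w) - (jumps u - jumps w)"
    by (simp add: drift_def adjoint_hilbert_linear)
  then have "norm (drift u - drift w) \<le> norm (adjoint B (u - w)) + norm (jumps u - jumps w)"
    using norm_triangle_ineq4 by metis
  also have "\<dots> \<le> norm B * norm (u - w) + (1 + r) * norm (\<mu> (pos_cone - {0})) * norm (u - w)"
    by (intro add_mono adjoint_hilbert_norm norm_jumps_diff_le uw)
  finally show "norm (drift u - drift w) \<le> (norm B + (1 + r) * norm (\<mu> (pos_cone - {0}))) * norm (u - w)"
    by (simp add: distrib_right)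
qed

text \<open>For orthogonal \<open>u\<close> and \<open>x\<close> the truncated integral is finite by
  admissibility and dominates the jump integral; the drift condition bounds it in turn by
  \<open>adjoint B u \<bullet> x\<close>.\<close>

lemma drift_quasi_monotone:
  assumes "u \<in> pos_cone" "x \<in> pos_cone" "u \<bullet> x = 0"
  shows "0 \<le> drift u \<bullet> x"
proof -
  let ?t = "\<lambda>\<xi>. (trunc \<xi> \<bullet> u) / (norm \<xi>)\<^sup>2"
  have nonneg: "0 \<le> ?t \<xi>" if "\<xi> \<in> space (scalar_measure \<mu> x)" for \<xi>
  proof -
    have "0 \<le> \<xi> \<bullet> u"
      using that assms(1) by (intro pos_cone_inner_nonneg) (auto simp: space_scalar_measure[OF cone_valued])
    then show ?thesis by (simp add: trunc_def)
  qed
  have "integrable (scalar_measure \<mu> x) ?t"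
  proof (rule integrableI_nonneg)
    have "?t \<in> borel_measurable cone_borel" by (rule borel_imp_cone_borel_measurable) measurable
    then show "?t \<in> borel_measurable (scalar_measure \<mu> x)"
      by (simp add: measurable_cong_sets[OF sets_scalar_measure[OF cone_valued] refl])
    show "AE \<xi> in scalar_measure \<mu> x. 0 \<le> ?t \<xi>" using nonneg by (rule AE_I2)
  qed (rule \<mu>_trunc[OF assms])
  moreover have "jump_kernel u \<xi> / (norm \<xi>)\<^sup>2 \<le> ?t \<xi>" if "\<xi> \<in> space (scalar_measure \<mu> x)" for \<xi>
    using that assms(1) by (intro divide_right_mono jump_kernel_le_trunc pos_cone_inner_nonneg)
      (auto simp: space_scalar_measure[OF cone_valued])
  ultimately have "jumps u \<bullet> x \<le> (\<integral>\<xi>. ?t \<xi> \<partial>scalar_measure \<mu> x)"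
    unfolding jumps_inner(1)[OF assms(1,2)]
    by (intro integral_mono jumps_inner(2) assms)
  then show ?thesis using \<mu>_drift[OF assms] by (simp add: drift_def inner_diff_left)
qed

text \<open>Pairing with \<open>u\<close> makes the jump part an integral against the finite measure
  \<open>scalar_measure \<mu> u\<close>, with integrand at least -1 whatever \<open>s\<close>
  is.\<close>

lemma drift_growth:
  assumes u: "u \<in> pos_cone" and s: "0 \<le> s" "s \<le> 1"
  shows "u \<bullet> drift (s *\<^sub>R u) \<le> norm B * (u \<bullet> u) + norm (\<mu> (pos_cone - {0})) * norm u"
proof -
  let ?N = "scalar_measure \<mu> u"
  interpret N: finite_measure ?N by (rule finite_scalar_measure[OF cone_valued u])
  have su: "s *\<^sub>R u \<in> pos_cone" by (intro pos_cone.scaleR_mem u s)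
  have ptw: "- 1 \<le> jump_kernel (s *\<^sub>R u) \<xi> / (norm \<xi>)\<^sup>2" if \<xi>: "\<xi> \<in> space ?N" for \<xi>
  proof -
    have "- (norm \<xi>)\<^sup>2 \<le> jump_kernel (s *\<^sub>R u) \<xi>"
      using \<xi> by (intro jump_kernel_lower pos_cone_inner_nonneg su)
        (auto simp: space_scalar_measure[OF cone_valued])
    then show ?thesis using \<xi> by (simp add: le_divide_eq space_scalar_measure[OF cone_valued])
  qed
  have "- (\<mu> (pos_cone - {0}) \<bullet> u) = (\<integral>\<xi>. - 1 \<partial>?N)"
    using measure_space_scalar_measure[OF cone_valued u] by simp
  also have "\<dots> \<le> jumps (s *\<^sub>R u) \<bullet> u"
    unfolding jumps_inner(1)[OF su u]
    by (intro integral_mono jumps_inner(2) su u ptw) auto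
  finally have 1: "- (u \<bullet> jumps (s *\<^sub>R u)) \<le> \<mu> (pos_cone - {0}) \<bullet> u" by (simp add: inner_commute)
  also have "\<dots> \<le> norm (\<mu> (pos_cone - {0})) * norm u" by (rule norm_cauchy_schwarz)
  finally have 2: "- (u \<bullet> jumps (s *\<^sub>R u)) \<le> \<dots>" .
  have "u \<bullet> adjoint B (s *\<^sub>R u) = s * (u \<bullet> adjoint B u)" by (simp add: adjoint_hilbert_linear)
  also have "\<dots> \<le> \<bar>s * (u \<bullet> adjoint B u)\<bar>" by simp
  also have "\<dots> = s * \<bar>u \<bullet> adjoint B u\<bar>" using s by (simp add: abs_mult)
  also have "\<dots> \<le> 1 * (norm u * norm (adjoint B u))"
    using s by (intro mult_mono Cauchy_Schwarz_ineq2) auto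
  also have "\<dots> \<le> 1 * (norm u * (norm B * norm u))"
    by (intro mult_left_mono adjoint_hilbert_norm) auto
  also have "\<dots> = norm B * (u \<bullet> u)" by (simp add: power2_norm_eq_inner[symmetric] power2_eq_square)
  finally show ?thesis using 2 by (simp add: drift_def inner_diff_right)
qed

text \<open>The imaginary units square to -1, so the quadratic term becomes a positive multiple of a
  rank-one square.\<close>

lemma riccati_R_eq:
  "riccati_R B D \<mu> (0, v) u = drift u + (1 / 2) *\<^sub>R sq (op_sqrt D v)"
proof -
  have "tensor 0 0 = (0 :: 'h \<Rightarrow>\<^sub>L 'h)" by (auto intro!: blinfun_eqI simp: tensor_apply)
  then have "fst (ctensor (cext (op_sqrt D) (0, v)) (cext (op_sqrt D) (0, v)))
      = op_of (- sq (op_sqrt D v))"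
    by (simp add: ctensor_def cext_def op_of_uminus op_of_sq)
  then have "Abs_sahs (fst (ctensor (cext (op_sqrt D) (0, v)) (cext (op_sqrt D) (0, v))))
      = - sq (op_sqrt D v)"
    by (simp add: op_of_inverse)
  then show ?thesis
    by (simp add: riccati_R_def drift_def jumps_def jump_kernel_def)
qed

end

lemma imag_space_iff: "z \<in> imag_space \<longleftrightarrow> fst z = 0"
  by (cases z) (auto simp: imag_space_def imul_def of_re_def image_iff)

context semigroup_generator
begin

text \<open>The real part of \<psi> vanishes, so i times its integral is the real vector
  \<open>- w\<close>. The weak form on the right contains the domain condition, since it exhibits a
  representing vector.\<close>

lemma adjoint_mild_equation_iff:
  fixes \<psi> :: "real \<Rightarrow> 'h complexified"
  assumes \<psi>: "continuous_on {0..T} \<psi>" "\<And>t. t \<in> {0..T} \<Longrightarrow> \<psi> t \<in> imag_space"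
    and t: "t \<in> {0..T}"
  shows "imul (integral {0..t} \<psi>) \<in> of_re ` adjoint_dom A domA \<and>
      \<psi> t = (0, a) - imul (cext (adjoint_on A domA) (imul (integral {0..t} \<psi>)))
    \<longleftrightarrow> (\<forall>x\<in>domA. A x \<bullet> integral {0..t} (\<lambda>s. snd (\<psi> s)) = x \<bullet> (snd (\<psi> t) - a))"
    (is "?L \<longleftrightarrow> ?R")
proof -
  define w where "w = integral {0..t} (\<lambda>s. snd (\<psi> s))"
  have int: "\<psi> integrable_on {0..t}"
    using t by (intro integrable_continuous_real continuous_on_subset[OF \<psi>(1)]) auto
  have "fst (integral {0..t} \<psi>) = integral {0..t} (\<lambda>s. fst (\<psi> s))"
    using integral_linear[OF int bounded_linear_fst] by (simp add: o_def)
  also have "\<dots> = integral {0..t} (\<lambda>s. 0)"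
    using \<psi>(2) t by (intro integral_cong) (auto simp: imag_space_iff)
  finally have "fst (integral {0..t} \<psi>) = 0" by simp
  moreover have "snd (integral {0..t} \<psi>) = w"
    unfolding w_def using integral_linear[OF int bounded_linear_snd] by (simp add: o_def)
  ultimately have I: "imul (integral {0..t} \<psi>) = (- w, 0)" by (simp add: imul_def)
  \<comment> \<open>\<open>cext\<close> applies the adjoint to the zero imaginary part as well, so
    its value there is needed.\<close>
  have zero: "adjoint_on A domA 0 = 0" by (rule adjoint_domI(2)) simp
  have \<psi>t: "\<psi> t = (0, snd (\<psi> t))" using \<psi>(2)[OF t] by (simp add: imag_space_iff prod_eq_iff)
  have "?L \<longleftrightarrow> - w \<in> adjoint_dom A domA \<and> snd (\<psi> t) = a - adjoint_on A domA (- w)"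
    unfolding I by (subst \<psi>t) (auto simp: of_re_def cext_def imul_def zero image_iff)
  also have "\<dots> \<longleftrightarrow> ?R"
    unfolding w_def[symmetric]
  proof
    assume "- w \<in> adjoint_dom A domA \<and> snd (\<psi> t) = a - adjoint_on A domA (- w)"
    then show "\<forall>x\<in>domA. A x \<bullet> w = x \<bullet> (snd (\<psi> t) - a)"
      using adjoint_domD[of "- w"] by (force simp: inner_diff_right)
  next
    assume *: "\<forall>x\<in>domA. A x \<bullet> w = x \<bullet> (snd (\<psi> t) - a)"
    then have "A x \<bullet> (- w) = x \<bullet> (a - snd (\<psi> t))" if "x \<in> domA" for x
      using that by (simp add: inner_diff_right)
    from adjoint_domI[OF this]
    show "- w \<in> adjoint_dom A domA \<and> snd (\<psi> t) = a - adjoint_on A domA (- w)" by simp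
  qed
  finally show ?thesis .
qed

end

theorem proposition3p2:
  fixes b :: "'h::{real_inner,banach,second_countable_topology} sahs"
    and B :: "'h sahs \<Rightarrow>\<^sub>L 'h sahs"
    and m :: "'h sahs measure"
    and \<mu> :: "'h sahs set \<Rightarrow> 'h sahs"
    and A :: "'h \<Rightarrow> 'h" and domA :: "'h set"
    and D :: "'h \<Rightarrow>\<^sub>L 'h"
  assumes infinite_dimensional: "\<not> (\<exists>X::'h set. finite X \<and> span X = UNIV)"
    and admissible: "admissible b B m \<mu>"
    and generator: "\<exists>S. c0_semigroup S \<and> generates A domA S"
    and D: "positive_op D" "selfadjoint_op D"
  shows "\<forall>u\<^sub>1\<in>imag_space. \<forall>u\<^sub>2\<in>pos_cone. \<forall>T\<ge>0.
    \<exists>\<Phi> \<psi>\<^sub>1 \<psi>\<^sub>2. mild_solution b B m \<mu> A domA D u\<^sub>1 u\<^sub>2 T \<Phi> \<psi>\<^sub>1 \<psi>\<^sub>2 \<and>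
      (\<forall>\<Phi>' \<psi>\<^sub>1' \<psi>\<^sub>2'. mild_solution b B m \<mu> A domA D u\<^sub>1 u\<^sub>2 T \<Phi>' \<psi>\<^sub>1' \<psi>\<^sub>2' \<longrightarrow>
        (\<forall>t\<in>{0..T}. \<Phi>' t = \<Phi> t \<and> \<psi>\<^sub>1' t = \<psi>\<^sub>1 t \<and> \<psi>\<^sub>2' t = \<psi>\<^sub>2 t))"
proof (intro ballI allI impI)
  fix u\<^sub>1 :: "'h complexified" and u\<^sub>2 :: "'h sahs" and T :: real
  assume u\<^sub>1: "u\<^sub>1 \<in> imag_space" and u\<^sub>2: "u\<^sub>2 \<in> pos_cone" and T: "0 \<le> T"
  interpret admissible_parameters b B m \<mu> by standard (rule admissible)
  obtain S where "c0_semigroup S" "generates A domA S" using generator by blast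
  then interpret semigroup_generator S A domA by unfold_locales

  \<comment> \<open>Construction of a solution\<close>
  define a where "a = snd u\<^sub>1"
  have u\<^sub>1_eq: "u\<^sub>1 = (0, a)" using u\<^sub>1 by (simp add: imag_space_iff a_def prod_eq_iff)
  define v where "v t = adjoint (S t) a" for t
  define c where "c t = (1 / 2) *\<^sub>R sq (op_sqrt D (v t))" for t
  have v_cont: "continuous_on {0..T} v" unfolding v_def by (rule adjoint_continuous)
  have c_cont: "continuous_on {0..T} c"
    unfolding c_def by (intro continuous_intros continuous_on_compose2[OF sq_continuous] v_cont) auto
  have c_mem: "c t \<in> pos_cone" for t
    unfolding c_def by (intro pos_cone.scaleR_mem sq_mem_pos_cone) simp
  have S0_adj: "adjoint (S 0) a = a"
    by (rule inner_left_eqI) (simp add: adjoint_works_hilbert[symmetric] S_0)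
  \<comment> \<open>The growth constants are \<open>norm B\<close> and the norm of the total mass
    \<open>\<mu> (pos_cone - {0})\<close>, as in \<open>drift_growth\<close>.\<close>
  obtain \<psi> where \<psi>0: "\<psi> 0 = u\<^sub>2" and \<psi>_mem: "\<And>t. t \<in> {0..T} \<Longrightarrow> \<psi> t \<in> pos_cone"
    and \<psi>_der: "\<And>t. t \<in> {0..T} \<Longrightarrow> (\<psi> has_vector_derivative drift (\<psi> t) + c t) (at t within {0..T})"
    using pos_cone.cone_ode_exists[OF T drift_lipschitz drift_quasi_monotone drift_growth
        norm_ge_zero norm_ge_zero c_cont c_mem u\<^sub>2] by blast
  have \<psi>_cont: "continuous_on {0..T} \<psi>"
    unfolding continuous_on_eq_continuous_within
    using has_vector_derivative_continuous[OF \<psi>_der] by blast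
  have drift_cont: "continuous_on {0..T} (\<lambda>t. drift (\<psi> t))"
  proof -
    have "bounded (\<psi> ` {0..T})"
      by (intro compact_imp_bounded compact_continuous_image \<psi>_cont compact_Icc)
    then obtain r where r: "\<And>t. t \<in> {0..T} \<Longrightarrow> norm (\<psi> t) \<le> r" unfolding bounded_iff by blast
    obtain L where L: "\<forall>u\<in>pos_cone. \<forall>w\<in>pos_cone. norm u \<le> r \<longrightarrow> norm w \<le> r \<longrightarrow>
        norm (drift u - drift w) \<le> L * norm (u - w)" using drift_lipschitz by blast
    have "\<bar>L\<bar>-lipschitz_on (pos_cone \<inter> cball 0 r) drift"
    proof (rule lipschitz_onI)
      fix u w :: "'h sahs" assume "u \<in> pos_cone \<inter> cball 0 r" "w \<in> pos_cone \<inter> cball 0 r"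
      then have "dist (drift u) (drift w) \<le> L * dist u w" using L by (simp add: dist_norm)
      also have "\<dots> \<le> \<bar>L\<bar> * dist u w" by (intro mult_right_mono) auto
      finally show "dist (drift u) (drift w) \<le> \<bar>L\<bar> * dist u w" .
    qed simp
    then show ?thesis
      by (intro continuous_on_compose2[OF lipschitz_on_continuous_on \<psi>_cont])
        (use \<psi>_mem r in auto)
  qed
  define \<Phi> where "\<Phi> t = integral {0..t} (\<lambda>s. riccati_F b m (\<psi> s))" for t
  have F_cont: "continuous_on {0..T} (\<lambda>t. riccati_F b m (\<psi> t))"
    by (rule continuous_on_compose2[OF riccati_F_continuous \<psi>_cont]) (use \<psi>_mem in auto)
  have \<Phi>_der: "(\<Phi> has_vector_derivative riccati_F b m (\<psi> t)) (at t within {0..T})"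
    if "t \<in> {0..T}" for t
    unfolding \<Phi>_def by (rule integral_has_vector_derivative[OF F_cont that])
  have v_imag: "(0, v t) \<in> imag_space" for t by (simp add: imag_space_iff)
  have \<psi>\<^sub>1_cont: "continuous_on {0..T} (\<lambda>t. (0 :: 'h, v t))" by (intro continuous_intros v_cont)
  have "mild_solution b B m \<mu> A domA D u\<^sub>1 u\<^sub>2 T \<Phi> (\<lambda>t. (0, v t)) \<psi>"
    unfolding mild_solution_def
  proof (intro conjI ballI)
    show "C1_on_interval T \<Phi>"
      unfolding C1_on_interval_def using F_cont \<Phi>_der by blast
    show "C1_on_interval T \<psi>"
      unfolding C1_on_interval_def
      using continuous_on_add[OF drift_cont c_cont] \<psi>_der
      by (intro exI[of _ "\<lambda>t. drift (\<psi> t) + c t"]) auto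
    show "0 \<le> \<Phi> t" if "t \<in> {0..T}" for t
      unfolding \<Phi>_def using that \<psi>_mem
      by (intro Henstock_Kurzweil_Integration.integral_nonneg integrable_continuous_real
          continuous_on_subset[OF F_cont] riccati_F_nonneg) auto
    show "continuous_on {0..T} (\<lambda>t. (0 :: 'h, v t))" by (rule \<psi>\<^sub>1_cont)
    show "\<Phi> 0 = 0" by (simp add: \<Phi>_def)
    show "(0, v 0) = u\<^sub>1" by (simp add: v_def S0_adj u\<^sub>1_eq)
    fix t assume t: "t \<in> {0..T}"
    have "\<forall>x\<in>domA. A x \<bullet> integral {0..t} (\<lambda>s. snd (0, v s)) = x \<bullet> (snd (0, v t) - a)"
      using adjoint_orbit_integral_equation t by (simp add: v_def)
    then show "imul (integral {0..t} (\<lambda>t. (0, v t))) \<in> of_re ` adjoint_dom A domA"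
      "(0, v t) = u\<^sub>1 - imul (cext (adjoint_on A domA) (imul (integral {0..t} (\<lambda>t. (0, v t)))))"
      using adjoint_mild_equation_iff[OF \<psi>\<^sub>1_cont v_imag t, of a] unfolding u\<^sub>1_eq by blast+
  qed (use \<psi>_mem \<psi>0 v_imag \<Phi>_der \<psi>_der in \<open>auto simp: riccati_R_eq c_def\<close>)

  \<comment> \<open>Uniqueness\<close>
  moreover have "\<forall>t\<in>{0..T}. \<Phi>' t = \<Phi> t \<and> \<psi>\<^sub>1' t = (0, v t) \<and> \<psi>\<^sub>2' t = \<psi> t"
    if sol: "mild_solution b B m \<mu> A domA D u\<^sub>1 u\<^sub>2 T \<Phi>' \<psi>\<^sub>1' \<psi>\<^sub>2'" for \<Phi>' \<psi>\<^sub>1' \<psi>\<^sub>2'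
  proof -
    have C1_cont: "continuous_on {0..T} f" if "C1_on_interval T f" for f :: "real \<Rightarrow> 'x::real_normed_vector"
      using that unfolding C1_on_interval_def continuous_on_eq_continuous_within
      by (metis has_vector_derivative_continuous)
    have \<psi>\<^sub>1': "continuous_on {0..T} \<psi>\<^sub>1'" "\<And>t. t \<in> {0..T} \<Longrightarrow> \<psi>\<^sub>1' t \<in> imag_space"
      "\<And>t. t \<in> {0..T} \<Longrightarrow> imul (integral {0..t} \<psi>\<^sub>1') \<in> of_re ` adjoint_dom A domA \<and>
        \<psi>\<^sub>1' t = (0, a) - imul (cext (adjoint_on A domA) (imul (integral {0..t} \<psi>\<^sub>1')))"
      using sol unfolding mild_solution_def u\<^sub>1_eq by blast+
    have eq1: "\<psi>\<^sub>1' t = (0, v t)" if t: "t \<in> {0..T}" for t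
    proof -
      have cont: "continuous_on {0..T} (\<lambda>t. snd (\<psi>\<^sub>1' t))" by (intro continuous_intros \<psi>\<^sub>1')
      \<comment> \<open>The initial value \<open>a\<close> cancels in the difference, which
        therefore solves the homogeneous equation.\<close>
      have "snd (\<psi>\<^sub>1' t) - v t = 0"
      proof (rule adjoint_integral_equation_unique[OF _ _ t])
        show "continuous_on {0..T} (\<lambda>t. snd (\<psi>\<^sub>1' t) - v t)" by (intro continuous_intros cont v_cont)
        fix r x assume r: "r \<in> {0..T}" and x: "x \<in> domA"
        have "integral {0..r} (\<lambda>t. snd (\<psi>\<^sub>1' t) - v t) = integral {0..r} (\<lambda>t. snd (\<psi>\<^sub>1' t)) - integral {0..r} v"
          using r by (intro integral_diff integrable_continuous_real
              continuous_on_subset[OF cont] continuous_on_subset[OF v_cont]) auto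
        moreover have "A x \<bullet> integral {0..r} (\<lambda>t. snd (\<psi>\<^sub>1' t)) = x \<bullet> (snd (\<psi>\<^sub>1' r) - a)"
          using adjoint_mild_equation_iff[OF \<psi>\<^sub>1'(1,2) r, of a] \<psi>\<^sub>1'(3)[OF r] x by blast
        moreover have "A x \<bullet> integral {0..r} v = x \<bullet> (v r - a)"
          using adjoint_orbit_integral_equation[OF x, of r a] r by (simp add: v_def[abs_def])
        ultimately show "A x \<bullet> integral {0..r} (\<lambda>t. snd (\<psi>\<^sub>1' t) - v t) = x \<bullet> (snd (\<psi>\<^sub>1' r) - v r)"
          by (simp add: inner_diff_right)
      qed
      then show ?thesis using \<psi>\<^sub>1'(2)[OF t] by (simp add: imag_space_iff prod_eq_iff)
    qed
    have \<psi>\<^sub>2': "C1_on_interval T \<psi>\<^sub>2'" "\<And>t. t \<in> {0..T} \<Longrightarrow> \<psi>\<^sub>2' t \<in> pos_cone" "\<psi>\<^sub>2' 0 = u\<^sub>2"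
      "\<And>t. t \<in> {0<..T} \<Longrightarrow>
        (\<psi>\<^sub>2' has_vector_derivative riccati_R B D \<mu> (\<psi>\<^sub>1' t) (\<psi>\<^sub>2' t)) (at t within {0..T})"
      using sol unfolding mild_solution_def by blast+
    \<comment> \<open>Agreement of the first components makes the forcing \<open>c\<close> the same
      for both.\<close>
    have eq2: "\<psi>\<^sub>2' t = \<psi> t" if t: "t \<in> {0..T}" for t
    proof (rule pos_cone.cone_ode_unique[OF drift_lipschitz _ _ _ \<psi>_cont \<psi>_mem _ _ t, where c=c])
      show "continuous_on {0..T} \<psi>\<^sub>2'" by (rule C1_cont[OF \<psi>\<^sub>2'(1)])
      show "\<psi>\<^sub>2' 0 = \<psi> 0" by (simp add: \<psi>\<^sub>2' \<psi>0)
      fix s assume s: "0 < s" "s < T"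
      show "(\<psi>\<^sub>2' has_vector_derivative drift (\<psi>\<^sub>2' s) + c s) (at s)"
        using \<psi>\<^sub>2'(4)[of s] eq1[of s] s by (simp add: riccati_R_eq c_def at_within_Icc_at)
      show "(\<psi> has_vector_derivative drift (\<psi> s) + c s) (at s)"
        using \<psi>_der[of s] s by (simp add: at_within_Icc_at)
    qed (rule \<psi>\<^sub>2'(2))
    have \<Phi>': "C1_on_interval T \<Phi>'" "\<Phi>' 0 = 0"
      "\<And>t. t \<in> {0<..T} \<Longrightarrow> (\<Phi>' has_vector_derivative riccati_F b m (\<psi>\<^sub>2' t)) (at t within {0..T})"
      using sol unfolding mild_solution_def by blast+
    have "\<Phi>' t = \<Phi> t" if t: "t \<in> {0..T}" for t
    proof -
      \<comment> \<open>The equation is given only for positive times, hence the fundamental theorem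
        with derivatives in the interior and continuity up to the endpoints.\<close>
      have "((\<lambda>s. riccati_F b m (\<psi> s)) has_integral \<Phi>' t - \<Phi>' 0) {0..t}"
      proof (rule fundamental_theorem_of_calculus_interior)
        show "0 \<le> t" using t by simp
        show "continuous_on {0..t} \<Phi>'"
          using t by (intro continuous_on_subset[OF C1_cont[OF \<Phi>'(1)]]) auto
        fix s assume s: "s \<in> {0<..<t}"
        then show "(\<Phi>' has_vector_derivative riccati_F b m (\<psi> s)) (at s)"
          using \<Phi>'(3)[of s] eq2[of s] t by (simp add: at_within_Icc_at)
      qed
      then show ?thesis using \<Phi>'(2) by (simp add: \<Phi>_def integral_unique)
    qed
    then show ?thesis using eq1 eq2 by blast
  qed
  ultimately show "\<exists>\<Phi> \<psi>\<^sub>1 \<psi>\<^sub>2. mild_solution b B m \<mu> A domA D u\<^sub>1 u\<^sub>2 T \<Phi> \<psi>\<^sub>1 \<psi>\<^sub>2 \<and>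
      (\<forall>\<Phi>' \<psi>\<^sub>1' \<psi>\<^sub>2'. mild_solution b B m \<mu> A domA D u\<^sub>1 u\<^sub>2 T \<Phi>' \<psi>\<^sub>1' \<psi>\<^sub>2' \<longrightarrow>
        (\<forall>t\<in>{0..T}. \<Phi>' t = \<Phi> t \<and> \<psi>\<^sub>1' t = \<psi>\<^sub>1 t \<and> \<psi>\<^sub>2' t = \<psi>\<^sub>2 t))"
    by blast
qed

end
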